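(* The Jacobian SKP (JSKP) and the Manin–Radul SKP (MRSKP) hierarchies are special cases of the maximal SKP hierarchy. Precisely, let $\{t_n\}_{n\ge1}$ be variables with $t_{2n}$ even and $t_{2n+1}$ odd. (J) Under the substitution $t^+_{2n}=t^-_{2n}=t_{2n}$, $t^-_{2n+1}=0$, $t^+_{2n+1}=t_{2n+1}$, the operator $U_M$ becomes $U_J=\exp\sum_{n\ge0}\big(t_{2(n+1)}\partial_x^{n+1}+t_{2n+1}\partial_x^n\partial_\xi\big)$; and if $S\in\widehat\Gamma_0$ satisfies $(S\,U_M\,S_0^{-1})_-=0$ for some time-independent $S_0\in\Gamma_0$, then after this substitution $S$ satisfies the JSKP hierarchy $$\partial_{t_{2n}}S=-(S\partial_x^nS^{-1})_-S\ (n\ge1),\qquad \partial_{t_{2n+1}}S=-(S\partial_x^n\partial_\xi S^{-1})_-S\ (n\ge0).$$ (MR) Under the substitution $t^+_{2n}=t^-_{2n}=t_{2n}$, $t^+_{2n+1}=t^-_{2n+1}=t_{2n+1}$, the operator $U_M$ becomes $U_{MR}=\exp\sum_{n\ge1}t_nD^n$; and if $S\in\widehat\Gamma_0$ satisfies $(S\,U_M\,S_0^{-1})_-=0$ for some time-independent $S_0\in\Gamma_0$, then after this substitution $S$ satisfies the MRSKP hierarchy $D_nS=-(SD^nS^{-1})_-S$ for all $n\ge1$, where $D_{2n}=\partial_{t_{2n}}$ and $D_{2n+1}=\partial_{t_{2n+1}}-\sum_{m\ge0}t_{2m+1}\partial_{t_{2(n+m+1)}}$.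
   Context: Operators. Let $\mathcal A$ be a supercommutative $\mathbf C$-superalgebra and $R=\mathcal A\otimes\mathbf C[[x,\xi]]$ with $x$ even, $\xi$ odd, $\xi^2=0$; $D=\partial_\xi+\xi\partial_x$, so $D^2=\partial_x$, $\partial_\xi=D-\xi D^2$, $D^{-1}=\partial_x^{-1}D$. Super-pseudodifferential operators are series $P=\sum_{j<\infty}p_jD^j$, $p_j\in R$ (finitely many positive powers, arbitrarily many negative ones), multiplied via $D^mf=\sum_{r\ge0}{m\brack r}(-1)^{|f|(m-r)}f^{[r]}D^{m-r}$ for homogeneous $f\in R$ and $m\in\mathbf Z$, where $|f|$ is the parity, $f^{[r]}=D^r(f)$, and ${m\brack r}=0$ if $r(m-r)$ is odd, ${m\brack r}=\binom{\lfloor m/2\rfloor}{\lfloor r/2\rfloor}$ otherwise. They form the algebra $\mathcal E$. $\Gamma_0\subset\mathcal E$ is the group of operators $1+\sum_{j\ge1}s_{-j}D^{-j}$ with $s_{-j}$ of parity $j$ mod 2. Time variables. $\{t^+_n\}_{n\ge1}$ and $\{t^-_n\}_{n\ge1}$: $t^\pm_{2n}$ are even, $t^\pm_{2n+1}$ are odd. Give $t_n^\pm$ (and $t_n$) weight $n$. The time-dependent operator algebra $\widehat{\mathcal E}$ consists of formal sums $P=\sum_{n\in\mathbf Z}p_nD^n$ with $p_n\in R[[t]]$ (formal power series in the time variables in question) such that for some constant $C$ every monomial in the $t$'s occurring in $p_n$ has weight $\ge n-C$, for all $n$; the multiplication is by the same rule. $P_-=\sum_{n<0}p_nD^n$. $\widehat\Gamma_0$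 is the set of operators $1+\sum_{j\ge1}s_{-j}D^{-j}$ with $s_{-j}\in R[[t]]$ of parity $j$ mod 2. Maximal time evolution operator: $U_M=e^{H_{(1)}}e^{H_{(0)}}$ with $$H_{(1)}=\sum_{n\ge0}\big(t^+_{2n+1}\partial_\xi\partial_x^n+t^-_{2n+1}\xi\partial_x^{n+1}\big),\qquad H_{(0)}=\sum_{n\ge1}\big(t^+_{2n}\,\partial_\xi\xi\,\partial_x^{n}+t^-_{2n}\,\xi\partial_\xi\,\partial_x^{n}\big).$$ The maximal SKP hierarchy is the evolution of $S$ determined by $(S\,U_M\,S_0^{-1})_-=0$. *)

theory Defs
  imports Complex_Main "HOL-Library.Multiset" "HOL-Library.Function_Algebras"
begin

section \<open>Supercommutative superalgebras over the complex numbers\<close>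

text \<open>
  Parities are booleans (\<open>True\<close> is odd), and \<open>p \<noteq> q\<close> is the sum of the parities \<open>p\<close> and \<open>q\<close>.
  The algebra is unital and the zero algebra is allowed, hence \<open>ring + monoid_mult\<close> and
  not \<open>ring_1\<close>.
\<close>

class supercommutative_algebra = ring + monoid_mult +
  fixes scaleC :: "complex \<Rightarrow> 'a \<Rightarrow> 'a"
    and hpart :: "bool \<Rightarrow> 'a set"
  assumes scaleC_add_right: "scaleC c (a + b) = scaleC c a + scaleC c b"
    and scaleC_add_left: "scaleC (c + d) a = scaleC c a + scaleC d a"
    and scaleC_scaleC: "scaleC c (scaleC d a) = scaleC (c * d) a"
    and scaleC_one: "scaleC 1 a = a"
    and mult_scaleC_left: "scaleC c a * b = scaleC c (a * b)"
    and mult_scaleC_right: "a * scaleC c b = scaleC c (a * b)"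
    and hpart_zero: "0 \<in> hpart p"
    and hpart_add: "a \<in> hpart p \<Longrightarrow> b \<in> hpart p \<Longrightarrow> a + b \<in> hpart p"
    and hpart_scaleC: "a \<in> hpart p \<Longrightarrow> scaleC c a \<in> hpart p"
    and hpart_decomposition:
      "\<exists>!u. fst u \<in> hpart False \<and> snd u \<in> hpart True \<and> a = fst u + snd u"
    and hpart_one: "1 \<in> hpart False"
    and hpart_mult: "a \<in> hpart p \<Longrightarrow> b \<in> hpart q \<Longrightarrow> a * b \<in> hpart (p \<noteq> q)"
    and supercommute:
      "a \<in> hpart p \<Longrightarrow> b \<in> hpart q \<Longrightarrow> a * b = (if p \<and> q then - (b * a) else b * a)"

text \<open>The grading involution, \<open>a \<mapsto> (-1)\<^sup>|\<^sup>a\<^sup>| a\<close> on homogeneous elements.\<close>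

definition grinv :: "'a::supercommutative_algebra \<Rightarrow> 'a" where
  "grinv a = (THE b. \<exists>u\<in>hpart False. \<exists>v\<in>hpart True. a = u + v \<and> b = u - v)"

definition signed :: "bool \<Rightarrow> 'a::uminus \<Rightarrow> 'a" where
  "signed p a = (if p then - a else a)"


section \<open>Variables and monomials\<close>

text \<open>
  \<open>X\<close> and \<open>Xi\<close> are the space variables; \<open>T n\<close>, \<open>Tp n\<close>, \<open>Tm n\<close> stand for
  \<open>t\<^sub>n\<close>, \<open>t\<^sup>+\<^sub>n\<close>, \<open>t\<^sup>-\<^sub>n\<close>. Only the indices \<open>n \<ge> 1\<close> occur, see \<open>times_pm\<close> and \<open>times_std\<close>.
\<close>

datatype var = X | Xi | T nat | Tp nat | Tm nat

fun vodd :: "var \<Rightarrow> bool" where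
  "vodd X = False"
| "vodd Xi = True"
| "vodd (T n) = odd n"
| "vodd (Tp n) = odd n"
| "vodd (Tm n) = odd n"

fun weight :: "var \<Rightarrow> nat" where
  "weight X = 0"
| "weight Xi = 0"
| "weight (T n) = n"
| "weight (Tp n) = n"
| "weight (Tm n) = n"

definition times_pm :: "var set" where
  "times_pm = Tp ` {1..} \<union> Tm ` {1..}"

definition times_std :: "var set" where
  "times_std = T ` {1..}"

text \<open>
  A linear order on the variables fixes the normal form of products of odd variables. The choice
  is immaterial, except that \<open>X\<close> and \<open>Xi\<close> precede the time variables, so that series in the
  time variables have their coefficients in \<open>R\<close> on the left.
\<close>

fun vrank :: "var \<Rightarrow> nat" where
  "vrank X = 0"
| "vrank Xi = 1"
| "vrank (T n) = 3 * n + 2"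
| "vrank (Tp n) = 3 * n + 3"
| "vrank (Tm n) = 3 * n + 4"

lemma vrank_inject: "vrank u = vrank v \<Longrightarrow> u = v"
  by (cases u; cases v; simp; presburger)

instantiation var :: linorder
begin

definition less_eq_var :: "var \<Rightarrow> var \<Rightarrow> bool" where
  "u \<le> v \<longleftrightarrow> vrank u \<le> vrank v"

definition less_var :: "var \<Rightarrow> var \<Rightarrow> bool" where
  "u < v \<longleftrightarrow> vrank u < vrank v"

instance
  by standard (auto simp: less_eq_var_def less_var_def intro: vrank_inject)

end

text \<open>
  A monomial is a multiset of variables without repeated odd variables; it denotes the product of
  its elements in increasing order.
\<close>

type_synonym mono = "var multiset"

definition legal :: "mono \<Rightarrow> bool" where
  "legal m \<longleftrightarrow> (\<forall>v. vodd v \<longrightarrow> count m v \<le> 1)"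

definition mpar :: "mono \<Rightarrow> bool" where
  "mpar m \<longleftrightarrow> odd (size (filter_mset vodd m))"

definition mweight :: "mono \<Rightarrow> nat" where
  "mweight m = sum_mset (image_mset weight m)"

text \<open>The sign of sorting the product of the monomials \<open>k\<close> and \<open>l\<close> (for legal \<open>k + l\<close>).\<close>

definition msign :: "mono \<Rightarrow> mono \<Rightarrow> bool" where
  "msign k l \<longleftrightarrow> odd (card {(u, v). u \<in># k \<and> v \<in># l \<and> vodd u \<and> vodd v \<and> v < u})"


section \<open>Formal power series\<close>

text \<open>
  \<open>f\<close> denotes the sum of the \<open>f m \<cdot> m\<close> over all legal monomials \<open>m\<close>, with the
  coefficient on the left; members of the sets of series below vanish on monomials that are
  not legal.
\<close>

type_synonym 'a ser = "mono \<Rightarrow> 'a"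

definition sconst :: "'a \<Rightarrow> 'a::supercommutative_algebra ser" where
  "sconst a = (\<lambda>m. if m = {#} then a else 0)"

definition svar :: "var \<Rightarrow> 'a::supercommutative_algebra ser" where
  "svar v = (\<lambda>m. if m = {#v#} then 1 else 0)"

definition smult :: "'a::supercommutative_algebra ser \<Rightarrow> 'a ser \<Rightarrow> 'a ser" where
  "smult f g = (\<lambda>m. if legal m then
     (\<Sum>k | k \<subseteq># m. signed (msign k (m - k))
        (f k * (if mpar k then grinv (g (m - k)) else g (m - k)))) else 0)"

definition has_parity :: "bool \<Rightarrow> 'a::supercommutative_algebra ser \<Rightarrow> bool" where
  "has_parity p f \<longleftrightarrow> (\<forall>m. f m \<in> hpart (p \<noteq> mpar m))"

text \<open>\<open>f \<mapsto> (-1)\<^sup>|\<^sup>f\<^sup>| f\<close> on homogeneous series\<close>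

definition sinv :: "'a::supercommutative_algebra ser \<Rightarrow> 'a ser" where
  "sinv f = (\<lambda>m. signed (mpar m) (grinv (f m)))"

text \<open>
  The left partial derivative. For odd \<open>v\<close> it is an odd derivation: it picks up a sign when it
  passes the coefficient and each of the odd variables that precede \<open>v\<close>.
\<close>

definition sderiv :: "var \<Rightarrow> 'a::supercommutative_algebra ser \<Rightarrow> 'a ser" where
  "sderiv v f = (\<lambda>m.
     if vodd v then
       (if v \<in># m then 0
        else signed (odd (card {u \<in> set_mset m. vodd u \<and> u < v})) (grinv (f (add_mset v m))))
     else scaleC (of_nat (count m v + 1)) (f (add_mset v m)))"

definition sD :: "'a::supercommutative_algebra ser \<Rightarrow> 'a ser" where
  "sD f = sderiv Xi f + smult (svar Xi) (sderiv X f)"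

text \<open>
  The algebraic tensor product of the algebra with \<open>\<complex>[[x,\<xi>]]\<close>: finite sums of products
  \<open>a \<cdot> c\<close> with \<open>a\<close> in the algebra and \<open>c\<close> a complex power series. (Over an
  infinite-dimensional algebra this is smaller than the space of all power series in \<open>x\<close>, \<open>\<xi>\<close>.)
\<close>

definition R_ring :: "'a::supercommutative_algebra ser set" where
  "R_ring = {f. \<exists>(N::nat) (a :: nat \<Rightarrow> 'a) (c :: nat \<Rightarrow> mono \<Rightarrow> complex).
     (\<forall>i<N. \<forall>m. c i m \<noteq> 0 \<longrightarrow> legal m \<and> set_mset m \<subseteq> {X, Xi}) \<and>
     f = (\<lambda>m. \<Sum>i<N. scaleC (c i m) (a i))}"

text \<open>\<open>R[[t]]\<close> for the time variables in \<open>V\<close>: the coefficient of each monomial in them is in \<open>R\<close>.\<close>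

definition R_time :: "var set \<Rightarrow> 'a::supercommutative_algebra ser set" where
  "R_time V = {f. (\<forall>m. f m \<noteq> 0 \<longrightarrow> legal m \<and> set_mset m \<subseteq> {X, Xi} \<union> V) \<and>
     (\<forall>k. set_mset k \<subseteq> V \<longrightarrow>
        (\<lambda>m. if set_mset m \<subseteq> {X, Xi} then f (m + k) else 0) \<in> R_ring)}"


section \<open>Super-pseudodifferential operators\<close>

text \<open>\<open>P\<close> denotes the formal sum of the \<open>P n \<cdot> D\<^sup>n\<close> over all integers \<open>n\<close>.\<close>

type_synonym 'a oper = "int \<Rightarrow> 'a ser"

definition E_hat :: "var set \<Rightarrow> 'a::supercommutative_algebra oper set" where
  "E_hat V = {P. (\<forall>n. P n \<in> R_time V) \<and>
     (\<exists>C::int. \<forall>n m. P n m \<noteq> 0 \<longrightarrow> n - C \<le> int (mweight m))}"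

text \<open>
  Formal sums are taken coefficientwise. Each coefficient has to be a finite sum (otherwise it
  is 0 here), which is the case in all uses below.
\<close>

definition fsum :: "'i set \<Rightarrow> ('i \<Rightarrow> 'a::comm_monoid_add) \<Rightarrow> 'a" where
  "fsum I F = (\<Sum>i | i \<in> I \<and> F i \<noteq> 0. F i)"

definition osum :: "'i set \<Rightarrow> ('i \<Rightarrow> 'a oper) \<Rightarrow> 'a::supercommutative_algebra oper" where
  "osum I F = (\<lambda>n m. fsum I (\<lambda>i. F i n m))"

definition sbinom :: "int \<Rightarrow> nat \<Rightarrow> complex" where
  "sbinom m r = (if odd (int r * (m - int r)) then 0
     else of_int (m div 2) gchoose (r div 2))"

text \<open>
  The coefficients of \<open>D\<^sup>m f = \<Sum>\<^sub>r [m, r] (-1)\<^bsup>|f|(m - r)\<^esup> f\<^bsup>[r]\<^esup> D\<^bsup>m - r\<^esup>\<close>,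
  extended additively to series \<open>f\<close> that are not homogeneous.
\<close>

definition Dcomm :: "int \<Rightarrow> nat \<Rightarrow> 'a::supercommutative_algebra ser \<Rightarrow> 'a ser" where
  "Dcomm m r f = (\<lambda>k. scaleC (sbinom m r)
     ((sD ^^ r) (if odd (m - int r) then sinv f else f) k))"

definition omult :: "'a::supercommutative_algebra oper \<Rightarrow> 'a oper \<Rightarrow> 'a oper"
    (infixl \<open>\<odot>\<close> 70) where
  "P \<odot> Q = (\<lambda>n k. fsum UNIV (\<lambda>(m, r). smult (P m) (Dcomm m r (Q (n - m + int r))) k))"

definition Dpow :: "int \<Rightarrow> 'a::supercommutative_algebra oper" where
  "Dpow j = (\<lambda>n. if n = j then sconst 1 else 0)"

definition oser :: "'a::supercommutative_algebra ser \<Rightarrow> 'a oper" where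
  "oser f = (\<lambda>n. if n = 0 then f else 0)"

definition oone :: "'a::supercommutative_algebra oper" where
  "oone = oser (sconst 1)"

definition opow :: "'a::supercommutative_algebra oper \<Rightarrow> nat \<Rightarrow> 'a oper" where
  "opow P k = ((\<lambda>Q. P \<odot> Q) ^^ k) oone"

definition oexp :: "'a::supercommutative_algebra oper \<Rightarrow> 'a oper" where
  "oexp P = osum UNIV (\<lambda>k n m. scaleC (1 / fact k) (opow P k n m))"

definition oinv :: "var set \<Rightarrow> 'a::supercommutative_algebra oper \<Rightarrow> 'a oper" where
  "oinv V P = (THE Q. Q \<in> E_hat V \<and> P \<odot> Q = oone \<and> Q \<odot> P = oone)"

definition neg_part :: "'a::supercommutative_algebra oper \<Rightarrow> 'a oper" where
  "neg_part P = (\<lambda>n. if n < 0 then P n else 0)"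

definition oderiv :: "var \<Rightarrow> 'a::supercommutative_algebra oper \<Rightarrow> 'a oper" where
  "oderiv v P = (\<lambda>n. sderiv v (P n))"

definition Gamma_over :: "'a::supercommutative_algebra ser set \<Rightarrow> 'a oper set" where
  "Gamma_over B = {P. P 0 = sconst 1 \<and> (\<forall>n>0. P n = 0) \<and>
     (\<forall>j\<ge>1. P (- j) \<in> B \<and> has_parity (odd j) (P (- j)))}"

definition Gamma0 :: "'a::supercommutative_algebra oper set" where
  "Gamma0 = Gamma_over R_ring"

definition Gamma0_hat :: "var set \<Rightarrow> 'a::supercommutative_algebra oper set" where
  "Gamma0_hat V = Gamma_over (R_time V)"

definition ovar :: "var \<Rightarrow> 'a::supercommutative_algebra oper" where
  "ovar v = oser (svar v)"

definition d_x :: "'a::supercommutative_algebra oper" where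
  "d_x = Dpow 2"

definition d_xi :: "'a::supercommutative_algebra oper" where
  "d_xi = Dpow 1 - ovar Xi \<odot> Dpow 2"


section \<open>Substitution of the time variables\<close>

text \<open>
  The value of a monomial is the product of the values of its variables, in the order of the
  normal form; \<open>\<sigma>\<close> is meant to send even (odd) variables to even (odd) series.
\<close>

definition msubst :: "(var \<Rightarrow> 'a ser) \<Rightarrow> mono \<Rightarrow> 'a::supercommutative_algebra ser" where
  "msubst \<sigma> m = foldr (\<lambda>v g. smult (\<sigma> v) g) (sorted_list_of_multiset m) (sconst 1)"

definition ssubst :: "(var \<Rightarrow> 'a ser) \<Rightarrow> 'a ser \<Rightarrow> 'a::supercommutative_algebra ser" where
  "ssubst \<sigma> f = (\<lambda>k. fsum UNIV (\<lambda>m. smult (sconst (f m)) (msubst \<sigma> m) k))"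

definition osubst :: "(var \<Rightarrow> 'a ser) \<Rightarrow> 'a oper \<Rightarrow> 'a::supercommutative_algebra oper" where
  "osubst \<sigma> P = (\<lambda>n. ssubst \<sigma> (P n))"

fun subst_J :: "var \<Rightarrow> 'a::supercommutative_algebra ser" where
  "subst_J (Tp n) = svar (T n)"
| "subst_J (Tm n) = (if even n then svar (T n) else 0)"
| "subst_J v = svar v"

fun subst_MR :: "var \<Rightarrow> 'a::supercommutative_algebra ser" where
  "subst_MR (Tp n) = svar (T n)"
| "subst_MR (Tm n) = svar (T n)"
| "subst_MR v = svar v"


section \<open>Evolution operators and hierarchies\<close>

definition H1 :: "'a::supercommutative_algebra oper" where
  "H1 = osum UNIV (\<lambda>n::nat. ovar (Tp (2 * n + 1)) \<odot> d_xi \<odot> opow d_x n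
     + ovar (Tm (2 * n + 1)) \<odot> ovar Xi \<odot> opow d_x (n + 1))"

definition H0 :: "'a::supercommutative_algebra oper" where
  "H0 = osum {1..} (\<lambda>n::nat. ovar (Tp (2 * n)) \<odot> d_xi \<odot> ovar Xi \<odot> opow d_x n
     + ovar (Tm (2 * n)) \<odot> ovar Xi \<odot> d_xi \<odot> opow d_x n)"

definition U_M :: "'a::supercommutative_algebra oper" where
  "U_M = oexp H1 \<odot> oexp H0"

definition U_J :: "'a::supercommutative_algebra oper" where
  "U_J = oexp (osum UNIV (\<lambda>n::nat. ovar (T (2 * (n + 1))) \<odot> opow d_x (n + 1)
     + ovar (T (2 * n + 1)) \<odot> opow d_x n \<odot> d_xi))"

definition U_MR :: "'a::supercommutative_algebra oper" where
  "U_MR = oexp (osum {1..} (\<lambda>n::nat. ovar (T n) \<odot> Dpow (int n)))"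

definition maximal_SKP :: "'a::supercommutative_algebra oper \<Rightarrow> 'a oper \<Rightarrow> bool" where
  "maximal_SKP S S0 \<longleftrightarrow> neg_part (S \<odot> U_M \<odot> oinv times_pm S0) = 0"

definition JSKP :: "'a::supercommutative_algebra oper \<Rightarrow> bool" where
  "JSKP S \<longleftrightarrow>
     (\<forall>n\<ge>1. oderiv (T (2 * n)) S
        = - (neg_part (S \<odot> opow d_x n \<odot> oinv times_std S) \<odot> S)) \<and>
     (\<forall>n. oderiv (T (2 * n + 1)) S
        = - (neg_part (S \<odot> opow d_x n \<odot> d_xi \<odot> oinv times_std S) \<odot> S))"

definition MR_flow :: "nat \<Rightarrow> 'a::supercommutative_algebra oper \<Rightarrow> 'a oper" where
  "MR_flow k P =
     (if even k then oderiv (T k) P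
      else oderiv (T k) P - osum UNIV (\<lambda>m::nat.
        ovar (T (2 * m + 1)) \<odot> oderiv (T (2 * (k div 2 + m + 1))) P))"

definition MRSKP :: "'a::supercommutative_algebra oper \<Rightarrow> bool" where
  "MRSKP S \<longleftrightarrow> (\<forall>n\<ge>1. MR_flow n S
     = - (neg_part (S \<odot> Dpow (int n) \<odot> oinv times_std S) \<odot> S))"

end

theory Submission
  imports Defs
begin

text \<open>
  Both substitutions are homomorphisms of operator algebras, and they turn the two exponents of
  \<open>U\<^sub>M\<close> into commuting operators, so that the product of exponentials becomes one exponential
  \<open>U\<close>. If \<open>\<partial>H\<close> commutes with the exponent \<open>H\<close>, then \<open>\<partial>U = (\<partial>H) U\<close>; in the Manin-Radul case the
  commutator is central and produces the correction terms in \<open>D\<^sub>2\<^sub>n\<^sub>+\<^sub>1\<close>, so that always \<open>V U = K U\<close> for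
  the flow \<open>V\<close> with generator \<open>K\<close>. Now \<open>Y = S U S\<^sub>0\<^sup>-\<^sup>1\<close> and \<open>V Y = ((V S) S\<^sup>-\<^sup>1 + S K S\<^sup>-\<^sup>1) Y\<close> have no negative
  part, and \<open>Y\<close> is \<open>1\<close> up to terms of positive weight, so it can be cancelled. Hence
  \<open>(V S) S\<^sup>-\<^sup>1 = - (S K S\<^sup>-\<^sup>1)\<^sub>-\<close>, as \<open>(V S) S\<^sup>-\<^sup>1\<close> has only negative powers of \<open>D\<close>.

  Infinite sums are handled by congruences: modulo series of weight at least \<open>w\<close>, every sum
  that occurs is finite. The multiplication of operators is associative because the coefficients of
  \<open>D\<^sup>m f\<close> satisfy a Pascal rule, which can be run upwards and downwards from \<open>m = 0\<close>.
\<close>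

section \<open>Signs and the grading involution\<close>

text \<open>The statement uses raw functions, sums that default to 0 and inverses given by
  \<open>THE\<close>. The calculations take place in a type \<open>bop\<close> larger than
  \<open>E_hat\<close>: it keeps the growth bound and drops the condition that coefficients lie in
  \<open>R\<close>. That condition returns as \<open>Rt\<close>, in order to identify
  \<open>oinv\<close> with a Neumann series. The growth bound shapes everything. Operators have
  infinitely many positive and negative powers of \<open>D\<close>, and products make sense only
  because high powers carry high weight. The Hamiltonians have bound 0 since the weight of each time
  variable matches the power of \<open>D\<close> that it multiplies. Two topologies occur. Inverses
  of monic operators of order zero converge in powers of \<open>D^-1\<close>; the exponentials and
  the cancellation of \<open>Y\<close> converge by weight. The parity condition on \<open>S\<close>
  says that \<open>S\<close> is fixed by the grading automorphism \<open>ohat\<close>, so odd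
  derivations and odd variables pass it without signs. The exponents commute after substitution
  because \<open>dxi * Xi + Xi * dxi = 1\<close> turns the even part into multiples of powers of
  \<open>D^2\<close>.\<close>

lemma scaleC_zero_left [simp]: "scaleC 0 (a::'a::supercommutative_algebra) = 0"
  using scaleC_add_left[of 0 0 a] by simp

lemma scaleC_zero_right [simp]: "scaleC c (0::'a::supercommutative_algebra) = 0"
  using scaleC_add_right[of c 0 "0::'a"] by simp

lemma scaleC_uminus: "scaleC c (- a) = - scaleC c (a::'a::supercommutative_algebra)"
  using scaleC_add_right[of c a "- a"] by (simp add: eq_neg_iff_add_eq_0 add.commute)

lemma scaleC_neg: "scaleC (- c) a = - scaleC c (a::'a::supercommutative_algebra)"
  using scaleC_add_left[of c "- c" a] by (simp add: eq_neg_iff_add_eq_0 add.commute)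

lemma scaleC_sum: "scaleC c (sum f A) = (\<Sum>i\<in>A. scaleC c (f i :: 'a::supercommutative_algebra))"
  by (induction A rule: infinite_finite_induct) (auto simp: scaleC_add_right)

lemma scaleC_sum_left: "scaleC (sum c A) a = (\<Sum>i\<in>A. scaleC (c i) (a :: 'a::supercommutative_algebra))"
  by (induction A rule: infinite_finite_induct) (auto simp: scaleC_add_left)

lemma hpart_uminus: "a \<in> hpart p \<Longrightarrow> - a \<in> hpart p" for a :: "'a::supercommutative_algebra"
  using hpart_scaleC[of a p "- 1"] by (simp add: scaleC_neg scaleC_one)

lemma grinv_parts:
  fixes u v :: "'a::supercommutative_algebra"
  assumes "u \<in> hpart False" "v \<in> hpart True"
  shows "grinv (u + v) = u - v"
  unfolding grinv_def
proof (rule the_equality)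
  show "\<exists>u'\<in>hpart False. \<exists>v'\<in>hpart True. u + v = u' + v' \<and> u - v = u' - v'"
    using assms by blast
next
  fix b assume "\<exists>u'\<in>hpart False. \<exists>v'\<in>hpart True. u + v = u' + v' \<and> b = u' - v'"
  then obtain u' v' where *: "u' \<in> hpart False" "v' \<in> hpart True" "u + v = u' + v'" "b = u' - v'"
    by blast
  have "(u, v) = (u', v')"
    using hpart_decomposition[of "u + v"] * assms by (metis fst_conv snd_conv)
  then show "b = u - v" using * by simp
qed

lemma parts_exist:
  obtains u v where "u \<in> hpart False" "v \<in> hpart True" "(a::'a::supercommutative_algebra) = u + v"
  using hpart_decomposition[of a] by metis

lemma grinv_hpart: "a \<in> hpart p \<Longrightarrow> grinv a = signed p a" for a :: "'a::supercommutative_algebra"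
  using grinv_parts[of a 0] grinv_parts[of 0 a] by (cases p) (auto simp: signed_def hpart_zero)

lemma grinv_add: "grinv (a + b) = grinv a + grinv (b::'a::supercommutative_algebra)"
proof -
  obtain u v where a: "u \<in> hpart False" "v \<in> hpart True" "a = u + v" by (rule parts_exist)
  obtain u' v' where b: "u' \<in> hpart False" "v' \<in> hpart True" "b = u' + v'" by (rule parts_exist)
  have "grinv ((u + u') + (v + v')) = (u + u') - (v + v')"
    using a b by (intro grinv_parts hpart_add)
  then show ?thesis using a b by (simp add: grinv_parts algebra_simps)
qed

lemma grinv_zero [simp]: "grinv (0::'a::supercommutative_algebra) = 0"
  using grinv_add[of 0 "0::'a"] by simp

lemma grinv_uminus: "grinv (- a) = - grinv (a::'a::supercommutative_algebra)"
  using grinv_add[of a "- a"] by (simp add: eq_neg_iff_add_eq_0 add.commute)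

lemma grinv_sum: "grinv (sum f A) = (\<Sum>i\<in>A. grinv (f i :: 'a::supercommutative_algebra))"
  by (induction A rule: infinite_finite_induct) (auto simp: grinv_add)

lemma grinv_one [simp]: "grinv (1::'a::supercommutative_algebra) = 1"
  using grinv_hpart[OF hpart_one] by (simp add: signed_def)

lemma grinv_scaleC: "grinv (scaleC c a) = scaleC c (grinv (a::'a::supercommutative_algebra))"
proof -
  obtain u v where a: "u \<in> hpart False" "v \<in> hpart True" "a = u + v" by (rule parts_exist)
  have "grinv (scaleC c u + scaleC c v) = scaleC c u - scaleC c v"
    using a by (intro grinv_parts hpart_scaleC)
  moreover have "scaleC c (u - v) = scaleC c u - scaleC c v"
    by (simp only: diff_conv_add_uminus scaleC_add_right scaleC_uminus)
  ultimately show ?thesis using a by (simp add: grinv_parts scaleC_add_right)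
qed

lemma grinv_grinv [simp]: "grinv (grinv a) = (a::'a::supercommutative_algebra)"
proof -
  obtain u v where a: "u \<in> hpart False" "v \<in> hpart True" "a = u + v" by (rule parts_exist)
  have "grinv (u + - v) = u - - v"
    using a by (intro grinv_parts hpart_uminus)
  then show ?thesis using a by (simp add: grinv_parts)
qed

lemma grinv_mult: "grinv (a * b) = grinv a * grinv (b::'a::supercommutative_algebra)"
proof -
  obtain u v where a: "u \<in> hpart False" "v \<in> hpart True" "a = u + v" by (rule parts_exist)
  obtain u' v' where b: "u' \<in> hpart False" "v' \<in> hpart True" "b = u' + v'" by (rule parts_exist)
  have "u * u' + v * v' \<in> hpart False" "u * v' + v * u' \<in> hpart True"
    using a b hpart_mult[of u False u' False] hpart_mult[of v True v' True]
      hpart_mult[of u False v' True] hpart_mult[of v True u' False] by (auto intro: hpart_add)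
  then have "grinv ((u * u' + v * v') + (u * v' + v * u')) = (u * u' + v * v') - (u * v' + v * u')"
    by (rule grinv_parts)
  then show ?thesis using a b by (simp add: grinv_parts algebra_simps)
qed

text \<open>Passing a monomial of parity \<open>p\<close> across a coefficient applies the
  involution to the power \<open>p\<close>. With a boolean exponent, powers compose by
  \<open>p \<noteq> q\<close>, just as signs do.\<close>

definition gi :: "bool \<Rightarrow> 'a::supercommutative_algebra \<Rightarrow> 'a" where
  "gi p a = (if p then grinv a else a)"

lemma gi_simps [simp]:
  "gi False a = a" "gi True a = grinv a" "gi p 0 = 0" "gi p 1 = 1"
  by (auto simp: gi_def)

lemma gi_gi: "gi p (gi q a) = gi (p \<noteq> q) a" by (auto simp: gi_def)
lemma gi_grinv: "gi p (grinv a) = gi (\<not> p) a" "grinv (gi p a) = gi (\<not> p) a" by (auto simp: gi_def)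
lemma gi_mult: "gi p (a * b) = gi p a * gi p b" by (auto simp: gi_def grinv_mult)
lemma gi_add: "gi p (a + b) = gi p a + gi p b" by (auto simp: gi_def grinv_add)
lemma gi_sum: "gi p (sum f A) = (\<Sum>i\<in>A. gi p (f i))" by (auto simp: gi_def grinv_sum)
lemma gi_scaleC: "gi p (scaleC c a) = scaleC c (gi p a)" by (auto simp: gi_def grinv_scaleC)
lemma gi_signed: "gi p (signed q a) = signed q (gi p a)" by (auto simp: gi_def signed_def grinv_uminus)
lemma signed_simps [simp]:
  "signed False a = a" "signed True a = - a" "signed p (0::'a::ab_group_add) = 0"
  by (auto simp: signed_def)

lemma signed_signed: "signed p (signed q a) = signed (p \<noteq> q) (a::'a::ab_group_add)"
  by (auto simp: signed_def)
lemma signed_uminus: "signed p (- a) = signed (\<not> p) (a::'a::ab_group_add)" "- signed p a = signed (\<not> p) a"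
  by (auto simp: signed_def)
lemma signed_add: "signed p (a + b) = signed p a + signed p (b::'a::ab_group_add)"
  by (auto simp: signed_def)
lemma signed_sum: "signed p (sum f A) = (\<Sum>i\<in>A. signed p (f i :: 'a::ab_group_add))"
  by (auto simp: signed_def sum_negf)
lemma signed_mult: "signed p a * b = signed p (a * b)" "a * signed p b = signed p (a * (b::'a::ring))"
  by (auto simp: signed_def)
lemma signed_scaleC: "scaleC c (signed p a) = signed p (scaleC c (a::'a::supercommutative_algebra))"
  by (auto simp: signed_def scaleC_uminus)
lemma signed_eq_0 [simp]: "signed p a = 0 \<longleftrightarrow> a = (0::'a::ab_group_add)"
  by (auto simp: signed_def)


section \<open>Monomials\<close>

lemma legal_subset: "legal m \<Longrightarrow> k \<subseteq># m \<Longrightarrow> legal k"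
  unfolding legal_def by (metis mset_subset_eq_count order_trans)

lemma legal_addD: "legal (k + l) \<Longrightarrow> legal k" "legal (k + l) \<Longrightarrow> legal l"
  by (rule legal_subset, assumption, simp)+

lemma legal_add_msetD: "legal (add_mset v m) \<Longrightarrow> legal m"
  by (rule legal_subset, assumption, simp)

lemma legal_empty [simp]: "legal {#}" by (simp add: legal_def)

lemma legal_single [simp]: "legal {#v#}" by (simp add: legal_def)

lemma legal_add_mset: "legal (add_mset v m) \<longleftrightarrow> legal m \<and> (vodd v \<longrightarrow> v \<notin># m)"
proof -
  have "legal (add_mset v m) \<Longrightarrow> vodd v \<Longrightarrow> v \<notin># m"
    unfolding legal_def by (metis One_nat_def Suc_le_mono count_add_mset count_greater_zero_iff le_zero_eq not_gr_zero)
  moreover have "legal m \<Longrightarrow> (vodd v \<longrightarrow> v \<notin># m) \<Longrightarrow> legal (add_mset v m)"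
    by (auto simp: legal_def count_eq_zero_iff)
  ultimately show ?thesis using legal_add_msetD by blast
qed

lemma legal_add_disjoint: "legal (k + l) \<Longrightarrow> vodd v \<Longrightarrow> v \<in># k \<Longrightarrow> v \<notin># l"
proof
  assume a: "legal (k + l)" "vodd v" "v \<in># k" "v \<in># l"
  then have "count k v + count l v \<le> 1" "count k v \<ge> 1" "count l v \<ge> 1"
    by (auto simp: legal_def)
  then show False by simp
qed

lemma submultiset_add_msetE:
  assumes "k \<subseteq># add_mset v m"
  obtains "k \<subseteq># m" | k' where "k = add_mset v k'" "k' \<subseteq># m"
proof (cases "v \<in># k")
  case True
  then obtain k' where "k = add_mset v k'" by (meson multi_member_split)
  then show ?thesis using assms that by auto
next
  case False
  have "count k u \<le> count m u" for u
    using mset_subset_eq_count[OF assms, of u] False by (cases "u = v") (auto simp: not_in_iff)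
  then show ?thesis using that by (simp add: mset_subset_eqI)
qed

lemma finite_submultisets [simp]: "finite {k. k \<subseteq># (m::'b multiset)}"
proof (induction m)
  case (add v m)
  have "{k. k \<subseteq># add_mset v m} \<subseteq> {k. k \<subseteq># m} \<union> add_mset v ` {k. k \<subseteq># m}"
    by (auto elim: submultiset_add_msetE)
  then show ?case using add by (meson finite_UnI finite_imageI finite_subset)
qed simp

lemma submultisets_add_mset:
  "{k. k \<subseteq># add_mset v m} = {k. k \<subseteq># m} \<union> add_mset v ` {k. k \<subseteq># m}"
  by (auto elim: submultiset_add_msetE intro: subset_mset.order_trans[of _ m])

text \<open>A set is enough to compute signs: a legal monomial contains each odd variable at most
  once, and even variables never contribute.\<close>

definition oddset :: "mono \<Rightarrow> var set" where
  "oddset m = {v. v \<in># m \<and> vodd v}"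

lemma finite_oddset [simp]: "finite (oddset m)"
  by (simp add: oddset_def)

text \<open>Parity of the number of transpositions that carry an odd \<open>v\<close> from the front
  of the sorted monomial to its place.\<close>

definition below :: "var \<Rightarrow> mono \<Rightarrow> bool" where
  "below v m \<longleftrightarrow> odd (card {u \<in> oddset m. u < v})"

lemma odd_card_Un: "finite A \<Longrightarrow> finite B \<Longrightarrow> A \<inter> B = {} \<Longrightarrow> odd (card (A \<union> B)) \<longleftrightarrow> (odd (card A) \<noteq> odd (card B))"
  by (simp add: card_Un_disjoint)

lemma oddset_add: "oddset (k + l) = oddset k \<union> oddset l" by (auto simp: oddset_def)

lemma oddset_add_mset: "oddset (add_mset v l) = (if vodd v then insert v (oddset l) else oddset l)"
  by (auto simp: oddset_def)

lemma oddset_empty [simp]: "oddset {#} = {}" by (auto simp: oddset_def)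

lemma oddset_disjoint: "legal (k + l) \<Longrightarrow> oddset k \<inter> oddset l = {}"
  using legal_add_disjoint by (auto simp: oddset_def)

lemma mpar_add: "mpar (k + l) = (mpar k \<noteq> mpar l)" by (auto simp: mpar_def)

lemma mpar_add_mset: "mpar (add_mset v l) = (vodd v \<noteq> mpar l)" by (auto simp: mpar_def)

lemma mpar_empty [simp]: "mpar {#} = False" by (simp add: mpar_def)

lemma mpar_oddset: "legal m \<Longrightarrow> mpar m = odd (card (oddset m))"
proof (induction m)
  case (add v m)
  then have "legal m" "vodd v \<Longrightarrow> v \<notin># m" by (auto simp: legal_add_mset)
  then show ?case using add.IH by (auto simp: mpar_add_mset oddset_add_mset card_insert_if) (auto simp: oddset_def)
qed simp

lemma mweight_add: "mweight (k + l) = mweight k + mweight l" by (simp add: mweight_def)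

lemma mweight_add_mset: "mweight (add_mset v l) = weight v + mweight l" by (simp add: mweight_def)

lemma mweight_empty [simp]: "mweight {#} = 0" by (simp add: mweight_def)

lemma msign_alt: "msign k l \<longleftrightarrow> odd (card {(u, v). u \<in> oddset k \<and> v \<in> oddset l \<and> v < u})"
  unfolding msign_def oddset_def by (rule arg_cong[where f = "\<lambda>A. odd (card A)"]) auto

lemma finite_inversions: "finite {(u, v). u \<in> oddset k \<and> v \<in> oddset l \<and> P u v}"
  by (rule finite_subset[of _ "oddset k \<times> oddset l"]) auto

lemma msign_empty [simp]: "msign {#} l = False" "msign k {#} = False"
  by (auto simp: msign_alt)

text \<open>Legality makes the odd variables of \<open>k\<close> and \<open>l\<close> disjoint, so
  the set of inversions splits. This bimultiplicativity of the sign is what associativity of series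
  rests on.\<close>

lemma msign_add_left:
  assumes "legal (k + l)"
  shows "msign (k + l) m = (msign k m \<noteq> msign l m)"
proof -
  have "{(u, v). u \<in> oddset (k + l) \<and> v \<in> oddset m \<and> v < u} =
    {(u, v). u \<in> oddset k \<and> v \<in> oddset m \<and> v < u} \<union> {(u, v). u \<in> oddset l \<and> v \<in> oddset m \<and> v < u}"
    by (auto simp: oddset_add)
  then show ?thesis unfolding msign_alt
    using oddset_disjoint[OF assms] by (subst odd_card_Un[symmetric]) (auto simp: finite_inversions)
qed

lemma msign_add_right:
  assumes "legal (k + l)"
  shows "msign m (k + l) = (msign m k \<noteq> msign m l)"
proof -
  have "{(u, v). u \<in> oddset m \<and> v \<in> oddset (k + l) \<and> v < u} =
    {(u, v). u \<in> oddset m \<and> v \<in> oddset k \<and> v < u} \<union> {(u, v). u \<in> oddset m \<and> v \<in> oddset l \<and> v < u}"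
    by (auto simp: oddset_add)
  then show ?thesis unfolding msign_alt
    using oddset_disjoint[OF assms] by (subst odd_card_Un[symmetric]) (auto simp: finite_inversions)
qed

lemma msign_single_left: "vodd v \<Longrightarrow> msign {#v#} l = below v l"
proof -
  assume v: "vodd v"
  have "{(u, w). u \<in> oddset {#v#} \<and> w \<in> oddset l \<and> w < u} = Pair v ` {w \<in> oddset l. w < v}"
    using v by (auto simp: oddset_add_mset)
  then show ?thesis unfolding msign_alt below_def by (simp add: card_image inj_on_def)
qed

text \<open>The inversions are the odd variables of \<open>l\<close> above \<open>v\<close>; their
  parity is that of all odd variables of \<open>l\<close> minus that of those below
  \<open>v\<close>.\<close>

lemma msign_single_right:
  assumes "vodd v" "legal l" "v \<notin># l"
  shows "msign l {#v#} = (mpar l \<noteq> below v l)"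
proof -
  have "{(u, w). u \<in> oddset l \<and> w \<in> oddset {#v#} \<and> w < u} = (\<lambda>u. (u, v)) ` {u \<in> oddset l. v < u}"
    using assms by (auto simp: oddset_add_mset)
  then have 1: "msign l {#v#} = odd (card {u \<in> oddset l. v < u})"
    unfolding msign_alt by (simp add: card_image inj_on_def)
  have "oddset l = {u \<in> oddset l. u < v} \<union> {u \<in> oddset l. v < u}"
    using assms by (auto simp: oddset_def not_less_iff_gr_or_eq)
  then have "mpar l = odd (card ({u \<in> oddset l. u < v} \<union> {u \<in> oddset l. v < u}))"
    using mpar_oddset[OF assms(2)] by simp
  then show ?thesis using 1 by (subst (asm) odd_card_Un) (auto simp: below_def)
qed

lemma msign_single_even: "\<not> vodd v \<Longrightarrow> msign {#v#} l = False" "\<not> vodd v \<Longrightarrow> msign l {#v#} = False"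
  by (auto simp: msign_alt oddset_add_mset)

lemma below_add:
  assumes "legal (k + l)"
  shows "below v (k + l) = (below v k \<noteq> below v l)"
proof -
  have "{u \<in> oddset (k + l). u < v} = {u \<in> oddset k. u < v} \<union> {u \<in> oddset l. u < v}"
    by (auto simp: oddset_add)
  then show ?thesis
    unfolding below_def using oddset_disjoint[OF assms]
    by (simp only:) (subst odd_card_Un, auto)
qed

lemma below_single: "below v {#u#} = (vodd u \<and> u < v)"
proof (cases "vodd u \<and> u < v")
  case True
  then have "{w \<in> oddset {#u#}. w < v} = {u}" by (auto simp: oddset_add_mset)
  then show ?thesis using True by (simp add: below_def)
next
  case False
  then have "{w \<in> oddset {#u#}. w < v} = {}" by (auto simp: oddset_add_mset split: if_splits)
  then show ?thesis using False unfolding below_def by (metis card.empty even_zero)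
qed

lemma below_add_mset: "legal (add_mset u l) \<Longrightarrow> below v (add_mset u l) = ((vodd u \<and> u < v) \<noteq> below v l)"
  using below_add[of "{#u#}" l] by (simp add: below_single)

lemma below_empty [simp]: "below v {#} = False" by (simp add: below_def)

text \<open>The only variable before \<open>Xi\<close> is the even \<open>X\<close>, so
  differentiating by \<open>Xi\<close> never costs a sorting sign.\<close>

lemma below_Xi [simp]: "below Xi m = False"
proof -
  have "\<not> u < Xi" if "vodd u" for u using that by (cases u) (auto simp: less_var_def)
  then have "{u \<in> oddset m. u < Xi} = {}" by (auto simp: oddset_def)
  then show ?thesis unfolding below_def by (metis card.empty even_zero)
qed

lemma sderiv_alt: "sderiv v f = (\<lambda>m.
     if vodd v then (if v \<in># m then 0 else signed (below v m) (grinv (f (add_mset v m))))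
     else scaleC (of_nat (count m v + 1)) (f (add_mset v m)))"
  unfolding sderiv_def below_def oddset_def
  by (intro ext) (simp add: conj_assoc)


section \<open>The ring of series\<close>

text \<open>Coefficients are unrestricted apart from vanishing on illegal monomials: the ring
  structure and the derivations need no more, and the condition of lying in \<open>R\<close> is
  treated separately.\<close>

typedef (overloaded) 'a lser = "{f :: 'a::supercommutative_algebra ser. \<forall>m. f m \<noteq> 0 \<longrightarrow> legal m}"
  morphisms coeff Lser
  by (rule exI[of _ "\<lambda>_. 0"]) simp

setup_lifting type_definition_lser

lemma lser_eqI: "(\<And>m. legal m \<Longrightarrow> coeff f m = coeff g m) \<Longrightarrow> f = g"
  using coeff[of f] coeff[of g] by (intro coeff_inject[THEN iffD1] ext) (metis (mono_tags, lifting) mem_Collect_eq)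

lemma coeff_illegal: "\<not> legal m \<Longrightarrow> coeff f m = 0"
  using coeff[of f] by auto

lemma submultiset_diff_mono: "j \<subseteq># k \<Longrightarrow> k \<subseteq># m \<Longrightarrow> k - j \<subseteq># m - j"
  by (metis add_diff_cancel_left' mset_subset_eq_add_left mset_subset_eq_exists_conv union_assoc)

text \<open>Both sides run over the ordered decompositions of \<open>m\<close> into three
  parts.\<close>

lemma sum_submultisets_assoc:
  "(\<Sum>k | k \<subseteq># m. \<Sum>j | j \<subseteq># k. F j (k - j) (m - k)) =
   (\<Sum>j | j \<subseteq># m. \<Sum>i | i \<subseteq># m - j. F j i (m - j - i))"
  for F :: "'b multiset \<Rightarrow> 'b multiset \<Rightarrow> 'b multiset \<Rightarrow> 'c::comm_monoid_add"
proof -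
  have "(\<Sum>(k, j)\<in>(SIGMA k:{k. k \<subseteq># m}. {j. j \<subseteq># k}). F j (k - j) (m - k)) =
    (\<Sum>(j, i)\<in>(SIGMA j:{j. j \<subseteq># m}. {i. i \<subseteq># m - j}). F j i (m - j - i))"
    by (rule sum.reindex_bij_witness[where i = "\<lambda>(j, i). (j + i, j)" and j = "\<lambda>(k, j). (j, k - j)"])
       (auto simp: subset_mset.le_diff_conv2 add.commute subset_mset.diff_add diff_diff_add_mset
          dest: subset_mset.order_trans elim: submultiset_diff_mono)
  then show ?thesis by (simp add: sum.Sigma)
qed

definition sterm :: "'a::supercommutative_algebra ser \<Rightarrow> 'a ser \<Rightarrow> mono \<Rightarrow> mono \<Rightarrow> 'a" where
  "sterm f g k l = signed (msign k l) (f k * gi (mpar k) (g l))"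

lemma smult_alt: "smult f g m = (if legal m then \<Sum>k | k \<subseteq># m. sterm f g k (m - k) else 0)"
  by (simp add: smult_def sterm_def gi_def)

instantiation lser :: (supercommutative_algebra) "{ring, monoid_mult}"
begin

lift_definition zero_lser :: "'a lser" is "\<lambda>_. 0" by simp
lift_definition one_lser :: "'a lser" is "sconst 1" by (simp add: sconst_def split: if_splits)
lift_definition plus_lser :: "'a lser \<Rightarrow> 'a lser \<Rightarrow> 'a lser" is "\<lambda>f g m. f m + g m"
  by (metis add.left_neutral)
lift_definition minus_lser :: "'a lser \<Rightarrow> 'a lser \<Rightarrow> 'a lser" is "\<lambda>f g m. f m - g m"
  by (metis diff_zero)
lift_definition uminus_lser :: "'a lser \<Rightarrow> 'a lser" is "\<lambda>f m. - f m" by simp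
lift_definition times_lser :: "'a lser \<Rightarrow> 'a lser \<Rightarrow> 'a lser" is smult
  by (simp add: smult_def split: if_splits)

instance
proof
  fix f g h :: "'a lser"
  show "f + g + h = f + (g + h)" by transfer (simp add: add.assoc)
  show "f + g = g + f" by transfer (simp add: add.commute)
  show "0 + f = f" by transfer simp
  show "- f + f = 0" by transfer simp
  show "f - g = f + - g" by transfer simp
  show "(f + g) * h = f * h + g * h"
    by transfer (auto simp: smult_alt sterm_def distrib_right signed_add sum.distrib intro!: ext)
  show "f * (g + h) = f * g + f * h"
    by transfer (auto simp: smult_alt sterm_def distrib_left gi_add signed_add sum.distrib intro!: ext)
  show "1 * f = f"
  proof (rule lser_eqI)
    fix m assume m: "legal m"
    have "coeff (1 * f) m = (\<Sum>k | k \<subseteq># m. if k = {#} then coeff f m else 0)"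
      unfolding times_lser.rep_eq one_lser.rep_eq smult_alt if_P[OF m]
      by (rule sum.cong) (auto simp: sterm_def sconst_def)
    then show "coeff (1 * f) m = coeff f m" by (simp add: sum.delta)
  qed
  show "f * 1 = f"
  proof (rule lser_eqI)
    fix m assume m: "legal m"
    have "coeff (f * 1) m = (\<Sum>k | k \<subseteq># m. if k = m then coeff f m else 0)"
      unfolding times_lser.rep_eq one_lser.rep_eq smult_alt if_P[OF m]
      by (rule sum.cong) (auto simp: sterm_def sconst_def Diff_eq_empty_iff_mset subset_mset.antisym)
    then show "coeff (f * 1) m = coeff f m" by (simp add: sum.delta)
  qed
  show "f * g * h = f * (g * h)"
  proof (rule lser_eqI)
    fix m assume m: "legal m"
    let ?f = "coeff f" and ?g = "coeff g" and ?h = "coeff h"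
    define F where "F j i l = signed (msign (j + i) l \<noteq> msign j i)
        (?f j * gi (mpar j) (?g i) * gi (mpar (j + i)) (?h l))" for j i l
    have "coeff (f * g * h) m = (\<Sum>k | k \<subseteq># m. \<Sum>j | j \<subseteq># k. F j (k - j) (m - k))"
      unfolding times_lser.rep_eq using m
      by (auto simp: smult_alt sterm_def F_def legal_subset sum_distrib_right signed_sum signed_mult
          signed_signed intro!: sum.cong)
    also have "\<dots> = (\<Sum>j | j \<subseteq># m. \<Sum>i | i \<subseteq># m - j. F j i (m - j - i))"
      by (rule sum_submultisets_assoc)
    also have "\<dots> = coeff (f * (g * h)) m"
      unfolding times_lser.rep_eq smult_alt sterm_def if_P[OF m]
    proof (intro sum.cong refl)
      fix j assume "j \<in> {j. j \<subseteq># m}"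
      then have j: "j \<subseteq># m" by simp
      have mj: "legal (m - j)" using m by (rule legal_subset) simp
      have "F j i (m - j - i) = signed (msign j (m - j))
          (?f j * gi (mpar j) (signed (msign i (m - j - i)) (?g i * gi (mpar i) (?h (m - j - i)))))"
        if i: "i \<subseteq># m - j" for i
      proof -
        have e: "m - j = i + (m - j - i)" by (rule subset_mset.add_diff_inverse[OF i, symmetric])
        have "j + i \<subseteq># m" using i j by (simp add: subset_mset.le_diff_conv2 add.commute)
        then have "legal (j + i)" using m legal_subset by blast
        \<comment> \<open>The cocycle identity: by bimultiplicativity both sides expand to the sum
          of the three pairwise signs.\<close>
        then have "(msign (j + i) (m - j - i) \<noteq> msign j i) = (msign j (m - j) \<noteq> msign i (m - j - i))"
          using msign_add_right[of i "m - j - i" j] mj e by (simp add: msign_add_left) blast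
        then show ?thesis
          by (auto simp: F_def gi_signed gi_mult gi_gi signed_mult signed_signed mpar_add mult.assoc)
      qed
      then show "(\<Sum>i | i \<subseteq># m - j. F j i (m - j - i)) = signed (msign j (m - j))
         (?f j * gi (mpar j) (if legal (m - j) then \<Sum>k | k \<subseteq># m - j.
            signed (msign k (m - j - k)) (?g k * gi (mpar k) (?h (m - j - k))) else 0))"
        using mj by (simp add: gi_sum sum_distrib_left signed_sum)
    qed
    finally show "coeff (f * g * h) m = coeff (f * (g * h)) m" .
  qed
qed

end

lemmas coeff_simps = zero_lser.rep_eq one_lser.rep_eq plus_lser.rep_eq minus_lser.rep_eq uminus_lser.rep_eq

lemma coeff_mult: "legal m \<Longrightarrow> coeff (f * g) m = (\<Sum>k | k \<subseteq># m. sterm (coeff f) (coeff g) k (m - k))"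
  by (simp add: times_lser.rep_eq smult_alt)

lemma coeff_sum: "coeff (sum f A) m = (\<Sum>i\<in>A. coeff (f i) m)"
  by (induction A rule: infinite_finite_induct) (auto simp: coeff_simps)

lift_definition lvar :: "var \<Rightarrow> 'a::supercommutative_algebra lser" is svar
  by (simp add: svar_def split: if_splits)

lift_definition lscale :: "complex \<Rightarrow> 'a::supercommutative_algebra lser \<Rightarrow> 'a lser" is "\<lambda>c f m. scaleC c (f m)"
  by (metis scaleC_zero_right)

lift_definition linv :: "'a::supercommutative_algebra lser \<Rightarrow> 'a lser" is sinv
  by (auto simp: sinv_def) (metis grinv_zero)

lift_definition lder :: "var \<Rightarrow> 'a::supercommutative_algebra lser \<Rightarrow> 'a lser" is sderiv
  by (auto simp: sderiv_alt split: if_splits) (metis legal_add_mset scaleC_zero_right grinv_zero)+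

definition lD :: "'a::supercommutative_algebra lser \<Rightarrow> 'a lser" where
  "lD f = lder Xi f + lvar Xi * lder X f"

lemma coeff_lD: "coeff (lD f) = sD (coeff f)"
  by (simp add: lD_def sD_def plus_lser.rep_eq times_lser.rep_eq lder.rep_eq lvar.rep_eq plus_fun_def)


section \<open>The grading involution and scalar multiplication of series\<close>

lemma coeff_signed: "coeff (signed p f) m = signed p (coeff f m)"
  by (auto simp: signed_def coeff_simps)

definition lgi :: "bool \<Rightarrow> 'a::supercommutative_algebra lser \<Rightarrow> 'a lser" where
  "lgi p f = (if p then linv f else f)"

lemma lgi_simps [simp]: "lgi False f = f" "lgi True f = linv f" by (auto simp: lgi_def)

lemma coeff_linv: "coeff (linv f) m = signed (mpar m) (grinv (coeff f m))"
  by (simp add: linv.rep_eq sinv_def)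

lemma linv_add: "linv (f + g) = linv f + linv g"
  by (rule lser_eqI) (simp add: coeff_simps coeff_linv grinv_add signed_add)

lemma linv_uminus: "linv (- f) = - linv f"
  by (rule lser_eqI) (simp add: coeff_simps coeff_linv grinv_uminus signed_uminus)

lemma linv_zero [simp]: "linv 0 = 0"
  by (rule lser_eqI) (simp add: coeff_simps coeff_linv)

lemma linv_sum: "linv (sum f A) = (\<Sum>i\<in>A. linv (f i))"
  by (induction A rule: infinite_finite_induct) (auto simp: linv_add)

lemma linv_one [simp]: "linv 1 = 1"
  by (rule lser_eqI) (simp add: coeff_simps coeff_linv sconst_def)

lemma linv_linv [simp]: "linv (linv f) = f"
  by (rule lser_eqI) (simp add: coeff_linv gi_signed[of True, simplified] signed_signed)

lemma linv_inject: "linv f = linv g \<Longrightarrow> f = g"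
  by (metis linv_linv)

lemma linv_lscale: "linv (lscale c f) = lscale c (linv f)"
  by (rule lser_eqI) (simp add: lscale.rep_eq coeff_linv grinv_scaleC signed_scaleC)

lemma linv_mult: "linv (f * g) = linv f * linv g"
proof (rule lser_eqI)
  fix m assume m: "legal m"
  have "signed (mpar m) (grinv (sterm (coeff f) (coeff g) k (m - k))) =
    sterm (coeff (linv f)) (coeff (linv g)) k (m - k)" if "k \<subseteq># m" for k
  proof -
    have "mpar m = (mpar k \<noteq> mpar (m - k))"
      using mpar_add[of k "m - k"] that by simp
    then show ?thesis
      by (auto simp: sterm_def coeff_linv gi_signed gi_grinv gi_gi grinv_mult grinv_uminus signed_def)
  qed
  then show "coeff (linv (f * g)) m = coeff (linv f * linv g) m"
    using m by (simp add: coeff_linv coeff_mult grinv_sum signed_sum)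
qed

lemma linv_lvar: "linv (lvar v) = signed (vodd v) (lvar v)"
  by (rule lser_eqI) (auto simp: coeff_linv coeff_signed lvar.rep_eq svar_def mpar_add_mset)

lemma lscale_add: "lscale c (f + g) = lscale c f + lscale c g"
  by (rule lser_eqI) (simp add: coeff_simps lscale.rep_eq scaleC_add_right)

lemma lscale_add_left: "lscale (c + d) f = lscale c f + lscale d f"
  by (rule lser_eqI) (simp add: coeff_simps lscale.rep_eq scaleC_add_left)

lemma lscale_lscale: "lscale c (lscale d f) = lscale (c * d) f"
  by (rule lser_eqI) (simp add: lscale.rep_eq scaleC_scaleC)

lemma lscale_one [simp]: "lscale 1 f = f"
  by (rule lser_eqI) (simp add: lscale.rep_eq scaleC_one)

lemma lscale_zero [simp]: "lscale 0 f = 0" "lscale c 0 = 0"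
  by (rule lser_eqI, simp add: lscale.rep_eq coeff_simps)+

lemma lscale_uminus: "lscale c (- f) = - lscale c f" "lscale (- c) f = - lscale c f"
  by (rule lser_eqI, simp add: lscale.rep_eq coeff_simps scaleC_uminus scaleC_neg)+

lemma lscale_mult_left: "lscale c f * g = lscale c (f * g)"
  by (rule lser_eqI) (simp add: lscale.rep_eq coeff_mult sterm_def scaleC_sum mult_scaleC_left signed_scaleC)

lemma lscale_mult_right: "f * lscale c g = lscale c (f * g)"
  by (rule lser_eqI) (simp add: lscale.rep_eq coeff_mult sterm_def scaleC_sum mult_scaleC_right
      gi_scaleC signed_scaleC)


subsection \<open>Derivations\<close>

lemma add_mset_minus: "k \<subseteq># m \<Longrightarrow> add_mset v m - k = add_mset v (m - k)"
  by (metis add_mset_add_single subset_mset.add_diff_assoc2)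

lemma sum_submultisets_add_mset:
  assumes "v \<notin># m"
  shows "(\<Sum>k | k \<subseteq># add_mset v m. F k (add_mset v m - k)) =
    (\<Sum>k | k \<subseteq># m. F k (add_mset v (m - k))) + (\<Sum>k | k \<subseteq># m. F (add_mset v k) (m - k))"
proof -
  have "(\<Sum>k | k \<subseteq># add_mset v m. F k (add_mset v m - k)) =
    (\<Sum>k\<in>{k. k \<subseteq># m}. F k (add_mset v m - k)) + (\<Sum>k\<in>add_mset v ` {k. k \<subseteq># m}. F k (add_mset v m - k))"
    unfolding submultisets_add_mset using assms
    by (intro sum.union_disjoint) (auto dest: mset_subset_eqD)
  then show ?thesis
    by (simp add: sum.reindex inj_on_def add_mset_minus)
qed

text \<open>If \<open>v\<close> also occurs in \<open>m\<close>, the submultisets with and without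
  the new copy of \<open>v\<close> overlap. Summands that vanish unless \<open>v \<in># k\<close>
  avoid this: on them \<open>add_mset v\<close> is a bijection of the index sets.\<close>

lemma sum_submultisets_left:
  assumes "\<And>k l. v \<notin># k \<Longrightarrow> F k l = 0"
  shows "(\<Sum>k | k \<subseteq># add_mset v m. F k (add_mset v m - k)) = (\<Sum>k | k \<subseteq># m. F (add_mset v k) (m - k))"
proof -
  have "(\<Sum>k | k \<subseteq># add_mset v m. F k (add_mset v m - k)) =
    (\<Sum>k\<in>add_mset v ` {k. k \<subseteq># m}. F k (add_mset v m - k))"
  proof (intro sum.mono_neutral_right ballI)
    fix k assume k: "k \<in> {k. k \<subseteq># add_mset v m} - add_mset v ` {k. k \<subseteq># m}"
    have "v \<notin># k"
    proof
      assume "v \<in># k"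
      then obtain l where "k = add_mset v l" by (meson multi_member_split)
      then show False using k by auto
    qed
    then show "F k (add_mset v m - k) = 0" using assms by blast
  qed auto
  then show ?thesis by (simp add: sum.reindex inj_on_def)
qed

lemma sum_submultisets_right:
  assumes "\<And>k l. v \<notin># l \<Longrightarrow> F k l = 0"
  shows "(\<Sum>k | k \<subseteq># add_mset v m. F k (add_mset v m - k)) = (\<Sum>k | k \<subseteq># m. F k (add_mset v (m - k)))"
proof -
  have "(\<Sum>k | k \<subseteq># add_mset v m. F k (add_mset v m - k)) =
    (\<Sum>k | k \<subseteq># m. F k (add_mset v m - k))"
  proof (intro sum.mono_neutral_right ballI)
    fix k assume k: "k \<in> {k. k \<subseteq># add_mset v m} - {k. k \<subseteq># m}"
    have "v \<notin># add_mset v m - k"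
    proof
      assume "v \<in># add_mset v m - k"
      then obtain l where "add_mset v m - k = add_mset v l" by (meson multi_member_split)
      then have "add_mset v m = add_mset v (k + l)"
        using k subset_mset.add_diff_inverse by fastforce
      then show False using k by simp
    qed
    then show "F k (add_mset v m - k) = 0" using assms by blast
  qed (auto intro: subset_mset.order_trans[of _ m])
  then show ?thesis by (simp add: add_mset_minus)
qed

lemma coeff_lder_odd: "vodd v \<Longrightarrow> coeff (lder v f) m =
    (if v \<in># m then 0 else signed (below v m) (grinv (coeff f (add_mset v m))))"
  by (simp add: lder.rep_eq sderiv_alt)

lemma coeff_lder_even: "\<not> vodd v \<Longrightarrow> coeff (lder v f) m =
    scaleC (of_nat (count m v + 1)) (coeff f (add_mset v m))"
  by (simp add: lder.rep_eq sderiv_alt)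

lemma lder_add: "lder v (f + g) = lder v f + lder v g"
  by (rule lser_eqI, cases "vodd v")
     (simp_all add: coeff_simps coeff_lder_odd coeff_lder_even grinv_add signed_add scaleC_add_right)

lemma lder_uminus: "lder v (- f) = - lder v f"
  by (rule lser_eqI, cases "vodd v")
     (simp_all add: coeff_simps coeff_lder_odd coeff_lder_even grinv_uminus signed_uminus scaleC_uminus)

lemma lder_zero [simp]: "lder v 0 = 0"
  using lder_add[of v 0 0] by simp

lemma lder_lscale: "lder v (lscale c f) = lscale c (lder v f)"
  by (rule lser_eqI, cases "vodd v")
     (simp_all add: lscale.rep_eq coeff_lder_odd coeff_lder_even grinv_scaleC signed_scaleC scaleC_scaleC mult.commute)

lemma lder_one [simp]: "lder v 1 = 0"
  by (rule lser_eqI, cases "vodd v")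
     (simp_all add: coeff_simps coeff_lder_odd coeff_lder_even sconst_def)

lemma lder_lvar: "lder v (lvar u) = (if u = v then 1 else 0)"
  by (rule lser_eqI, cases "vodd v")
     (auto simp: coeff_simps coeff_lder_odd coeff_lder_even sconst_def lvar.rep_eq svar_def scaleC_one)

lemma lder_linv: "lder v (linv f) = signed (vodd v) (linv (lder v f))"
  by (rule lser_eqI, cases "vodd v")
     (auto simp: coeff_signed coeff_simps coeff_linv coeff_lder_odd coeff_lder_even mpar_add_mset grinv_scaleC
       signed_scaleC signed_uminus gi_signed[of True, simplified] signed_def grinv_uminus scaleC_uminus)

lemma msign_add_mset_even:
  "\<not> vodd v \<Longrightarrow> msign (add_mset v k) l = msign k l" "\<not> vodd v \<Longrightarrow> msign k (add_mset v l) = msign k l"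
  by (simp_all add: msign_alt oddset_add_mset)

text \<open>The factor produced by differentiation is the multiplicity of \<open>v\<close>, which is
  additive over a splitting of the monomial. Each of the two resulting sums is supported on
  splittings that place \<open>v\<close> in the differentiated factor.\<close>

lemma lder_mult_even:
  assumes v: "\<not> vodd v"
  shows "lder v (f * g) = lder v f * g + f * lder v g"
proof (rule lser_eqI)
  fix m assume m: "legal m"
  then have M: "legal (add_mset v m)" using v by (simp add: legal_add_mset)
  define T where "T = sterm (coeff f) (coeff g)"
  have cnt: "count (add_mset v m) v = count k v + count (add_mset v m - k) v" if "k \<subseteq># add_mset v m" for k
    using that by (metis count_union subset_mset.add_diff_inverse)
  have "coeff (lder v (f * g)) m =
    (\<Sum>k | k \<subseteq># add_mset v m. scaleC (of_nat (count (add_mset v m) v)) (T k (add_mset v m - k)))"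
    using m M v by (simp add: coeff_lder_even coeff_mult scaleC_sum T_def)
  also have "\<dots> = (\<Sum>k | k \<subseteq># add_mset v m. scaleC (of_nat (count k v)) (T k (add_mset v m - k))) +
     (\<Sum>k | k \<subseteq># add_mset v m. scaleC (of_nat (count (add_mset v m - k) v)) (T k (add_mset v m - k)))"
    unfolding sum.distrib[symmetric] scaleC_add_left[symmetric] of_nat_add[symmetric]
    using cnt by (intro sum.cong) auto
  also have "(\<Sum>k | k \<subseteq># add_mset v m. scaleC (of_nat (count k v)) (T k (add_mset v m - k))) =
     (\<Sum>k | k \<subseteq># m. scaleC (of_nat (count (add_mset v k) v)) (T (add_mset v k) (m - k)))"
    by (rule sum_submultisets_left) (simp add: not_in_iff)
  also have "\<dots> = coeff (lder v f * g) m"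
    using m v by (simp add: coeff_mult sterm_def T_def coeff_lder_even signed_scaleC mult_scaleC_left
        msign_add_mset_even mpar_add_mset)
  also have "(\<Sum>k | k \<subseteq># add_mset v m. scaleC (of_nat (count (add_mset v m - k) v)) (T k (add_mset v m - k))) =
     (\<Sum>k | k \<subseteq># m. scaleC (of_nat (count (add_mset v (m - k)) v)) (T k (add_mset v (m - k))))"
    by (rule sum_submultisets_right) (simp add: not_in_iff)
  also have "\<dots> = coeff (f * lder v g) m"
    using m v by (simp add: coeff_mult sterm_def T_def coeff_lder_even signed_scaleC mult_scaleC_right
        msign_add_mset_even gi_scaleC)
  finally show "coeff (lder v (f * g)) m = coeff (lder v f * g + f * lder v g) m"
    by (simp add: coeff_simps)
qed

lemma lder_mult_odd:
  assumes v: "vodd v"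
  shows "lder v (f * g) = lder v f * g + linv f * lder v g"
proof (rule lser_eqI)
  fix m assume m: "legal m"
  let ?f = "coeff f" and ?g = "coeff g"
  let ?T1 = "sterm (coeff (lder v f)) ?g" and ?T2 = "sterm (coeff (linv f)) (coeff (lder v g))"
  show "coeff (lder v (f * g)) m = coeff (lder v f * g + linv f * lder v g) m"
  proof (cases "v \<in># m")
    case False
    then have M: "legal (add_mset v m)" using m v by (simp add: legal_add_mset)
    have "signed (below v m) (grinv (sterm ?f ?g (add_mset v k) (m - k))) = ?T1 k (m - k) \<and>
      signed (below v m) (grinv (sterm ?f ?g k (add_mset v (m - k)))) = ?T2 k (m - k)"
      if k: "k \<subseteq># m" for k
    proof -
      define l where "l = m - k"
      have ml: "m = k + l" using k by (simp add: l_def)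
      have vk: "v \<notin># k" "v \<notin># l" using False ml by auto
      have leg: "legal (add_mset v k)" "legal k" "legal l" "legal (add_mset v l)" "legal (k + l)"
        using M m vk v unfolding ml by (auto simp: legal_add_mset dest: legal_addD)
      have 1: "msign (add_mset v k) l = (below v l \<noteq> msign k l)"
        using msign_add_left[of "{#v#}" k l] leg v by (simp add: msign_single_left)
      have 2: "msign k (add_mset v l) = ((mpar k \<noteq> below v k) \<noteq> msign k l)"
        using msign_add_right[of "{#v#}" l k] leg v vk by (simp add: msign_single_right)
      have 3: "below v m = (below v k \<noteq> below v l)" unfolding ml using leg by (simp add: below_add)
      show ?thesis unfolding l_def[symmetric] using v vk
        by (auto simp: sterm_def 1 2 3 coeff_lder_odd coeff_linv mpar_add_mset gi_signed gi_grinv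
            gi_gi gi_def grinv_mult grinv_uminus signed_def)
    qed
    then show ?thesis
      using m M False v
      by (simp add: coeff_simps coeff_lder_odd coeff_mult sum_submultisets_add_mset grinv_add grinv_sum
          signed_add signed_sum)
  next
    case True
    then obtain n where n: "m = add_mset v n" by (meson multi_member_split)
    have vn: "v \<notin># n" and ln: "legal n" using m v by (auto simp: n legal_add_mset)
    \<comment> \<open>As \<open>v\<close> already occurs in \<open>m\<close>, the left side of the
      Leibniz rule has coefficient 0. On the right the undifferentiated factor must contain
      \<open>v\<close>, and the two ways of arranging this cancel in pairs.\<close>
    have "?T1 k (add_mset v (n - k)) + ?T2 (add_mset v k) (n - k) = 0" if k: "k \<subseteq># n" for k
    proof -
      define l where "l = n - k"
      have nl: "n = k + l" using k by (simp add: l_def)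
      have vk: "v \<notin># k" "v \<notin># l" using vn nl by auto
      have leg: "legal (add_mset v k)" "legal k" "legal l" "legal (add_mset v l)" "legal (k + l)"
        using ln m vk v unfolding nl by (auto simp: legal_add_mset dest: legal_addD)
      have 1: "msign (add_mset v k) l = (below v l \<noteq> msign k l)"
        using msign_add_left[of "{#v#}" k l] leg v by (simp add: msign_single_left)
      have 2: "msign k (add_mset v l) = ((mpar k \<noteq> below v k) \<noteq> msign k l)"
        using msign_add_right[of "{#v#}" l k] leg v vk by (simp add: msign_single_right)
      show ?thesis unfolding l_def[symmetric] using v vk
        by (auto simp: sterm_def 1 2 coeff_lder_odd coeff_linv mpar_add_mset gi_signed gi_grinv
            gi_gi gi_def grinv_uminus signed_def)
    qed
    then have "(\<Sum>k | k \<subseteq># n. ?T1 k (add_mset v (n - k))) + (\<Sum>k | k \<subseteq># n. ?T2 (add_mset v k) (n - k)) = 0"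
      by (simp add: sum.distrib[symmetric])
    moreover have "(\<Sum>k | k \<subseteq># n. ?T1 (add_mset v k) (n - k)) = 0"
      using v by (intro sum.neutral) (auto simp: sterm_def coeff_lder_odd)
    moreover have "(\<Sum>k | k \<subseteq># n. ?T2 k (add_mset v (n - k))) = 0"
      using v by (intro sum.neutral) (auto simp: sterm_def coeff_lder_odd)
    ultimately show ?thesis
      using m v vn unfolding n
      by (simp add: coeff_simps coeff_lder_odd coeff_mult sum_submultisets_add_mset)
  qed
qed

lemma lder_mult: "lder v (f * g) = lder v f * g + lgi (vodd v) f * lder v g"
  by (cases "vodd v") (simp_all add: lder_mult_odd lder_mult_even)

lemma lder_commute:
  assumes "u < v"
  shows "lder v (lder u f) = signed (vodd u \<and> vodd v) (lder u (lder v f))"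
proof (rule lser_eqI)
  fix m assume m: "legal m"
  have ne: "u \<noteq> v" "v \<noteq> u" "\<not> v < u" using assms by auto
  show "coeff (lder v (lder u f)) m = coeff (signed (vodd u \<and> vodd v) (lder u (lder v f))) m"
    using ne assms m
    by (cases "vodd u"; cases "vodd v")
       (auto simp: coeff_lder_odd coeff_lder_even coeff_signed coeff_simps below_add_mset legal_add_mset
         add_mset_commute[of u v] scaleC_scaleC grinv_scaleC grinv_uminus signed_def mult.commute
         scaleC_uminus)
qed

section \<open>Multiplication by a variable\<close>

lemma coeff_lvar_mult:
  assumes "legal m"
  shows "coeff (lvar v * f) m =
    (if v \<in># m then signed (msign {#v#} (m - {#v#})) (gi (vodd v) (coeff f (m - {#v#}))) else 0)"
proof -
  have "coeff (lvar v * f) m = (\<Sum>k | k \<subseteq># m. if k = {#v#} then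
     signed (msign {#v#} (m - {#v#})) (gi (vodd v) (coeff f (m - {#v#}))) else 0)"
    unfolding coeff_mult[OF assms]
    by (rule sum.cong) (auto simp: sterm_def lvar.rep_eq svar_def mpar_add_mset)
  then show ?thesis by (simp add: sum.delta)
qed

lemma coeff_mult_lvar:
  assumes "legal m"
  shows "coeff (f * lvar v) m =
    (if v \<in># m then signed (msign (m - {#v#}) {#v#}) (coeff f (m - {#v#})) else 0)"
proof -
  have "coeff (f * lvar v) m = (\<Sum>k | k \<subseteq># m. if k = m - {#v#} then (if v \<in># m then
     signed (msign (m - {#v#}) {#v#}) (coeff f (m - {#v#})) else 0) else 0)"
    unfolding coeff_mult[OF assms]
  proof (rule sum.cong)
    fix k assume "k \<in> {k. k \<subseteq># m}"
    then obtain l where l: "m = k + l" by (auto simp: subset_mset.le_iff_add)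
    have "l = {#v#}" if "k = m - {#v#}" "v \<in># m"
      using insert_DiffM[OF that(2)] that(1) l by (metis add_left_cancel add_mset_add_single)
    then have "m - k = {#v#} \<longleftrightarrow> k = m - {#v#} \<and> v \<in># m"
      by (auto simp: l)
    then show "sterm (coeff f) (coeff (lvar v)) k (m - k) = (if k = m - {#v#} then (if v \<in># m then
     signed (msign (m - {#v#}) {#v#}) (coeff f (m - {#v#})) else 0) else 0)"
      by (auto simp: sterm_def lvar.rep_eq svar_def)
  qed simp
  then show ?thesis by (simp add: sum.delta)
qed

lemma lvar_mult_commute: "lvar v * f = lgi (vodd v) f * lvar v"
proof (rule lser_eqI)
  fix m assume m: "legal m"
  show "coeff (lvar v * f) m = coeff (lgi (vodd v) f * lvar v) m"
  proof (cases "v \<in># m")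
    case True
    then obtain n where n: "m = add_mset v n" by (meson multi_member_split)
    show ?thesis
      using m unfolding coeff_lvar_mult[OF m] coeff_mult_lvar[OF m] unfolding n
      by (cases "vodd v") (auto simp: legal_add_mset msign_single_left msign_single_right
          msign_single_even coeff_linv signed_signed signed_def)
  qed (use m in \<open>simp add: coeff_lvar_mult coeff_mult_lvar\<close>)
qed

lemma lvar_odd_square: "vodd v \<Longrightarrow> lvar v * lvar v = 0"
  by (rule lser_eqI) (auto simp: coeff_lvar_mult lvar.rep_eq svar_def coeff_simps dest!: multi_member_split
      simp: legal_add_mset)

section \<open>The odd derivation \<open>D\<close> on series\<close>

lemma lD_add: "lD (f + g) = lD f + lD g"
  by (simp add: lD_def lder_add distrib_left)

lemma lD_zero [simp]: "lD 0 = 0" by (simp add: lD_def)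

lemma lD_sum: "lD (sum f A) = (\<Sum>i\<in>A. lD (f i))"
  by (induction A rule: infinite_finite_induct) (auto simp: lD_add)

lemma lD_uminus: "lD (- f) = - lD f"
  by (simp add: lD_def lder_uminus)

lemma lD_signed: "lD (signed p f) = signed p (lD f)"
  by (auto simp: signed_def lD_uminus)

lemma lD_lscale: "lD (lscale c f) = lscale c (lD f)"
  by (simp add: lD_def lder_lscale lscale_mult_right lscale_add)

lemma lD_one [simp]: "lD 1 = 0" by (simp add: lD_def)

lemma lD_mult: "lD (f * g) = lD f * g + linv f * lD g"
proof -
  have "lvar Xi * (f * lder X g) = linv f * (lvar Xi * lder X g)"
    using lvar_mult_commute[of Xi f] by (simp add: mult.assoc[symmetric])
  then show ?thesis
    by (simp add: lD_def lder_mult algebra_simps)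
qed

lemma linv_lD: "linv (lD f) = - lD (linv f)"
  by (simp add: lD_def lder_linv linv_add linv_mult linv_lvar)

lemma lD_Xi: "lD (lvar Xi) = 1"
  by (simp add: lD_def lder_lvar)

lemma lD_lvar: "v \<noteq> X \<Longrightarrow> v \<noteq> Xi \<Longrightarrow> lD (lvar v) = 0"
  by (simp add: lD_def lder_lvar)

lemma lder_lD:
  assumes "v \<noteq> X" "v \<noteq> Xi"
  shows "lder v (lD f) = signed (vodd v) (lD (lder v f))"
proof -
  have "X < v" "Xi < v" using assms by (cases v; simp add: less_var_def)+
  then show ?thesis
    using assms by (cases "vodd v") (simp_all add: lD_def lder_add lder_mult lder_commute lder_lvar linv_lvar)
qed


subsection \<open>The coefficients of \<open>D\<^sup>m f\<close>\<close>

definition Dc :: "int \<Rightarrow> nat \<Rightarrow> 'a::supercommutative_algebra lser \<Rightarrow> 'a lser" where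
  "Dc m r f = lscale (sbinom m r) ((lD ^^ r) (lgi (odd (m - int r)) f))"

lemma coeff_lD_power: "coeff ((lD ^^ r) f) = (sD ^^ r) (coeff f)"
  by (induction r) (simp_all add: coeff_lD)

lemma coeff_Dc: "coeff (Dc m r f) = Dcomm m r (coeff f)"
  by (simp add: Dc_def Dcomm_def lscale.rep_eq coeff_lD_power lgi_def linv.rep_eq)

lemma lD_power_add: "(lD ^^ r) (f + g) = (lD ^^ r) f + (lD ^^ r) g"
  by (induction r) (simp_all add: lD_add)

lemma lD_power_zero [simp]: "(lD ^^ r) 0 = 0"
  by (induction r) simp_all

lemma lD_power_lscale: "(lD ^^ r) (lscale c f) = lscale c ((lD ^^ r) f)"
  by (induction r) (simp_all add: lD_lscale)

lemma linv_lD_power: "linv ((lD ^^ r) f) = signed (odd r) ((lD ^^ r) (linv f))"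
  by (induction r) (simp_all add: linv_lD lD_signed signed_def lD_uminus)

lemma Dc_add: "Dc m r (f + g) = Dc m r f + Dc m r g"
  by (simp add: Dc_def lgi_def linv_add lD_power_add lscale_add)

lemma Dc_0 [simp]: "Dc m r 0 = 0"
  using Dc_add[of m r 0 0] by simp

lemma Dc_zero: "Dc 0 r f = (if r = 0 then f else 0)"
proof -
  have "sbinom 0 r = (if r = 0 then 1 else 0)"
    by (cases "r div 2") (auto simp: sbinom_def)
  then show ?thesis by (simp add: Dc_def)
qed

text \<open>The ordinary Pascal rule is needed only for \<open>m\<close> and \<open>r\<close> both
  odd; in the other cases a vanishing coefficient leaves a single term. The sign for odd
  \<open>Suc r\<close> is the one that arises when \<open>linv\<close> passes \<open>Suc r\<close>
  copies of \<open>lD\<close>.\<close>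

lemma sbinom_Suc: "sbinom (m + 1) (Suc r) = (if odd (Suc r) then - sbinom m (Suc r) else sbinom m (Suc r)) + sbinom m r"
proof -
  have e: "(m + 1) div 2 = (if even m then m div 2 else m div 2 + 1)" by presburger
  show ?thesis
  proof (cases "even m")
    case True
    then show ?thesis by (cases "even r") (auto simp: sbinom_def e)
  next
    case False
    show ?thesis
    proof (cases "even r")
      case True
      then show ?thesis using False by (auto simp: sbinom_def e)
    next
      case False
      then obtain b where b: "r = 2 * b + 1" by (elim oddE)
      show ?thesis using \<open>odd m\<close> unfolding b
        by (simp add: sbinom_def e) (metis add.commute gbinomial_Suc_Suc of_int_1 of_int_add)
    qed
  qed
qed

lemma Dc_rec_0: "Dc (m + 1) 0 f = linv (Dc m 0 f)"
  by (simp add: Dc_def sbinom_def lgi_def linv_lscale)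

text \<open>Coefficientwise this is \<open>D^(m+1) f = D (D^m f)\<close>, where
  \<open>D g = linv g D + lD g\<close>.\<close>

lemma Dc_rec_Suc: "Dc (m + 1) (Suc r) f = lD (Dc m r f) + linv (Dc m (Suc r) f)"
proof -
  define g where "g = (lD ^^ Suc r) (lgi (odd (m - int r)) f)"
  have "linv (lgi (odd (m - int (Suc r))) f) = lgi (odd (m - int r)) f"
    by (auto simp: lgi_def)
  then have "linv (Dc m (Suc r) f) = lscale (sbinom m (Suc r)) (signed (odd (Suc r)) g)"
    by (simp only: Dc_def linv_lscale linv_lD_power g_def)
  moreover have "lD (Dc m r f) = lscale (sbinom m r) g"
    by (simp add: Dc_def lD_lscale g_def)
  moreover have "Dc (m + 1) (Suc r) f = lscale (sbinom (m + 1) (Suc r)) g"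
    by (simp add: Dc_def g_def)
  ultimately show ?thesis
    unfolding sbinom_Suc by (simp add: lscale_add_left lscale_uminus signed_def)
qed

text \<open>The recursion in \<open>m\<close> can be run backwards because \<open>linv\<close> is invertible; so the Leibniz rule
  and \<open>D\<^sup>m D\<^sup>n = D\<^bsup>m + n\<^esup>\<close> need to be checked at \<open>m = 0\<close> only.\<close>

lemma Dc_rec_unique:
  fixes L R :: "int \<Rightarrow> nat \<Rightarrow> 'a::supercommutative_algebra lser"
  assumes L0: "\<And>m. L (m + 1) 0 = linv (L m 0)"
    and LS: "\<And>m r. L (m + 1) (Suc r) = lD (L m r) + linv (L m (Suc r))"
    and R0: "\<And>m. R (m + 1) 0 = linv (R m 0)"
    and RS: "\<And>m r. R (m + 1) (Suc r) = lD (R m r) + linv (R m (Suc r))"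
    and base: "\<And>r. L 0 r = R 0 r"
  shows "L m r = R m r"
proof -
  have "\<forall>r. L m r = R m r"
  proof (induction m rule: int_induct[where k = 0])
    case base
    then show ?case using assms by blast
  next
    case (step1 i)
    show ?case
    proof
      fix r show "L (i + 1) r = R (i + 1) r"
        using step1 by (cases r) (simp_all add: L0 LS R0 RS)
    qed
  next
    case (step2 i)
    show ?case
    proof
      fix r show "L (i - 1) r = R (i - 1) r"
      proof (induction r)
        case 0
        have "linv (L (i - 1) 0) = linv (R (i - 1) 0)"
          using step2 L0[of "i - 1"] R0[of "i - 1"] by simp
        then show ?case by (rule linv_inject)
      next
        case (Suc r)
        have "L i (Suc r) = R i (Suc r)" using step2 by blast
        then have "lD (L (i - 1) r) + linv (L (i - 1) (Suc r)) = lD (R (i - 1) r) + linv (R (i - 1) (Suc r))"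
          using LS[of "i - 1" r] RS[of "i - 1" r] by simp
        then have "linv (L (i - 1) (Suc r)) = linv (R (i - 1) (Suc r))"
          using Suc by simp
        then show ?case by (rule linv_inject)
      qed
    qed
  qed
  then show ?thesis by blast
qed

text \<open>Coefficient form of \<open>D^m (g h) = (D^m g) h\<close>, with \<open>D^(m - b)\<close>
  moved on past \<open>h\<close>. Both sides obey the recursion in \<open>m\<close>.\<close>

lemma Dc_mult: "Dc m r (g * h) = (\<Sum>b\<le>r. Dc m b g * Dc (m - int b) (r - b) h)"
proof (rule Dc_rec_unique[where m = m and r = r])
  fix m r
  let ?R = "\<lambda>m r. \<Sum>b\<le>r. Dc m b g * Dc (m - int b) (r - b) h"
  show "?R (m + 1) 0 = linv (?R m 0)"
    by (simp add: Dc_rec_0 linv_mult)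
  \<comment> \<open>The added sum supplies the missing \<open>lD\<close> terms, so that the
    recursion can be applied to the factor with \<open>h\<close> inside the sum.\<close>
  have "linv (?R m (Suc r)) + (\<Sum>b\<le>r. linv (Dc m b g) * lD (Dc (m - int b) (r - b) h)) =
    (\<Sum>b\<le>r. linv (Dc m b g) * (lD (Dc (m - int b) (r - b) h) + linv (Dc (m - int b) (Suc (r - b)) h)))
      + linv (Dc m (Suc r) g) * linv (Dc (m - int (Suc r)) 0 h)"
    by (simp add: linv_add linv_sum linv_mult sum.distrib distrib_left Suc_diff_le)
  also have "\<dots> = (\<Sum>b\<le>Suc r. linv (Dc m b g) * Dc (m + 1 - int b) (Suc r - b) h)"
    by (simp add: Dc_rec_Suc[symmetric] Dc_rec_0[symmetric] Suc_diff_le algebra_simps)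
  also have "\<dots> = linv (Dc m 0 g) * Dc (m + 1) (Suc r) h
      + (\<Sum>b\<le>r. linv (Dc m (Suc b) g) * Dc (m - int b) (r - b) h)"
    by (subst sum.atMost_Suc_shift) simp
  finally have *: "linv (?R m (Suc r)) + (\<Sum>b\<le>r. linv (Dc m b g) * lD (Dc (m - int b) (r - b) h)) = \<dots>" .
  have "?R (m + 1) (Suc r) = linv (Dc m 0 g) * Dc (m + 1) (Suc r) h +
      (\<Sum>b\<le>r. (lD (Dc m b g) + linv (Dc m (Suc b) g)) * Dc (m - int b) (r - b) h)"
    by (subst sum.atMost_Suc_shift) (simp add: Dc_rec_0[symmetric] Dc_rec_Suc[symmetric])
  also have "\<dots> = (\<Sum>b\<le>r. lD (Dc m b g) * Dc (m - int b) (r - b) h) + (linv (Dc m 0 g) * Dc (m + 1) (Suc r) h +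
      (\<Sum>b\<le>r. linv (Dc m (Suc b) g) * Dc (m - int b) (r - b) h))"
    by (simp only: sum.distrib distrib_right add.left_commute)
  also have "\<dots> = lD (?R m r) + linv (?R m (Suc r))"
    unfolding *[symmetric] by (simp only: lD_sum lD_mult sum.distrib add.assoc add.left_commute add.commute)
  finally show "?R (m + 1) (Suc r) = lD (?R m r) + linv (?R m (Suc r))" .
next
  fix r show "Dc 0 r (g * h) = (\<Sum>b\<le>r. Dc 0 b g * Dc (0 - int b) (r - b) h)"
    by (simp add: Dc_zero if_distrib[of "\<lambda>x. x * _"] sum.delta cong: if_cong)
qed (simp_all add: Dc_rec_0 Dc_rec_Suc)

text \<open>Coefficient form of \<open>D^(m + n) h = D^m (D^n h)\<close>; the recursion runs in
  \<open>m\<close> with \<open>n\<close> fixed.\<close>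

lemma Dc_Dc: "Dc (m + n) r h = (\<Sum>u\<le>r. Dc m u (Dc n (r - u) h))"
proof (rule Dc_rec_unique[where m = m and r = r and L = "\<lambda>m r. Dc (m + n) r h"])
  fix m r
  let ?R = "\<lambda>m r. \<Sum>u\<le>r. Dc m u (Dc n (r - u) h)"
  show "Dc (m + 1 + n) 0 h = linv (Dc (m + n) 0 h)"
    using Dc_rec_0[of "m + n" h] by (simp add: algebra_simps)
  show "Dc (m + 1 + n) (Suc r) h = lD (Dc (m + n) r h) + linv (Dc (m + n) (Suc r) h)"
    using Dc_rec_Suc[of "m + n" r h] by (simp add: algebra_simps)
  show "?R (m + 1) 0 = linv (?R m 0)" by (simp add: Dc_rec_0)
  show "?R (m + 1) (Suc r) = lD (?R m r) + linv (?R m (Suc r))"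
  proof -
    have "?R (m + 1) (Suc r) = linv (Dc m 0 (Dc n (Suc r) h)) +
        (\<Sum>u\<le>r. lD (Dc m u (Dc n (r - u) h)) + linv (Dc m (Suc u) (Dc n (r - u) h)))"
      by (subst sum.atMost_Suc_shift) (simp add: Dc_rec_0[symmetric] Dc_rec_Suc[symmetric])
    moreover have "?R m (Suc r) = Dc m 0 (Dc n (Suc r) h) + (\<Sum>u\<le>r. Dc m (Suc u) (Dc n (r - u) h))"
      by (subst sum.atMost_Suc_shift) simp
    ultimately show ?thesis
      by (simp only: lD_sum linv_add linv_sum sum.distrib add.left_commute)
  qed
next
  fix r show "Dc (0 + n) r h = (\<Sum>u\<le>r. Dc 0 u (Dc n (r - u) h))"
    by (simp add: Dc_zero sum.delta cong: if_cong)
qed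

lemma linv_Dc: "linv (Dc m r f) = signed (odd r) (Dc m r (linv f))"
  by (auto simp: Dc_def linv_lscale linv_lD_power lgi_def signed_def lscale_uminus)

lemma lD_power_signed: "(lD ^^ r) (signed p f) = signed p ((lD ^^ r) f)"
  by (induction r) (simp_all add: lD_signed)

lemma lscale_signed: "lscale c (signed p f) = signed p (lscale c f)"
  by (auto simp: signed_def lscale_uminus)

lemma lder_lD_power:
  assumes "v \<noteq> X" "v \<noteq> Xi"
  shows "lder v ((lD ^^ r) f) = signed (vodd v \<and> odd r) ((lD ^^ r) (lder v f))"
  by (induction r) (auto simp: lder_lD assms lD_signed signed_def lD_uminus)

lemma lder_Dc:
  assumes "v \<noteq> X" "v \<noteq> Xi"
  shows "lder v (Dc m r f) = signed (vodd v \<and> odd m) (Dc m r (lder v f))"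
proof -
  have "lder v (lgi (odd (m - int r)) f) = signed (vodd v \<and> odd (m - int r)) (lgi (odd (m - int r)) (lder v f))"
    by (auto simp: lgi_def lder_linv)
  then have "lder v ((lD ^^ r) (lgi (odd (m - int r)) f)) = signed (vodd v \<and> odd r)
      (signed (vodd v \<and> odd (m - int r)) ((lD ^^ r) (lgi (odd (m - int r)) (lder v f))))"
    by (simp only: lder_lD_power[OF assms] lD_power_signed)
  also have "\<dots> = signed (vodd v \<and> odd m) ((lD ^^ r) (lgi (odd (m - int r)) (lder v f)))"
    by (auto simp: signed_def)
  finally show ?thesis
    by (simp add: Dc_def lder_lscale lscale_signed)
qed

lemma sbinom_0_right [simp]: "sbinom m 0 = 1" by (simp add: sbinom_def)

lemma Dc_one: "Dc m r 1 = (if r = 0 then 1 else 0)"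
  by (cases r) (auto simp: Dc_def lgi_def funpow_Suc_right simp del: funpow.simps)


section \<open>Weight filtrations of series\<close>

text \<open>Convergence is measured by the weights of the times alone: \<open>lD\<close> preserves
  this filtration because \<open>X\<close> and \<open>Xi\<close> have weight 0, whereas a time
  derivative by \<open>v\<close> loses \<open>weight v\<close>.\<close>

definition val :: "nat \<Rightarrow> 'a::supercommutative_algebra lser \<Rightarrow> bool" where
  "val w f \<longleftrightarrow> (\<forall>k. coeff f k \<noteq> 0 \<longrightarrow> w \<le> mweight k)"

text \<open>Here \<open>\<xi>\<close> gets weight \<open>1\<close>: then \<open>D\<close> lowers this weight by at most one, and the bound
  \<open>C\<close> in \<open>E_hat\<close> becomes additive under products. In particular operators with \<open>C = 0\<close> are closed
  under products, which fails for the weights of the time variables alone.\<close>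

definition xweight :: "mono \<Rightarrow> nat" where
  "xweight m = mweight m + count m Xi"

definition ordb :: "int \<Rightarrow> 'a::supercommutative_algebra lser \<Rightarrow> bool" where
  "ordb d f \<longleftrightarrow> (\<forall>k. coeff f k \<noteq> 0 \<longrightarrow> d \<le> int (xweight k))"

lemma xweight_add: "xweight (k + l) = xweight k + xweight l"
  by (simp add: xweight_def mweight_add)

lemma coeff_mult_nonzero:
  assumes "coeff (f * g) m \<noteq> 0"
  obtains k l where "m = k + l" "coeff f k \<noteq> 0" "coeff g l \<noteq> 0"
proof -
  have m: "legal m" using assms coeff_illegal by blast
  obtain k where k: "k \<subseteq># m" "sterm (coeff f) (coeff g) k (m - k) \<noteq> 0"
    using assms unfolding coeff_mult[OF m] by (elim sum.not_neutral_contains_not_neutral) simp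
  then have "coeff f k \<noteq> 0" "coeff g (m - k) \<noteq> 0" by (auto simp: sterm_def)
  then show ?thesis using that[of k "m - k"] k by simp
qed

lemma val_0 [simp]: "val 0 f" by (simp add: val_def)
lemma val_zero [simp]: "val w 0" by (simp add: val_def coeff_simps)
lemma val_mono: "val w f \<Longrightarrow> v \<le> w \<Longrightarrow> val v f" by (force simp: val_def)
lemma val_add: "val w f \<Longrightarrow> val w g \<Longrightarrow> val w (f + g)"
  by (force simp: val_def coeff_simps)
lemma val_uminus: "val w f \<Longrightarrow> val w (- f)" by (auto simp: val_def coeff_simps)
lemma val_diff: "val w f \<Longrightarrow> val w g \<Longrightarrow> val w (f - g)"
  using val_add[of w f "- g"] val_uminus[of w g] by simp
lemma val_sum: "(\<And>i. i \<in> A \<Longrightarrow> val w (f i)) \<Longrightarrow> val w (sum f A)"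
  by (induction A rule: infinite_finite_induct) (auto simp: val_add)
lemma val_mult: "val v f \<Longrightarrow> val w g \<Longrightarrow> val (v + w) (f * g)"
  unfolding val_def by (metis add_mono coeff_mult_nonzero mweight_add)
lemma val_mult_left: "val w f \<Longrightarrow> val w (f * g)"
  using val_mult[of w f 0 g] by simp
lemma val_mult_right: "val w g \<Longrightarrow> val w (f * g)"
  using val_mult[of 0 f w g] by simp
lemma val_linv: "val w f \<Longrightarrow> val w (linv f)"
  by (auto simp: val_def coeff_linv) (metis grinv_zero)
lemma val_signed: "val w f \<Longrightarrow> val w (signed p f)"
  by (auto simp: signed_def val_uminus)
lemma val_lscale: "val w f \<Longrightarrow> val w (lscale c f)"
  by (auto simp: val_def lscale.rep_eq) (metis scaleC_zero_right)

lemma coeff_lder_nonzero: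
  "coeff (lder v f) m \<noteq> 0 \<Longrightarrow> coeff f (add_mset v m) \<noteq> 0"
  by (cases "vodd v") (auto simp: coeff_lder_odd coeff_lder_even split: if_splits)

lemma val_lder: "val (w + weight v) f \<Longrightarrow> val w (lder v f)"
  using coeff_lder_nonzero[of v f] by (force simp: val_def mweight_add_mset)

lemma val_lD: "val w f \<Longrightarrow> val w (lD f)"
  using val_lder[of w Xi f] val_lder[of w X f] by (auto simp: lD_def intro!: val_add val_mult_right)

lemma val_Dc: "val w f \<Longrightarrow> val w (Dc m r f)"
proof -
  assume "val w f"
  then have "val w (lgi p f)" for p by (cases p) (auto simp: val_linv)
  then have "val w ((lD ^^ r) (lgi p f))" for p by (induction r) (auto simp: val_lD)
  then show ?thesis by (simp add: Dc_def val_lscale)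
qed

lemma val_eqI: "(\<And>w. val w (f - g)) \<Longrightarrow> f = g"
proof (rule lser_eqI)
  fix m assume "\<And>w. val w (f - g)"
  then have "coeff (f - g) m = 0" unfolding val_def by (meson not_less_eq_eq order_refl)
  then show "coeff f m = coeff g m" by (simp add: coeff_simps)
qed

section \<open>The filtration in which \<open>Xi\<close> has weight one\<close>

lemma ordb_0: "d \<le> 0 \<Longrightarrow> ordb d f" by (auto simp: ordb_def)
lemma ordb_zero [simp]: "ordb d 0" by (simp add: ordb_def coeff_simps)
lemma ordb_mono: "ordb d f \<Longrightarrow> e \<le> d \<Longrightarrow> ordb e f" by (force simp: ordb_def)
lemma ordb_add: "ordb d f \<Longrightarrow> ordb d g \<Longrightarrow> ordb d (f + g)"
  by (force simp: ordb_def coeff_simps)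
lemma ordb_uminus: "ordb d f \<Longrightarrow> ordb d (- f)" by (auto simp: ordb_def coeff_simps)
lemma ordb_mult: "ordb d f \<Longrightarrow> ordb e g \<Longrightarrow> ordb (d + e) (f * g)"
  unfolding ordb_def by (smt (verit, best) coeff_mult_nonzero of_nat_add xweight_add)
lemma ordb_linv: "ordb d f \<Longrightarrow> ordb d (linv f)"
  by (auto simp: ordb_def coeff_linv) (metis grinv_zero)
lemma ordb_signed: "ordb d f \<Longrightarrow> ordb d (signed p f)"
  by (auto simp: signed_def ordb_uminus)
lemma ordb_lscale: "ordb d f \<Longrightarrow> ordb d (lscale c f)"
  by (auto simp: ordb_def lscale.rep_eq) (metis scaleC_zero_right)

lemma ordb_lder: "ordb d f \<Longrightarrow> ordb (d - int (weight v) - (if v = Xi then 1 else 0)) (lder v f)"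
  using coeff_lder_nonzero[of v f] by (force simp: ordb_def mweight_add_mset xweight_def)

lemma ordb_lvar: "ordb (int (weight v) + (if v = Xi then 1 else 0)) (lvar v)"
  by (auto simp: ordb_def lvar.rep_eq svar_def xweight_def mweight_add_mset)

lemma ordb_lD: "ordb d f \<Longrightarrow> ordb (d - 1) (lD f)"
  using ordb_lder[of d f Xi] ordb_mult[OF ordb_lvar[of Xi] ordb_lder[of d f X]]
  by (auto simp: lD_def intro!: ordb_add elim: ordb_mono)

lemma ordb_Dc: "ordb d f \<Longrightarrow> ordb (d - int r) (Dc m r f)"
proof -
  assume "ordb d f"
  then have "ordb d (lgi p f)" for p by (cases p) (auto simp: ordb_linv)
  then have "ordb (d - int r) ((lD ^^ r) (lgi p f))" for p
  proof (induction r)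
    case (Suc r)
    then show ?case using ordb_lD[OF Suc(1)[OF Suc(2)]] by (simp add: algebra_simps)
  qed simp
  then show ?thesis by (simp add: Dc_def ordb_lscale)
qed

text \<open>A legal monomial contains \<open>Xi\<close> at most once, so the two weights differ by
  at most one; hence the \<open>+ 1\<close>.\<close>

lemma ordb_imp_val: "ordb (int w + 1) f \<Longrightarrow> val w f"
  unfolding ordb_def val_def
proof (intro allI impI)
  fix k assume a: "\<forall>k. coeff f k \<noteq> 0 \<longrightarrow> int w + 1 \<le> int (xweight k)" "coeff f k \<noteq> 0"
  then have "legal k" using coeff_illegal by blast
  then have "count k Xi \<le> 1" by (simp add: legal_def)
  then show "w \<le> mweight k" using a by (force simp: xweight_def)
qed


section \<open>Locally finite sums\<close>

lemma fsum_eq: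
  assumes "finite J" "J \<subseteq> I" "\<And>i. i \<in> I \<Longrightarrow> i \<notin> J \<Longrightarrow> F i = 0"
  shows "fsum I F = sum F J"
  unfolding fsum_def using assms by (intro sum.mono_neutral_left) auto

lift_definition lsum :: "('i \<Rightarrow> 'a::supercommutative_algebra lser) \<Rightarrow> 'a lser" is
  "\<lambda>F m. fsum UNIV (\<lambda>i. F i m)"
  unfolding fsum_def by (metis (mono_tags, lifting) mem_Collect_eq sum.neutral)

text \<open>Only finitely many members matter below each weight, so every coefficient of the family
  is a finite sum. This excludes the default value 0 of \<open>fsum\<close>, which would destroy
  additivity.\<close>

definition locfin :: "('i \<Rightarrow> 'a::supercommutative_algebra lser) \<Rightarrow> bool" where
  "locfin F \<longleftrightarrow> (\<forall>w. finite {i. \<not> val w (F i)})"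

lemma lsum_approx:
  assumes "finite J" "\<And>i. i \<notin> J \<Longrightarrow> val w (F i)"
  shows "val w (lsum F - sum F J)"
  unfolding val_def
proof (intro allI impI, rule ccontr)
  fix k assume k: "coeff (lsum F - sum F J) k \<noteq> 0" "\<not> w \<le> mweight k"
  have "fsum UNIV (\<lambda>i. coeff (F i) k) = (\<Sum>i\<in>J. coeff (F i) k)"
    using assms k by (intro fsum_eq) (auto simp: val_def)
  then show False using k by (simp add: coeff_simps lsum.rep_eq coeff_sum)
qed

lemma lsum_finite:
  assumes "finite J" "\<And>i. i \<notin> J \<Longrightarrow> F i = 0"
  shows "lsum F = sum F J"
  by (rule val_eqI) (rule lsum_approx, use assms in auto)

lemma lsum_image:
  assumes "finite A" "inj_on g A" "\<And>i. i \<notin> g ` A \<Longrightarrow> F i = 0"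
  shows "lsum F = (\<Sum>x\<in>A. F (g x))"
  using lsum_finite[of "g ` A" F] assms by (simp add: sum.reindex)

lemma lsum_single: "(\<And>i. i \<noteq> i0 \<Longrightarrow> F i = 0) \<Longrightarrow> lsum F = F i0"
  using lsum_finite[of "{i0}" F] by simp

lemma lsum_add:
  assumes "locfin F" "locfin G"
  shows "lsum (\<lambda>i. F i + G i) = lsum F + lsum G"
proof (rule val_eqI)
  fix w
  define J where "J = {i. \<not> val w (F i)} \<union> {i. \<not> val w (G i)}"
  have J: "finite J" using assms by (simp add: J_def locfin_def)
  have "val w (lsum F - sum F J)" "val w (lsum G - sum G J)"
    "val w (lsum (\<lambda>i. F i + G i) - (\<Sum>i\<in>J. F i + G i))"
    using J by (intro lsum_approx; auto simp: J_def val_add)+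
  then have "val w ((lsum (\<lambda>i. F i + G i) - (\<Sum>i\<in>J. F i + G i)) - (lsum F - sum F J) - (lsum G - sum G J))"
    by (intro val_diff[of w "_ - _"]) assumption+
  then show "val w (lsum (\<lambda>i. F i + G i) - (lsum F + lsum G))"
    by (simp add: sum.distrib algebra_simps)
qed

lemma val_lsum: "(\<And>i. val w (F i)) \<Longrightarrow> val w (lsum F)"
  using lsum_approx[of "{}" w F] by simp

lemma ordb_lsum: "(\<And>i. ordb d (F i)) \<Longrightarrow> ordb d (lsum F)"
  unfolding ordb_def lsum.rep_eq fsum_def
  by (metis (mono_tags, lifting) sum.neutral)


section \<open>The ring of operators\<close>

definition bounded_by :: "int \<Rightarrow> (int \<Rightarrow> 'a::supercommutative_algebra lser) \<Rightarrow> bool" where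
  "bounded_by C P \<longleftrightarrow> (\<forall>n. ordb (n - C) (P n))"

lemma bounded_byD: "bounded_by C P \<Longrightarrow> d \<le> n - C \<Longrightarrow> ordb d (P n)"
  unfolding bounded_by_def using ordb_mono by blast

text \<open>Contains \<open>E_hat V\<close> for every \<open>V\<close>: \<open>mweight\<close> is at
  most \<open>xweight\<close>, so a bound in terms of the former gives one in terms of the latter.
  Coefficients need not lie in \<open>R\<close>.\<close>

typedef (overloaded) 'a bop = "{P :: int \<Rightarrow> 'a::supercommutative_algebra lser. \<exists>C. bounded_by C P}"
  morphisms cf Bop
  by (rule exI[of _ "\<lambda>_. 0"]) (simp add: bounded_by_def)

lifting_forget lser.lifting
setup_lifting type_definition_bop

definition bnd :: "int \<Rightarrow> 'a::supercommutative_algebra bop \<Rightarrow> bool" where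
  "bnd C P \<longleftrightarrow> bounded_by C (cf P)"

lemma bnd_exists: obtains C where "C \<ge> 0" "bnd C P"
proof -
  obtain C where "bounded_by C (cf P)" using cf[of P] by auto
  then have "bounded_by (max C 0) (cf P)"
    unfolding bounded_by_def[of "max C 0"] by (auto intro: bounded_byD)
  then show ?thesis using that[of "max C 0"] by (simp add: bnd_def)
qed

lemma bnd_mono: "bnd C P \<Longrightarrow> C \<le> C' \<Longrightarrow> bnd C' P"
  unfolding bnd_def bounded_by_def[of C'] by (auto intro: bounded_byD)

lemma bop_eqI: "(\<And>n. cf P n = cf Q n) \<Longrightarrow> P = Q"
  by (metis cf_inject ext)

definition mterm :: "(int \<Rightarrow> 'a::supercommutative_algebra lser) \<Rightarrow> (int \<Rightarrow> 'a lser) \<Rightarrow> int \<Rightarrow> int \<times> nat \<Rightarrow> 'a lser" where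
  "mterm P Q n = (\<lambda>(m, r). P m * Dc m r (Q (n - m + int r)))"

lemma ordb_mterm:
  assumes "bounded_by C P" "bounded_by C' Q"
  shows "ordb (n - (C + C')) (mterm P Q n i)"
proof -
  obtain m r where i: "i = (m, r)" by (cases i)
  have "ordb (m - C + (n - m + int r - C' - int r)) (P m * Dc m r (Q (n - m + int r)))"
    using assms unfolding bounded_by_def by (intro ordb_mult ordb_Dc) auto
  then show ?thesis by (simp add: i mterm_def algebra_simps)
qed

text \<open>A power of \<open>D\<close> beyond the bound by more than \<open>w\<close> forces weight
  \<open>w\<close> on its coefficient. The pairs \<open>(m, r)\<close> that escape both conditions
  form a finite set, since \<open>m\<close> is bounded above and \<open>r - m\<close> as
  well.\<close>

lemma val_mterm:
  assumes "bounded_by C P" "bounded_by C' Q" "m > C + int w \<or> n - m + int r > C' + int w"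
  shows "val w (mterm P Q n (m, r))"
  using assms(3)
proof
  assume "m > C + int w"
  then have "ordb (int w + 1) (P m)" using assms by (intro bounded_byD[OF assms(1)]) auto
  then show ?thesis by (simp add: mterm_def val_mult_left ordb_imp_val)
next
  let ?n = "n - m + int r"
  assume "?n > C' + int w"
  then have "ordb (int w + 1) (Q ?n)" 
    by (intro bounded_byD[OF assms(2)]) auto
  then show ?thesis by (simp add: mterm_def val_mult_right ordb_imp_val val_Dc)
qed

lemma locfin_mterm:
  assumes "bounded_by C P" "bounded_by C' Q"
  shows "locfin (mterm P Q n)"
  unfolding locfin_def
proof
  fix w
  have "{i. \<not> val w (mterm P Q n i)} \<subseteq> {n - C' - int w..C + int w} \<times> {..nat (C + C' + 2 * int w - n)}"
  proof
    fix i assume i: "i \<in> {i. \<not> val w (mterm P Q n i)}"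
    obtain m r where mr: "i = (m, r)" by (cases i)
    have "\<not> (m > C + int w \<or> n - m + int r > C' + int w)"
      using i mr val_mterm[OF assms] by blast
    then show "i \<in> {n - C' - int w..C + int w} \<times> {..nat (C + C' + 2 * int w - n)}"
      using mr by auto
  qed
  then show "finite {i. \<not> val w (mterm P Q n i)}"
    by (rule finite_subset) simp
qed

instantiation bop :: (supercommutative_algebra) "{ab_group_add, times, one}"
begin

lift_definition zero_bop :: "'a bop" is "\<lambda>_. 0" by (simp add: bounded_by_def)
lift_definition one_bop :: "'a bop" is "\<lambda>n. if n = 0 then 1 else 0"
  by (rule exI[of _ 0]) (auto simp: bounded_by_def intro: ordb_0)
lift_definition plus_bop :: "'a bop \<Rightarrow> 'a bop \<Rightarrow> 'a bop" is "\<lambda>P Q n. P n + Q n"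
proof -
  fix P Q :: "int \<Rightarrow> 'a lser" assume "\<exists>C. bounded_by C P" "\<exists>C. bounded_by C Q"
  then obtain C C' where "bounded_by C P" "bounded_by C' Q" by blast
  then have "bounded_by (max C C') (\<lambda>n. P n + Q n)"
    unfolding bounded_by_def[of "max C C'"] by (auto intro!: ordb_add intro: bounded_byD)
  then show "\<exists>C. bounded_by C (\<lambda>n. P n + Q n)" ..
qed
lift_definition uminus_bop :: "'a bop \<Rightarrow> 'a bop" is "\<lambda>P n. - P n"
  by (auto simp: bounded_by_def intro: ordb_uminus)
definition minus_bop :: "'a bop \<Rightarrow> 'a bop \<Rightarrow> 'a bop" where "P - Q = P + - Q" for P Q :: "'a bop"
lift_definition times_bop :: "'a bop \<Rightarrow> 'a bop \<Rightarrow> 'a bop" is "\<lambda>P Q n. lsum (mterm P Q n)"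
proof -
  fix P Q :: "int \<Rightarrow> 'a lser" assume "\<exists>C. bounded_by C P" "\<exists>C. bounded_by C Q"
  then obtain C C' where "bounded_by C P" "bounded_by C' Q" by blast
  then have "bounded_by (C + C') (\<lambda>n. lsum (mterm P Q n))"
    unfolding bounded_by_def[of "C + C'"] by (auto intro!: ordb_lsum ordb_mterm)
  then show "\<exists>C. bounded_by C (\<lambda>n. lsum (mterm P Q n))" ..
qed

instance
proof
  fix P Q R :: "'a bop"
  show "P + Q + R = P + (Q + R)" by transfer (simp add: add.assoc)
  show "P + Q = Q + P" by transfer (simp add: add.commute)
  show "0 + P = P" by transfer simp
  show "- P + P = 0" by transfer simp
  show "P - Q = P + - Q" by (rule minus_bop_def)
qed

end

lemma cf_simps: "cf 0 n = 0" "cf 1 n = (if n = 0 then 1 else 0)" "cf (P + Q) n = cf P n + cf Q n"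
  "cf (- P) n = - cf P n" "cf (P - Q) n = cf P n - cf Q n"
  by (simp_all add: zero_bop.rep_eq one_bop.rep_eq plus_bop.rep_eq uminus_bop.rep_eq diff_conv_add_uminus del: add_uminus_conv_diff)

lemma cf_sum: "cf (sum F A) n = (\<Sum>i\<in>A. cf (F i) n)"
  by (induction A rule: infinite_finite_induct) (auto simp: cf_simps)

lemma cf_times: "cf (P * Q) n = lsum (mterm (cf P) (cf Q) n)"
  by (simp add: times_bop.rep_eq)

lemma bnd_times: "bnd C P \<Longrightarrow> bnd C' Q \<Longrightarrow> bnd (C + C') (P * Q)"
  unfolding bnd_def bounded_by_def[of "C + C'"] by (auto simp: cf_times intro!: ordb_lsum ordb_mterm)

lemma bnd_add: "bnd C P \<Longrightarrow> bnd C Q \<Longrightarrow> bnd C (P + Q)"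
  unfolding bnd_def bounded_by_def by (auto simp: cf_simps intro!: ordb_add)

lemma bnd_uminus: "bnd C P \<Longrightarrow> bnd C (- P)"
  unfolding bnd_def bounded_by_def by (auto simp: cf_simps intro!: ordb_uminus)

lemma bnd_diff: "bnd C P \<Longrightarrow> bnd C Q \<Longrightarrow> bnd C (P - Q)"
  unfolding minus_bop_def by (intro bnd_add bnd_uminus)

lemma bnd_zero [simp]: "bnd C 0"
  unfolding bnd_def bounded_by_def by (auto simp: cf_simps)

lemma bnd_one: "0 \<le> C \<Longrightarrow> bnd C 1"
  unfolding bnd_def bounded_by_def by (auto simp: cf_simps intro: ordb_0)

lemma locfin_mterm_cf: "locfin (mterm (cf P) (cf Q) n)"
  by (metis bnd_def bnd_exists locfin_mterm)

lemma bop_distrib: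
  fixes P Q R :: "'a::supercommutative_algebra bop"
  shows "(P + Q) * R = P * R + Q * R" "P * (Q + R) = P * Q + P * R"
proof -
  have "mterm (cf (P + Q)) (cf R) n = (\<lambda>i. mterm (cf P) (cf R) n i + mterm (cf Q) (cf R) n i)"
    "mterm (cf P) (cf (Q + R)) n = (\<lambda>i. mterm (cf P) (cf Q) n i + mterm (cf P) (cf R) n i)" for n
    by (auto simp: mterm_def cf_simps Dc_add algebra_simps)
  then show "(P + Q) * R = P * R + Q * R" "P * (Q + R) = P * Q + P * R"
    by (auto intro!: bop_eqI simp: cf_times cf_simps lsum_add locfin_mterm_cf)
qed

lemma bop_diff_distrib:
  fixes P Q R :: "'a::supercommutative_algebra bop"
  shows "(P - Q) * R = P * R - Q * R" "P * (Q - R) = P * Q - P * R"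
  using bop_distrib(1)[of "P - Q" Q R] bop_distrib(2)[of P "Q - R" R] by (simp_all add: algebra_simps)

lemma bop_mult_zero [simp]: "0 * P = 0" "P * 0 = (0 :: 'a::supercommutative_algebra bop)"
  using bop_diff_distrib(1)[of 0 0 P] bop_diff_distrib(2)[of P 0 0] by simp_all

lemma bop_sum_distrib:
  fixes P :: "'a::supercommutative_algebra bop"
  shows "sum F A * P = (\<Sum>i\<in>A. F i * P)" "P * sum F A = (\<Sum>i\<in>A. P * F i)"
  by (induction A rule: infinite_finite_induct) (auto simp: bop_distrib)

section \<open>Monomial operators and associativity\<close>

lift_definition single :: "int \<Rightarrow> 'a::supercommutative_algebra lser \<Rightarrow> 'a bop" is
  "\<lambda>j f n. if n = j then f else 0"
proof -
  fix j and f :: "'a lser"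
  have "bounded_by j (\<lambda>n. if n = j then f else 0)" by (auto simp: bounded_by_def intro: ordb_0)
  then show "\<exists>C. bounded_by C (\<lambda>n. if n = j then f else 0)" ..
qed

lemma cf_single: "cf (single j f) n = (if n = j then f else 0)"
  by (simp add: single.rep_eq)

lemma cf_single_mult_single:
  "cf (single a p * single b q) n = (if n \<le> a + b then p * Dc a (nat (a + b - n)) q else 0)"
proof (cases "n \<le> a + b")
  case True
  have "lsum (mterm (cf (single a p)) (cf (single b q)) n) =
    mterm (cf (single a p)) (cf (single b q)) n (a, nat (a + b - n))"
    using True by (intro lsum_single) (auto simp: mterm_def cf_single split: if_splits)
  then show ?thesis using True by (simp add: cf_times mterm_def cf_single)
next
  case False
  have "lsum (mterm (cf (single a p)) (cf (single b q)) n) = sum (mterm (cf (single a p)) (cf (single b q)) n) {}"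
    using False by (intro lsum_finite) (auto simp: mterm_def cf_single split: if_splits)
  then show ?thesis using False by (simp add: cf_times)
qed

text \<open>With \<open>N\<close> the total drop in the power of \<open>D\<close>, the left side
  becomes a double sum by \<open>Dc_Dc\<close>, the right side by \<open>Dc_mult\<close>. The two
  sums run over the same triangle \<open>i + u \<le> N\<close>, along different lines.\<close>

lemma single_assoc: "single a p * single b q * single c r = single a p * (single b q * single c r)"
proof (rule bop_eqI)
  fix n
  let ?P = "single a p" and ?Q = "single b q" and ?R = "single c r"
  let ?L = "mterm (cf (?P * ?Q)) (cf ?R) n" and ?M = "mterm (cf ?P) (cf (?Q * ?R)) n"
  show "cf (?P * ?Q * ?R) n = cf (?P * (?Q * ?R)) n"
  proof (cases "n \<le> a + b + c")
    case False
    have "lsum ?L = sum ?L {}" "lsum ?M = sum ?M {}"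
      using False by (intro lsum_finite; auto simp: mterm_def cf_single cf_single_mult_single split: if_splits)+
    then show ?thesis by (simp add: cf_times[of "?P * ?Q"] cf_times[of ?P])
  next
    case True
    define N where "N = nat (a + b + c - n)"
    have N: "int N = a + b + c - n" using True by (simp add: N_def)
    define G where "G l u = p * Dc a l q * Dc (a - int l) u (Dc b (N - l - u) r)" for l u
    have "lsum ?L = (\<Sum>i\<in>{..N}. ?L (a + b - int i, N - i))"
    proof (rule lsum_image[where g = "\<lambda>i. (a + b - int i, N - i)"])
      show "inj_on (\<lambda>i. (a + b - int i, N - i)) {..N}" by (auto simp: inj_on_def)
      fix x assume x: "x \<notin> (\<lambda>i. (a + b - int i, N - i)) ` {..N}"
      obtain m s where ms: "x = (m, s)" by (cases x)
      have "\<not> (m \<le> a + b \<and> n - m + int s = c)"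
      proof
        assume *: "m \<le> a + b \<and> n - m + int s = c"
        then have "x = (a + b - int (nat (a + b - m)), N - nat (a + b - m))" "nat (a + b - m) \<le> N"
          using N by (auto simp: ms)
        then show False using x by blast
      qed
      then show "?L x = 0" by (auto simp: ms mterm_def cf_single cf_single_mult_single)
    qed simp
    also have "\<dots> = (\<Sum>i\<le>N. p * Dc a i q * Dc (a - int i + b) (N - i) r)"
      using N by (intro sum.cong refl) (auto simp: mterm_def cf_single cf_single_mult_single algebra_simps of_nat_diff)
    also have "\<dots> = (\<Sum>i\<le>N. \<Sum>u\<le>N - i. G i u)"
      by (simp add: Dc_Dc sum_distrib_left G_def)
    also have "\<dots> = (\<Sum>(i, u)\<in>{(i, u). i + u \<le> N}. G i u)"
      by (subst sum.Sigma) (auto intro!: sum.cong)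
    also have "\<dots> = (\<Sum>s\<le>N. \<Sum>l\<le>s. G l (s - l))"
      by (rule sum.triangle_reindex_eq)
    also have "\<dots> = (\<Sum>s\<le>N. p * Dc a s (q * Dc b (N - s) r))"
      by (auto simp: Dc_mult sum_distrib_left G_def mult.assoc intro!: sum.cong)
    also have "\<dots> = (\<Sum>s\<in>{..N}. ?M (a, s))"
    proof (intro sum.cong refl)
      fix s assume s: "s \<in> {..N}"
      have "nat (b + c - (n - a + int s)) = N - s" using N s by (simp add: N_def nat_diff_distrib')
      then show "p * Dc a s (q * Dc b (N - s) r) = ?M (a, s)"
        using N s by (auto simp: mterm_def cf_single cf_single_mult_single)
    qed
    also have "\<dots> = lsum ?M"
    proof (rule lsum_image[symmetric])
      show "inj_on (Pair a) {..N}" by (auto simp: inj_on_def)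
      fix x assume x: "x \<notin> Pair a ` {..N}"
      show "?M x = 0"
        using x N by (cases x) (auto simp: mterm_def cf_single cf_single_mult_single split: if_splits)
    qed simp
    finally show ?thesis by (simp add: cf_times[of "?P * ?Q"] cf_times[of ?P])
  qed
qed

text \<open>Closeness to zero in the topology generated by the weights and by the powers of \<open>D\<^sup>-\<^sup>1\<close>.\<close>

definition near :: "nat \<Rightarrow> int \<Rightarrow> 'a::supercommutative_algebra bop \<Rightarrow> bool" where
  "near w d P \<longleftrightarrow> (\<forall>n\<ge>-d. val w (cf P n))"

text \<open>Either the power of \<open>D\<close> taken from \<open>P\<close> is at least
  \<open>- d\<close>, and its coefficient has weight \<open>w\<close>; or the power taken from
  \<open>Q\<close> exceeds \<open>C + int w\<close>, which forces weight \<open>w\<close> there.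
  This is where the loss \<open>C + int w\<close> comes from.\<close>

lemma near_mult_left:
  assumes "near w d P" "bnd C Q"
  shows "near w (d - C - int w) (P * Q)"
  unfolding near_def cf_times
proof (intro allI impI val_lsum)
  fix n and i :: "int \<times> nat" assume n: "- (d - C - int w) \<le> n"
  obtain m r where i: "i = (m, r)" by (cases i)
  obtain C' where C': "bounded_by C' (cf P)" by (metis bnd_def bnd_exists)
  show "val w (mterm (cf P) (cf Q) n i)"
  proof (cases "m \<ge> - d")
    case True
    then show ?thesis using assms by (auto simp: i mterm_def near_def intro: val_mult_left)
  next
    case False
    then show ?thesis using n unfolding i
      by (intro val_mterm[OF C' assms(2)[unfolded bnd_def]]) auto
  qed
qed

lemma near_mult_right:
  assumes "near w d Q" "bnd C P"
  shows "near w (d - C - int w) (P * Q)"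
  unfolding near_def cf_times
proof (intro allI impI val_lsum)
  fix n and i :: "int \<times> nat" assume n: "- (d - C - int w) \<le> n"
  obtain m r where i: "i = (m, r)" by (cases i)
  obtain C' where C': "bounded_by C' (cf Q)" by (metis bnd_def bnd_exists)
  show "val w (mterm (cf P) (cf Q) n i)"
  proof (cases "n - m + int r \<ge> - d")
    case True
    then show ?thesis using assms by (auto simp: i mterm_def near_def intro: val_mult_right val_Dc)
  next
    case False
    then show ?thesis using n unfolding i
      by (intro val_mterm[OF assms(2)[unfolded bnd_def] C']) auto
  qed
qed

lemma near_diff: "near w d P \<Longrightarrow> near w d Q \<Longrightarrow> near w d (P - Q)"
  by (auto simp: near_def cf_simps val_diff)

lemma near_add: "near w d P \<Longrightarrow> near w d Q \<Longrightarrow> near w d (P + Q)"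
  by (auto simp: near_def cf_simps val_add)

lemma near_mono: "near w d P \<Longrightarrow> e \<le> d \<Longrightarrow> near w e P"
  by (auto simp: near_def)

definition trunc :: "int \<Rightarrow> 'a::supercommutative_algebra bop \<Rightarrow> 'a bop" where
  "trunc d P = (\<Sum>j\<in>{-d..d}. single j (cf P j))"

lemma cf_trunc: "cf (trunc d P) n = (if \<bar>n\<bar> \<le> d then cf P n else 0)"
proof -
  have "cf (trunc d P) n = (\<Sum>j\<in>{-d..d}. if j = n then cf P n else 0)"
    unfolding trunc_def cf_sum by (intro sum.cong) (auto simp: cf_single)
  then show ?thesis by (auto simp: sum.delta)
qed

lemma bnd_trunc: "bnd C P \<Longrightarrow> bnd C (trunc d P)"
  by (auto simp: bnd_def bounded_by_def cf_trunc)

text \<open>The coefficients cut off above \<open>d\<close> already have weight \<open>w\<close>, by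
  the bound; those cut off below \<open>- d\<close> are invisible to
  \<open>near w d\<close>.\<close>

lemma near_trunc:
  assumes "bnd C P" "d \<ge> C + int w"
  shows "near w d (P - trunc d P)"
  unfolding near_def
proof (intro allI impI)
  fix n assume n: "n \<ge> - d"
  have "val w (cf P n)" if "n > d"
    using assms that by (intro ordb_imp_val bounded_byD[of C]) (auto simp: bnd_def)
  then show "val w (cf (P - trunc d P) n)" using n by (auto simp: cf_simps cf_trunc)
qed

text \<open>Modulo \<open>near\<close>, only finitely many terms of each factor matter; this reduces associativity to
  \<open>single_assoc\<close>.\<close>

lemma bop_assoc: "P * Q * R = P * (Q * R)" for P Q R :: "'a::supercommutative_algebra bop"
proof (intro bop_eqI val_eqI)
  fix n w
  let ?A = "\<lambda>P Q R :: 'a bop. P * Q * R - P * (Q * R)"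
  obtain C1 where C1: "C1 \<ge> 0" "bnd C1 P" by (rule bnd_exists)
  obtain C2 where C2: "C2 \<ge> 0" "bnd C2 Q" by (rule bnd_exists)
  obtain C3 where C3: "C3 \<ge> 0" "bnd C3 R" by (rule bnd_exists)
  define C where "C = C1 + C2 + C3"
  have b: "bnd C P" "bnd C Q" "bnd C R" and C0: "C \<ge> 0"
    using C1 C2 C3 by (auto simp: C_def elim: bnd_mono)
  \<comment> \<open>Two successive products may each cost \<open>C + int w\<close>; what remains
    still reaches down to the coefficient at \<open>n\<close>.\<close>
  define d where "d = 3 * C + 3 * int w + \<bar>n\<bar>"
  have d: "d \<ge> C + int w" using C0 by (auto simp: d_def)
  let ?P = "trunc d P" and ?Q = "trunc d Q" and ?R = "trunc d R"
  have e: "- (d - C - int w - C - int w) \<le> n" "- (d - (C + C) - int w) \<le> n"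
    using C0 by (auto simp: d_def)
  have d2: "d - C - int w - C - int w \<le> d - (C + C) - int w" by simp
  let ?d = "d - C - int w - C - int w"
  have near: "near w ?d (?A X Q' R')" if "near w d X" "bnd C X" "bnd C Q'" "bnd C R'" for X Q' R'
    using that d2 by (intro near_diff near_mult_left[of w "d - C - int w"] near_mult_left[of w d]
        near_mono[OF near_mult_left[of w d X "C + C" "Q' * R'"] d2] bnd_times)
  have near2: "near w ?d (?A P' X R')" if "near w d X" "bnd C X" "bnd C P'" "bnd C R'" for X P' R'
    using that by (intro near_diff near_mult_left[of w "d - C - int w"] near_mult_right[of w d]
        near_mult_right[of w "d - C - int w"] near_mult_left[of w d])
  have near3: "near w ?d (?A P' Q' X)" if "near w d X" "bnd C X" "bnd C P'" "bnd C Q'" for X P' Q'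
    using that d2 by (intro near_diff near_mult_right[of w "d - C - int w"] near_mult_right[of w d]
        near_mono[OF near_mult_right[of w d X "C + C" "P' * Q'"] d2] bnd_times)
  have zero: "?A ?P ?Q ?R = 0"
    by (simp add: trunc_def bop_sum_distrib single_assoc)
  \<comment> \<open>Telescoping: the three factors are truncated one after the other.\<close>
  have split: "?A P Q R = ?A (P - ?P) Q R + ?A ?P (Q - ?Q) R + ?A ?P ?Q (R - ?R) + ?A ?P ?Q ?R"
    by (simp add: bop_diff_distrib)
  note bt = b b[THEN bnd_trunc, of d] b[THEN near_trunc, OF d] bnd_diff[OF b(1) bnd_trunc[OF b(1)], of d]
    bnd_diff[OF b(2) bnd_trunc[OF b(2)], of d] bnd_diff[OF b(3) bnd_trunc[OF b(3)], of d]
  have "near w ?d (?A (P - ?P) Q R)" by (rule near) (rule bt)+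
  moreover have "near w ?d (?A ?P (Q - ?Q) R)" by (rule near2) (rule bt)+
  moreover have "near w ?d (?A ?P ?Q (R - ?R))" by (rule near3) (rule bt)+
  ultimately have "near w ?d (?A P Q R)"
    unfolding split zero add_0_right by (intro near_add)
  then show "val w (cf (P * Q * R) n - cf (P * (Q * R)) n)"
    using e(1) by (simp add: near_def cf_simps)
qed

lemma cf_one_mult: "1 * P = P" for P :: "'a::supercommutative_algebra bop"
proof (rule bop_eqI)
  fix n
  have "lsum (mterm (cf 1) (cf P) n) = mterm (cf 1) (cf P) n (0, 0)"
    by (intro lsum_single) (auto simp: mterm_def cf_simps Dc_zero split: if_splits)
  then show "cf (1 * P) n = cf P n" by (simp add: cf_times mterm_def cf_simps Dc_zero)
qed

lemma cf_mult_single_one: "cf (P * single j 1) n = cf P (n - j)"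
proof -
  have "lsum (mterm (cf P) (cf (single j 1)) n) = mterm (cf P) (cf (single j 1)) n (n - j, 0)"
    by (intro lsum_single) (auto simp: mterm_def cf_single Dc_one split: if_splits)
  then show ?thesis by (simp add: cf_times mterm_def cf_single Dc_one)
qed

lemma single_one: "single 0 1 = 1"
  by (rule bop_eqI) (simp add: cf_single cf_simps)

lemma mult_one: "P * 1 = P" for P :: "'a::supercommutative_algebra bop"
  using cf_mult_single_one[of P 0] by (intro bop_eqI) (simp add: single_one)

instance bop :: (supercommutative_algebra) "{ring, monoid_mult}"
  by standard (simp_all add: bop_distrib bop_assoc cf_one_mult mult_one)


lemma Dc_lscale: "Dc m r (lscale c f) = lscale c (Dc m r f)"
  by (auto simp: Dc_def lgi_def linv_lscale lD_power_lscale lscale_lscale mult.commute)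

lemma Dc_signed: "Dc m r (signed p f) = signed p (Dc m r f)"
  using Dc_add[of m r "- f" f] by (simp add: signed_def eq_neg_iff_add_eq_0)

text \<open>\<open>c\<close> is the weight that \<open>L\<close> may destroy: 0 for scalars,
  involutions and substitutions, \<open>weight v\<close> for the derivative by
  \<open>v\<close>.\<close>

lemma lsum_map:
  assumes diff: "\<And>f g. L (f - g) = L f - L g" and cont: "\<And>w f. val (w + c) f \<Longrightarrow> val w (L f)"
    and F: "locfin F"
  shows "L (lsum F) = lsum (\<lambda>i. L (F i))"
proof (rule val_eqI)
  fix w
  define J where "J = {i. \<not> val (w + c) (F i)}"
  have J: "finite J" using F by (simp add: J_def locfin_def)
  have L0: "L 0 = 0" using diff[of 0 0] by simp
  have add: "L (f + g) = L f + L g" for f g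
    using diff[of "f + g" g] by (simp add: algebra_simps)
  have sum: "L (sum F J) = (\<Sum>i\<in>J. L (F i))"
    using J by (induction J rule: finite_induct) (auto simp: L0 add)
  have "val (w + c) (lsum F - sum F J)" using J by (intro lsum_approx) (auto simp: J_def)
  then have "val w (L (lsum F) - (\<Sum>i\<in>J. L (F i)))" using cont diff sum by metis
  moreover have "val w (lsum (\<lambda>i. L (F i)) - (\<Sum>i\<in>J. L (F i)))"
    using J by (intro lsum_approx) (auto simp: J_def cont)
  ultimately show "val w (L (lsum F) - lsum (\<lambda>i. L (F i)))"
    using val_diff by fastforce
qed

subsection \<open>Elementary operators\<close>

abbreviation os :: "'a::supercommutative_algebra lser \<Rightarrow> 'a bop" where
  "os \<equiv> single 0"

abbreviation dp :: "int \<Rightarrow> 'a::supercommutative_algebra bop" where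
  "dp j \<equiv> single j 1"

abbreviation bvar :: "var \<Rightarrow> 'a::supercommutative_algebra bop" where
  "bvar v \<equiv> os (lvar v)"

lemma cf_os_mult: "cf (os f * P) n = f * cf P n"
proof -
  have "lsum (mterm (cf (os f)) (cf P) n) = mterm (cf (os f)) (cf P) n (0, 0)"
    by (intro lsum_single) (auto simp: mterm_def cf_single Dc_zero split: if_splits)
  then show ?thesis by (simp add: cf_times mterm_def cf_single Dc_zero)
qed

lemma os_mult_os: "os f * os g = os (f * g)"
  by (rule bop_eqI) (simp add: cf_os_mult cf_single)

lemma os_mult_dp: "os f * dp j = single j f"
  by (rule bop_eqI) (simp add: cf_mult_single_one cf_single)

lemma dp_mult_dp: "dp a * dp b = dp (a + b)"
  by (rule bop_eqI) (auto simp: cf_mult_single_one cf_single)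

lemma dp_power: "dp j ^ n = dp (j * int n)"
  by (induction n) (simp_all add: single_one dp_mult_dp algebra_simps)

lemma single_zero [simp]: "single j 0 = 0"
  by (rule bop_eqI) (simp add: cf_single cf_simps)

lemma single_uminus: "single j (- f) = - single j f"
  by (rule bop_eqI) (simp add: cf_single cf_simps)

lemma single_signed: "single j (signed p f) = signed p (single j f)"
  by (simp add: signed_def single_uminus)

text \<open>For \<open>m \<ge> 0\<close> this cuts \<open>D^m f\<close> off at the power 0 of
  \<open>D\<close>, so differential operators stay differential operators. It fails for negative
  \<open>m\<close>, hence the sign condition.\<close>

lemma sbinom_eq_0:
  assumes "0 \<le> m" "m < int r"
  shows "sbinom m r = 0"
proof (cases "odd (int r * (m - int r))")
  case False
  obtain k where k: "m = int k" using assms nonneg_int_cases by blast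
  have "k div 2 < r div 2" using assms False unfolding k by (simp; presburger)
  moreover have "(of_int (m div 2) :: complex) = of_nat (k div 2)"
    unfolding k by (metis of_int_of_nat_eq of_nat_div of_nat_numeral)
  ultimately show ?thesis
    by (simp add: sbinom_def binomial_gbinomial[symmetric] del: of_nat_div)
qed (simp add: sbinom_def)

lemma Dc_1: "Dc 1 0 f = linv f" "Dc 1 (Suc 0) f = lD f"
  by (simp_all add: Dc_def sbinom_def)

lemma dp_1_mult_os: "dp 1 * os f = os (linv f) * dp 1 + os (lD f)"
proof (rule bop_eqI)
  fix n :: int
  consider "n > 1" | "n = 1" | "n = 0" | "n < 0" by linarith
  then show "cf (dp 1 * os f) n = cf (os (linv f) * dp 1 + os (lD f)) n"
  proof cases
    case 4
    then have "Dc 1 (nat (1 - n)) f = 0"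
      by (simp add: Dc_def sbinom_eq_0)
    then show ?thesis using 4 by (simp add: cf_single_mult_single cf_simps os_mult_dp cf_single)
  qed (simp_all add: cf_single_mult_single cf_simps os_mult_dp cf_single Dc_1)
qed

lemma dp_1_mult_bvar: "v \<noteq> X \<Longrightarrow> v \<noteq> Xi \<Longrightarrow> dp 1 * bvar v = signed (vodd v) (bvar v * dp 1)"
  by (auto simp: dp_1_mult_os lD_lvar linv_lvar single_uminus signed_def)

lemma dp_2: "dp 2 = dp 1 * dp 1" by (simp add: dp_mult_dp)

lemma bvar_commute: "bvar v * os f = os (lgi (vodd v) f) * bvar v"
  by (simp add: os_mult_os lvar_mult_commute)

lemma bvar_bvar: "bvar v * bvar u = signed (vodd u \<and> vodd v) (bvar u * bvar v)"
  using bvar_commute[of v "lvar u"] by (auto simp: linv_lvar lgi_def single_uminus signed_def)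

lemma bvar_odd_square: "vodd v \<Longrightarrow> bvar v * bvar v = 0"
  by (simp add: os_mult_os lvar_odd_square)


subsection \<open>Linear maps on operators\<close>

lift_definition sc :: "complex \<Rightarrow> 'a::supercommutative_algebra bop \<Rightarrow> 'a bop" is "\<lambda>c P n. lscale c (P n)"
  unfolding bounded_by_def using ordb_lscale by blast

text \<open>The grading automorphism of the operator algebra, with \<open>D\<close> odd. Being fixed
  by it means being even.\<close>

lift_definition ohat :: "'a::supercommutative_algebra bop \<Rightarrow> 'a bop" is "\<lambda>P n. signed (odd n) (linv (P n))"
  unfolding bounded_by_def using ordb_linv ordb_signed by blast

lift_definition bneg :: "'a::supercommutative_algebra bop \<Rightarrow> 'a bop" is "\<lambda>P n. if n < 0 then P n else 0"
  unfolding bounded_by_def using ordb_zero by (metis (full_types))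

lemma bounded_by_lder:
  "bounded_by C P \<Longrightarrow> bounded_by (C + int (weight v) + (if v = Xi then 1 else 0)) (\<lambda>n. lder v (P n))"
  unfolding bounded_by_def
proof
  fix n assume "\<forall>n. ordb (n - C) (P n)"
  then have "ordb (n - C - int (weight v) - (if v = Xi then 1 else 0)) (lder v (P n))"
    by (intro ordb_lder) blast
  then show "ordb (n - (C + int (weight v) + (if v = Xi then 1 else 0))) (lder v (P n))"
    by (simp only: diff_diff_eq add.assoc)
qed

lift_definition bder :: "var \<Rightarrow> 'a::supercommutative_algebra bop \<Rightarrow> 'a bop" is "\<lambda>v P n. lder v (P n)"
  using bounded_by_lder by blast

lemma cf_sc: "cf (sc c P) n = lscale c (cf P n)" by (simp add: sc.rep_eq)
lemma cf_ohat: "cf (ohat P) n = signed (odd n) (linv (cf P n))" by (simp add: ohat.rep_eq)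
lemma cf_bneg: "cf (bneg P) n = (if n < 0 then cf P n else 0)" by (simp add: bneg.rep_eq)
lemma cf_bder: "cf (bder v P) n = lder v (cf P n)" by (simp add: bder.rep_eq)

lemma sc_add: "sc c (P + Q) = sc c P + sc c Q"
  by (rule bop_eqI) (simp add: cf_sc cf_simps lscale_add)

lemma sc_zero [simp]: "sc c 0 = 0" "sc 0 P = 0"
  by (rule bop_eqI, simp add: cf_sc cf_simps)+

lemma sc_one [simp]: "sc 1 P = P"
  by (rule bop_eqI) (simp add: cf_sc)

lemma sc_add_left: "sc (c + d) P = sc c P + sc d P"
  by (rule bop_eqI) (simp add: cf_sc cf_simps lscale_add_left)

lemma sc_sc: "sc c (sc d P) = sc (c * d) P"
  by (rule bop_eqI) (simp add: cf_sc lscale_lscale)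

lemma sc_sum: "sc c (sum F A) = (\<Sum>i\<in>A. sc c (F i))"
  by (induction A rule: infinite_finite_induct) (auto simp: sc_add)

lemma lscale_diff: "lscale c (f - g) = lscale c f - lscale c g"
  by (simp only: diff_conv_add_uminus lscale_add lscale_uminus)

lemma sc_mult: "sc c P * Q = sc c (P * Q)" "P * sc c Q = sc c (P * Q)"
proof -
  have *: "lscale c (lsum (mterm (cf P) (cf Q) n)) = lsum (\<lambda>i. lscale c (mterm (cf P) (cf Q) n i))" for n
    by (rule lsum_map[where c = 0]) (auto simp: lscale_diff val_lscale locfin_mterm_cf)
  show "sc c P * Q = sc c (P * Q)" "P * sc c Q = sc c (P * Q)"
    by (rule bop_eqI, simp add: cf_times cf_sc *,
        rule arg_cong[where f = lsum], auto simp: mterm_def cf_sc lscale_mult_left lscale_mult_right Dc_lscale)+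
qed

lemma linv_diff: "linv (f - g) = linv f - linv g"
  by (simp only: diff_conv_add_uminus linv_add linv_uminus)

lemma signed_diff: "signed p (f - g) = signed p f - signed p (g::'b::ab_group_add)"
  by (simp add: signed_def)

lemma ohat_mult: "ohat (P * Q) = ohat P * ohat Q"
proof (rule bop_eqI)
  fix n
  have "signed (odd n) (linv (lsum (mterm (cf P) (cf Q) n))) =
    lsum (\<lambda>i. signed (odd n) (linv (mterm (cf P) (cf Q) n i)))"
    by (rule lsum_map[where c = 0]) (auto simp: linv_diff signed_diff val_signed val_linv locfin_mterm_cf)
  also have "(\<lambda>i. signed (odd n) (linv (mterm (cf P) (cf Q) n i))) = mterm (cf (ohat P)) (cf (ohat Q)) n"
  proof
    fix i :: "int \<times> nat"
    obtain m r where i: "i = (m, r)" by (cases i)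
    show "signed (odd n) (linv (mterm (cf P) (cf Q) n i)) = mterm (cf (ohat P)) (cf (ohat Q)) n i"
      unfolding i by (cases "even n"; cases "even m"; cases "even r")
        (simp_all add: mterm_def cf_ohat linv_mult linv_Dc Dc_signed[of _ _ True, simplified])
  qed
  finally show "cf (ohat (P * Q)) n = cf (ohat P * ohat Q) n"
    by (simp add: cf_ohat cf_times)
qed

lemma ohat_add: "ohat (P + Q) = ohat P + ohat Q"
  by (rule bop_eqI) (simp add: cf_ohat cf_simps linv_add signed_add)

lemma ohat_diff: "ohat (P - Q) = ohat P - ohat Q"
  by (rule bop_eqI) (simp add: cf_ohat cf_simps linv_diff signed_diff)

lemma ohat_single: "ohat (single j f) = signed (odd j) (single j (linv f))"
  by (rule bop_eqI) (auto simp: cf_ohat cf_single signed_def cf_simps)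

lemma bder_add: "bder v (P + Q) = bder v P + bder v Q"
  by (rule bop_eqI) (simp add: cf_bder cf_simps lder_add)

lemma lder_diff: "lder v (f - g) = lder v f - lder v g"
  by (simp only: diff_conv_add_uminus lder_add lder_uminus)

lemma bder_diff: "bder v (P - Q) = bder v P - bder v Q"
  by (rule bop_eqI) (simp add: cf_bder cf_simps lder_diff)

lemma bder_zero [simp]: "bder v 0 = 0"
  by (rule bop_eqI) (simp add: cf_bder cf_simps)

lemma bder_sc: "bder v (sc c P) = sc c (bder v P)"
  by (rule bop_eqI) (simp add: cf_bder cf_sc lder_lscale)

lemma bder_single: "bder v (single j f) = single j (lder v f)"
  by (rule bop_eqI) (simp add: cf_bder cf_single)

definition ogi :: "bool \<Rightarrow> 'a::supercommutative_algebra bop \<Rightarrow> 'a bop" where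
  "ogi p P = (if p then ohat P else P)"

text \<open>An odd time derivative passes \<open>D^m\<close> with the sign \<open>(-1)^m\<close> and
  the coefficient with \<open>linv\<close>; together these are \<open>ohat\<close>.\<close>

lemma bder_mult:
  assumes v: "v \<noteq> X" "v \<noteq> Xi"
  shows "bder v (P * Q) = bder v P * Q + ogi (vodd v) P * bder v Q"
proof (rule bop_eqI)
  fix n
  let ?P = "ogi (vodd v) P"
  have "lder v (lsum (mterm (cf P) (cf Q) n)) = lsum (\<lambda>i. lder v (mterm (cf P) (cf Q) n i))"
    by (rule lsum_map[where c = "weight v"]) (auto simp: lder_diff val_lder locfin_mterm_cf)
  also have "(\<lambda>i. lder v (mterm (cf P) (cf Q) n i)) =
      (\<lambda>i. mterm (cf (bder v P)) (cf Q) n i + mterm (cf ?P) (cf (bder v Q)) n i)"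
    by (auto simp: mterm_def cf_bder lder_mult lder_Dc[OF v] signed_mult ogi_def cf_ohat signed_def Dc_signed)
  finally show "cf (bder v (P * Q)) n = cf (bder v P * Q + ?P * bder v Q) n"
    by (simp add: cf_bder cf_times cf_simps lsum_add locfin_mterm_cf)
qed


subsection \<open>The weight filtration of operators\<close>

definition bval :: "nat \<Rightarrow> 'a::supercommutative_algebra bop \<Rightarrow> bool" where
  "bval w P \<longleftrightarrow> (\<forall>n. val w (cf P n))"

lemma bval_0 [simp]: "bval 0 P" by (simp add: bval_def)
lemma bval_zero [simp]: "bval w 0" by (simp add: bval_def cf_simps)
lemma bval_mono: "bval w P \<Longrightarrow> v \<le> w \<Longrightarrow> bval v P" by (auto simp: bval_def elim: val_mono)
lemma bval_add: "bval w P \<Longrightarrow> bval w Q \<Longrightarrow> bval w (P + Q)" by (simp add: bval_def cf_simps val_add)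
lemma bval_diff: "bval w P \<Longrightarrow> bval w Q \<Longrightarrow> bval w (P - Q)" by (simp add: bval_def cf_simps val_diff)
lemma bval_uminus: "bval w P \<Longrightarrow> bval w (- P)" by (simp add: bval_def cf_simps val_uminus)
lemma bval_sum: "(\<And>i. i \<in> A \<Longrightarrow> bval w (F i)) \<Longrightarrow> bval w (sum F A)"
  by (simp add: bval_def cf_sum val_sum)
lemma bval_mult: "bval v P \<Longrightarrow> bval w Q \<Longrightarrow> bval (v + w) (P * Q)"
  by (auto simp: bval_def cf_times mterm_def intro!: val_lsum val_mult val_Dc)
lemma bval_mult_left: "bval w P \<Longrightarrow> bval w (P * Q)" using bval_mult[of w P 0 Q] by simp
lemma bval_mult_right: "bval w Q \<Longrightarrow> bval w (P * Q)" using bval_mult[of 0 P w Q] by simp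
lemma bval_sc: "bval w P \<Longrightarrow> bval w (sc c P)" by (simp add: bval_def cf_sc val_lscale)
lemma bval_ohat: "bval w P \<Longrightarrow> bval w (ohat P)" by (simp add: bval_def cf_ohat val_linv val_signed)
lemma bval_bder: "bval (w + weight v) P \<Longrightarrow> bval w (bder v P)" by (simp add: bval_def cf_bder val_lder)

lemma bval_eqI: "(\<And>w. bval w (P - Q)) \<Longrightarrow> P = Q"
  by (auto simp: bval_def cf_simps intro!: bop_eqI val_eqI)

lemma bval_power: "bval 1 H \<Longrightarrow> bval j (H ^ j)"
proof (induction j)
  case (Suc j)
  then show ?case using bval_mult[of 1 H j "H ^ j"] by simp
qed simp

lemma bval_bvar: "bval (weight v) (bvar v)"
  by (auto simp: bval_def cf_single val_def lvar.rep_eq svar_def mweight_add_mset coeff_simps)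

lemma bnd_power: "bnd 0 H \<Longrightarrow> bnd 0 (H ^ j)"
proof (induction j)
  case (Suc j)
  then show ?case using bnd_times[of 0 H 0 "H ^ j"] by simp
qed (simp add: bnd_one)

lemma bnd_sc: "bnd C P \<Longrightarrow> bnd C (sc c P)"
  unfolding bnd_def bounded_by_def by (auto simp: cf_sc intro: ordb_lscale)

lemma bnd_single: "ordb (j - C) f \<Longrightarrow> bnd C (single j f)"
  unfolding bnd_def bounded_by_def by (auto simp: cf_single)

lemma bnd_bvar: "bnd (- int (weight v) - (if v = Xi then 1 else 0)) (bvar v)"
  by (intro bnd_single ordb_mono[OF ordb_lvar]) simp

lemma bnd_dp: "bnd j (dp j)"
  by (intro bnd_single ordb_0) simp

lemma bnd_bder: "bnd C P \<Longrightarrow> v \<noteq> Xi \<Longrightarrow> bnd (C + int (weight v)) (bder v P)"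
  unfolding bnd_def using bounded_by_lder[of C "cf P" v] by (simp add: bder.rep_eq)


subsection \<open>Infinite sums of operators\<close>

text \<open>The weight condition makes the tail from index \<open>N\<close> on vanish modulo weight
  \<open>N\<close>; the common bound makes the sum an operator again.\<close>

definition fam :: "int \<Rightarrow> (nat \<Rightarrow> 'a::supercommutative_algebra bop) \<Rightarrow> bool" where
  "fam C F \<longleftrightarrow> (\<forall>i. bnd C (F i) \<and> bval i (F i))"

definition bsum :: "(nat \<Rightarrow> 'a::supercommutative_algebra bop) \<Rightarrow> 'a bop" where
  "bsum F = Bop (\<lambda>n. lsum (\<lambda>i. cf (F i) n))"

lemma bounded_by_lsum: "(\<And>i. bnd C (F i)) \<Longrightarrow> bounded_by C (\<lambda>n. lsum (\<lambda>i. cf (F i) n))"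
  unfolding bnd_def bounded_by_def by (auto intro: ordb_lsum)

lemma cf_bsum: "fam C F \<Longrightarrow> cf (bsum F) n = lsum (\<lambda>i. cf (F i) n)"
  using bounded_by_lsum[of C F] unfolding bsum_def fam_def by (subst Bop_inverse) auto

lemma bnd_bsum:
  assumes "fam C F" shows "bnd C (bsum F)"
proof -
  have "cf (bsum F) = (\<lambda>n. lsum (\<lambda>i. cf (F i) n))" using cf_bsum[OF assms] by blast
  then show ?thesis using bounded_by_lsum[of C F] assms by (simp add: fam_def bnd_def)
qed

lemma bsum_approx:
  assumes "fam C F" "w \<le> N"
  shows "bval w (bsum F - sum F {..<N})"
  unfolding bval_def cf_simps cf_bsum[OF assms(1)] cf_sum
proof (intro allI lsum_approx)
  fix n i assume "i \<notin> {..<N}"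
  then show "val w (cf (F i) n)" using assms by (auto simp: fam_def bval_def intro: val_mono[of i])
qed simp

lemma bsum_unique:
  assumes "fam C F" "\<And>w. \<exists>N\<ge>w. bval w (P - sum F {..<N})"
  shows "P = bsum F"
proof (rule bval_eqI)
  fix w
  obtain N where "N \<ge> w" "bval w (P - sum F {..<N})" using assms(2) by blast
  then have "bval w ((P - sum F {..<N}) - (bsum F - sum F {..<N}))"
    using bsum_approx[OF assms(1)] by (intro bval_diff[of w "_ - _"])
  then show "bval w (P - bsum F)" by simp
qed

lemma bval_bsum: "fam C F \<Longrightarrow> (\<And>i. bval w (F i)) \<Longrightarrow> bval w (bsum F)"
  unfolding bval_def by (simp add: cf_bsum val_lsum)

lemma bsum_map:
  assumes "fam C F" "fam C' (\<lambda>i. L (F i))"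
    and diff: "\<And>P Q. L (P - Q) = L P - L Q" and cont: "\<And>w P. bval (w + c) P \<Longrightarrow> bval w (L P)"
  shows "L (bsum F) = bsum (\<lambda>i. L (F i))"
proof (rule bsum_unique[OF assms(2)])
  fix w
  have L0: "L 0 = 0" using diff[of 0 0] by simp
  have add: "L (f + g) = L f + L g" for f g
    using diff[of "f + g" g] by (simp add: algebra_simps)
  have sum: "L (sum F {..<N}) = (\<Sum>i<N. L (F i))" for N
    by (induction N) (auto simp: L0 add)
  have "bval w (L (bsum F) - (\<Sum>i<w + c. L (F i)))"
    unfolding sum[symmetric] diff[symmetric] by (rule cont, rule bsum_approx[OF assms(1)]) simp
  then show "\<exists>N\<ge>w. bval w (L (bsum F) - (\<Sum>i<N. L (F i)))" by (meson le_add1)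
qed

text \<open>Not an instance of \<open>bsum_map\<close>: after differentiation
  \<open>L (F i0)\<close> may have weight below \<open>i0\<close>, so the image family can violate
  \<open>fam\<close>.\<close>

lemma bsum_map_single:
  assumes F: "fam C F" and zero: "\<And>i. i \<noteq> i0 \<Longrightarrow> L (F i) = 0"
    and diff: "\<And>P Q. L (P - Q) = L P - L Q" and cont: "\<And>w P. bval (w + c) P \<Longrightarrow> bval w (L P)"
  shows "L (bsum F) = L (F i0)"
proof (rule bval_eqI)
  fix w
  have L0: "L 0 = 0" using diff[of 0 0] by simp
  have add: "L (f + g) = L f + L g" for f g
    using diff[of "f + g" g] by (simp add: algebra_simps)
  have sum: "L (sum F {..<N}) = (\<Sum>i<N. L (F i))" for N
    by (induction N) (auto simp: L0 add)
  have "(\<Sum>i<w + c + Suc i0. L (F i)) = (\<Sum>i\<in>{i0}. L (F i))"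
    using zero by (intro sum.mono_neutral_right) auto
  then have e: "L (F i0) = L (sum F {..<w + c + Suc i0})" unfolding sum by simp
  show "bval w (L (bsum F) - L (F i0))"
    unfolding e diff[symmetric] by (rule cont, rule bsum_approx[OF F]) simp
qed

lemma bsum_mult_left:
  assumes "fam C F" shows "Q * bsum F = bsum (\<lambda>i. Q * F i)"
proof -
  obtain C' where C': "bnd C' Q" using bnd_exists by blast
  then have "fam (C' + C) (\<lambda>i. Q * F i)"
    using assms by (auto simp: fam_def intro: bnd_times bval_mult_right)
  then show ?thesis
    by (rule bsum_map[OF assms, where c = 0]) (auto simp: bop_diff_distrib intro: bval_mult_right)
qed

lemma bsum_mult_right:
  assumes "fam C F" shows "bsum F * Q = bsum (\<lambda>i. F i * Q)"
proof -
  obtain C' where C': "bnd C' Q" using bnd_exists by blast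
  then have "fam (C + C') (\<lambda>i. F i * Q)"
    using assms by (auto simp: fam_def intro: bnd_times bval_mult_left)
  then show ?thesis
    by (rule bsum_map[OF assms, where c = 0]) (auto simp: bop_diff_distrib intro: bval_mult_left)
qed

lemma fam_add: "fam C F \<Longrightarrow> fam C G \<Longrightarrow> fam C (\<lambda>i. F i + G i)"
  by (auto simp: fam_def bnd_add bval_add)

lemma bsum_add:
  assumes "fam C F" "fam C G" shows "bsum (\<lambda>i. F i + G i) = bsum F + bsum G"
proof (rule bsum_unique[OF fam_add[OF assms], symmetric])
  fix w
  have "bval w ((bsum F - sum F {..<w}) + (bsum G - sum G {..<w}))"
    by (intro bval_add bsum_approx[OF assms(1)] bsum_approx[OF assms(2)]) auto
  then show "\<exists>N\<ge>w. bval w (bsum F + bsum G - (\<Sum>i<N. F i + G i))"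
    by (intro exI[of _ w]) (simp add: sum.distrib algebra_simps)
qed

lemma bsum_commute:
  assumes "fam C F" "\<And>i. Q * F i = F i * Q" shows "Q * bsum F = bsum F * Q"
  by (simp add: bsum_mult_left[OF assms(1)] bsum_mult_right[OF assms(1)] assms(2))


subsection \<open>The exponential\<close>

text \<open>Divided powers, because \<open>of_nat\<close> is not available in a ring that may be zero.\<close>

definition dpow :: "'a::supercommutative_algebra bop \<Rightarrow> nat \<Rightarrow> 'a bop" where
  "dpow H j = sc (1 / fact j) (H ^ j)"

definition bexp :: "'a::supercommutative_algebra bop \<Rightarrow> 'a bop" where
  "bexp H = bsum (dpow H)"

lemma dpow_0 [simp]: "dpow H 0 = 1" by (simp add: dpow_def)

lemma dpow_Suc: "sc (of_nat (Suc j)) (dpow H (Suc j)) = H * dpow H j"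
proof -
  have "of_nat (Suc j) * (1 / fact (Suc j)) = (1 / fact j :: complex)"
    by (simp add: field_simps del: of_nat_Suc)
  then show ?thesis
    by (simp only: dpow_def sc_sc sc_mult power_Suc)
qed

lemma dpow_commute: "A * B = B * A \<Longrightarrow> A * dpow B j = dpow B j * A"
  using power_commuting_commutes[of B A j] by (simp only: dpow_def sc_mult)

lemma fam_dpow: "bnd 0 H \<Longrightarrow> bval 1 H \<Longrightarrow> fam 0 (dpow H)"
  by (simp add: fam_def dpow_def bnd_sc bval_sc bnd_power bval_power)

lemma sc_inject:
  assumes "c \<noteq> 0" "sc c P = sc c Q" shows "P = Q"
proof -
  have "sc (1 / c) (sc c P) = sc (1 / c) (sc c Q)" by (simp only: assms(2))
  then show ?thesis using assms(1) by (simp only: sc_sc) simp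
qed

text \<open>The binomial theorem. After multiplication by \<open>Suc d\<close>, the two sums carry
  the factors \<open>i\<close> and \<open>Suc d - i\<close>, which add up to
  \<open>Suc d\<close>.\<close>

lemma dpow_add:
  assumes c: "A * B = B * A"
  shows "dpow (A + B) d = (\<Sum>i\<le>d. dpow A i * dpow B (d - i))"
proof (induction d)
  case (Suc d)
  let ?t = "\<lambda>i. dpow A i * dpow B (Suc d - i)"
  have "sc (of_nat (Suc d)) (dpow (A + B) (Suc d)) = (A + B) * (\<Sum>i\<le>d. dpow A i * dpow B (d - i))"
    by (simp only: dpow_Suc Suc)
  also have "\<dots> = (\<Sum>i\<le>d. (A * dpow A i) * dpow B (d - i)) + (\<Sum>i\<le>d. dpow A i * (B * dpow B (d - i)))"
  proof -
    have "B * (dpow A i * P) = dpow A i * (B * P)" for i P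
      using dpow_commute[OF c[symmetric], of i] by (simp add: mult.assoc[symmetric])
    then show ?thesis by (simp add: bop_distrib bop_sum_distrib mult.assoc sum.distrib)
  qed
  also have "(\<Sum>i\<le>d. (A * dpow A i) * dpow B (d - i)) = (\<Sum>i\<le>Suc d. sc (of_nat i) (?t i))"
    by (subst sum.atMost_Suc_shift) (simp add: dpow_Suc[symmetric] sc_mult del: of_nat_Suc)
  also have "(\<Sum>i\<le>d. dpow A i * (B * dpow B (d - i))) = (\<Sum>i\<le>Suc d. sc (of_nat (Suc d - i)) (?t i))"
  proof -
    have "(\<Sum>i\<le>d. dpow A i * (B * dpow B (d - i))) = (\<Sum>i\<le>d. sc (of_nat (Suc d - i)) (?t i))"
      by (intro sum.cong refl) (simp only: dpow_Suc[symmetric] sc_mult Suc_diff_le atMost_iff)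
    then show ?thesis by simp
  qed
  also have "(\<Sum>i\<le>Suc d. sc (of_nat i) (?t i)) + (\<Sum>i\<le>Suc d. sc (of_nat (Suc d - i)) (?t i)) =
      sc (of_nat (Suc d)) (\<Sum>i\<le>Suc d. ?t i)"
    unfolding sum.distrib[symmetric] sc_sum sc_add_left[symmetric]
    by (intro sum.cong refl) (simp add: of_nat_diff del: of_nat_Suc)
  finally show ?case by (rule sc_inject[rotated]) (simp del: of_nat_Suc)
qed simp

text \<open>The product of two partial sums runs over a square of indices. Its part
  \<open>i + j < w\<close> is a partial sum of the exponential of \<open>A + B\<close>, and the rest
  has weight at least \<open>w\<close>.\<close>

lemma bexp_add:
  assumes A: "bnd 0 A" "bval 1 A" and B: "bnd 0 B" "bval 1 B" and c: "A * B = B * A"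
  shows "bexp A * bexp B = bexp (A + B)"
  unfolding bexp_def[of "A + B"]
proof (rule bsum_unique)
  show "fam 0 (dpow (A + B))" using A B by (intro fam_dpow bnd_add bval_add)
  fix w
  let ?A = "sum (dpow A) {..<w}" and ?B = "sum (dpow B) {..<w}"
  have fA: "fam 0 (dpow A)" and fB: "fam 0 (dpow B)" using A B by (simp_all add: fam_dpow)
  have "bval w ((bexp A - ?A) * bexp B + ?A * (bexp B - ?B))"
    unfolding bexp_def
    by (intro bval_add bval_mult_left bval_mult_right bsum_approx[OF fA] bsum_approx[OF fB]) auto
  then have 1: "bval w (bexp A * bexp B - ?A * ?B)"
    by (simp add: bop_diff_distrib)
  have "?A * ?B = (\<Sum>(i, j)\<in>{..<w} \<times> {..<w}. dpow A i * dpow B j)"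
    by (simp add: sum_product sum.cartesian_product)
  also have "\<dots> = (\<Sum>(i, j)\<in>{(i, j). i + j < w}. dpow A i * dpow B j) +
      (\<Sum>(i, j)\<in>({..<w} \<times> {..<w}) - {(i, j). i + j < w}. dpow A i * dpow B j)"
    by (subst add.commute, rule sum.subset_diff) auto
  also have "(\<Sum>(i, j)\<in>{(i, j). i + j < w}. dpow A i * dpow B j) = (\<Sum>d<w. dpow (A + B) d)"
    by (simp add: sum.triangle_reindex dpow_add[OF c])
  finally have 2: "?A * ?B - (\<Sum>d<w. dpow (A + B) d) =
      (\<Sum>(i, j)\<in>({..<w} \<times> {..<w}) - {(i, j). i + j < w}. dpow A i * dpow B j)"
    by simp
  have "bval w (?A * ?B - (\<Sum>d<w. dpow (A + B) d))"
    unfolding 2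
  proof (rule bval_sum)
    fix x assume x: "x \<in> ({..<w} \<times> {..<w}) - {(i, j). i + j < w}"
    obtain i j where ij: "x = (i, j)" by (cases x)
    have "bval (i + j) (dpow A i * dpow B j)"
      using fA fB by (intro bval_mult) (auto simp: fam_def)
    then show "bval w (case x of (i, j) \<Rightarrow> dpow A i * dpow B j)"
      using x by (auto simp: ij elim: bval_mono)
  qed
  with 1 have "bval w ((bexp A * bexp B - ?A * ?B) + (?A * ?B - (\<Sum>d<w. dpow (A + B) d)))"
    by (rule bval_add)
  then show "\<exists>N\<ge>w. bval w (bexp A * bexp B - sum (dpow (A + B)) {..<N})"
    by (intro exI[of _ w]) simp
qed

lemma bexp_one: "bnd 0 H \<Longrightarrow> bval 1 H \<Longrightarrow> bval 1 (bexp H - 1)"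
  using bsum_approx[OF fam_dpow, of H 1 1] by (simp add: bexp_def)

text \<open>Degree by degree, this is \<open>\<partial>\<^sub>v e\<^sup>H = (K + [H, K] / 2) e\<^sup>H\<close>, with \<open>\<Theta> = [H, K] / 2\<close>.\<close>

lemma bder_dpow:
  assumes v: "v \<noteq> X" "v \<noteq> Xi" and hat: "ogi (vodd v) H = H"
    and K: "bder v H = K" and HK: "H * K = K * H + (\<Theta> + \<Theta>)" and H\<Theta>: "H * \<Theta> = \<Theta> * H"
  shows "bder v (dpow H (Suc j)) = K * dpow H j + \<Theta> * (if j = 0 then 0 else dpow H (j - 1))"
proof (induction j)
  case 0
  then show ?case by (simp add: dpow_def K)
next
  case (Suc j)
  let ?h = "\<lambda>j. if j = 0 then 0 else dpow H (j - 1)"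
  have h: "H * ?h j = sc (of_nat j) (dpow H j)" by (cases j) (simp_all add: dpow_Suc del: of_nat_Suc)
  have "sc (of_nat (Suc (Suc j))) (bder v (dpow H (Suc (Suc j)))) = bder v (H * dpow H (Suc j))"
    by (simp only: bder_sc[symmetric] dpow_Suc)
  also have "\<dots> = K * dpow H (Suc j) + H * (K * dpow H j + \<Theta> * ?h j)"
    by (simp only: bder_mult[OF v] hat K Suc)
  also have "H * (K * dpow H j + \<Theta> * ?h j) = K * (H * dpow H j) + (\<Theta> + \<Theta>) * dpow H j + \<Theta> * (H * ?h j)"
    by (simp only: bop_distrib(2) mult.assoc[symmetric] HK H\<Theta> bop_distrib(1))
  also have "\<dots> = sc (of_nat (Suc j)) (K * dpow H (Suc j)) + sc (of_nat (Suc (Suc j))) (\<Theta> * dpow H j)"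
    by (simp only: dpow_Suc[symmetric] h sc_mult of_nat_Suc sc_add_left sc_one bop_distrib add.assoc add.commute add.left_commute)
  also have "K * dpow H (Suc j) + (sc (of_nat (Suc j)) (K * dpow H (Suc j)) + sc (of_nat (Suc (Suc j))) (\<Theta> * dpow H j)) =
      sc (of_nat (Suc (Suc j))) (K * dpow H (Suc j) + \<Theta> * dpow H j)"
    by (simp only: sc_add of_nat_Suc[of "Suc j"] sc_add_left sc_one add.assoc add.commute add.left_commute)
  finally have "bder v (dpow H (Suc (Suc j))) = K * dpow H (Suc j) + \<Theta> * dpow H j"
    by (rule sc_inject[rotated]) (simp del: of_nat_Suc)
  then show ?case by simp
qed

lemma bder_bexp:
  assumes v: "v \<noteq> X" "v \<noteq> Xi" and hat: "ogi (vodd v) H = H"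
    and K: "bder v H = K" and HK: "H * K = K * H + (\<Theta> + \<Theta>)" and H\<Theta>: "H * \<Theta> = \<Theta> * H"
    and H: "bnd 0 H" "bval 1 H"
  shows "bder v (bexp H) = (K + \<Theta>) * bexp H"
proof (rule bval_eqI)
  fix w
  have f: "fam 0 (dpow H)" using H by (rule fam_dpow)
  \<comment> \<open>The derivative by \<open>v\<close> costs \<open>weight v\<close>. Partial sums
    of three lengths are needed below, because differentiating a divided power lowers the degree by
    one in the \<open>K\<close> term and by two in the \<open>\<Theta>\<close> term.\<close>
  define N where "N = w + weight v"
  let ?s = "\<lambda>N. sum (dpow H) {..<N}"
  have ders: "bder v (?s M) = (\<Sum>j<M. bder v (dpow H j))" for M
    by (induction M) (auto simp: bder_add)
  have "bval w (bder v (bexp H - ?s (Suc (Suc N))))"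
    unfolding bexp_def by (rule bval_bder, rule bsum_approx[OF f]) (simp add: N_def)
  moreover have "bder v (?s (Suc (Suc N))) = K * ?s (Suc N) + \<Theta> * ?s N"
  proof -
    have "bder v (?s (Suc (Suc N))) = (\<Sum>j<Suc N. bder v (dpow H (Suc j)))"
      unfolding ders by (subst sum.lessThan_Suc_shift) (simp add: bder_single flip: single_one)
    also have "\<dots> = K * ?s (Suc N) + \<Theta> * (\<Sum>j<Suc N. if j = 0 then 0 else dpow H (j - 1))"
      by (simp only: bder_dpow[OF v hat K HK H\<Theta>] sum.distrib bop_sum_distrib)
    also have "(\<Sum>j<Suc N. if j = 0 then 0 else dpow H (j - 1)) = ?s N"
      by (subst sum.lessThan_Suc_shift) simp
    finally show ?thesis .
  qed
  moreover have "bval w (K * (bexp H - ?s (Suc N)) + \<Theta> * (bexp H - ?s N))"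
    unfolding bexp_def by (intro bval_add bval_mult_right bsum_approx[OF f]) (simp_all add: N_def)
  ultimately have "bval w ((bder v (bexp H) - (K * ?s (Suc N) + \<Theta> * ?s N)) -
      (K * (bexp H - ?s (Suc N)) + \<Theta> * (bexp H - ?s N)))"
    using bval_diff by (metis bder_diff)
  then show "bval w (bder v (bexp H) - (K + \<Theta>) * bexp H)"
    by (simp add: algebra_simps)
qed


section \<open>The dressing argument\<close>

definition degle :: "int \<Rightarrow> 'a::supercommutative_algebra bop \<Rightarrow> bool" where
  "degle d P \<longleftrightarrow> (\<forall>n>d. cf P n = 0)"

definition nonneg :: "'a::supercommutative_algebra bop \<Rightarrow> bool" where
  "nonneg P \<longleftrightarrow> (\<forall>n<0. cf P n = 0)"

lemma lsum_zero: "(\<And>i. F i = 0) \<Longrightarrow> lsum F = 0"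
  using lsum_finite[of "{}" F] by simp

lemma degle_mult:
  assumes "degle d P" "degle e Q" shows "degle (d + e) (P * Q)"
  unfolding degle_def cf_times
proof (intro allI impI lsum_zero)
  fix n and i :: "int \<times> nat" assume n: "d + e < n"
  obtain m r where i: "i = (m, r)" by (cases i)
  have "m > d \<or> n - m + int r > e" using n by linarith
  then show "mterm (cf P) (cf Q) n i = 0" using assms by (auto simp: i mterm_def degle_def)
qed

lemma degle_mono: "degle d P \<Longrightarrow> d \<le> e \<Longrightarrow> degle e P" by (auto simp: degle_def)
lemma degle_add: "degle d P \<Longrightarrow> degle d Q \<Longrightarrow> degle d (P + Q)" by (auto simp: degle_def cf_simps)
lemma degle_diff: "degle d P \<Longrightarrow> degle d Q \<Longrightarrow> degle d (P - Q)" by (auto simp: degle_def cf_simps)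
lemma degle_one: "degle 0 1" by (auto simp: degle_def cf_simps)

lemma degle_eq_zero: "(\<And>d. degle (- int d) P) \<Longrightarrow> P = 0"
proof (rule bop_eqI)
  fix n assume "\<And>d. degle (- int d) P"
  then have "degle (- int (nat (1 - n))) P" .
  then show "cf P n = cf 0 n" by (auto simp: degle_def cf_simps)
qed

lemma degle_power: "degle (- 1) N \<Longrightarrow> degle (- int j) (N ^ j)"
proof (induction j)
  case (Suc j)
  then have "degle (- 1 + - int j) (N * N ^ j)" by (intro degle_mult) auto
  then show ?case by simp
qed (simp add: degle_one)

text \<open>A negative power in the product would need a negative power in one of the factors or a
  coefficient \<open>sbinom m r\<close> with \<open>0 \<le> m < r\<close>, and the latter
  vanishes.\<close>

lemma nonneg_mult:
  fixes P Q :: "'a::supercommutative_algebra bop"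
  assumes "nonneg P" "nonneg Q" shows "nonneg (P * Q)"
  unfolding nonneg_def cf_times
proof (intro allI impI lsum_zero)
  fix n :: int and i :: "int \<times> nat" assume n: "n < 0"
  obtain m r where i: "i = (m, r)" by (cases i)
  consider "m < 0" | "n - m + int r < 0" | "0 \<le> m" "m < int r" using n by linarith
  then show "mterm (cf P) (cf Q) n i = 0"
  proof cases
    case 3
    then have "Dc m r f = 0" for f :: "'a lser" by (simp add: Dc_def sbinom_eq_0)
    then show ?thesis by (simp add: i mterm_def)
  qed (use assms in \<open>auto simp: i mterm_def nonneg_def\<close>)
qed

lemma nonneg_diff: "nonneg P \<Longrightarrow> nonneg Q \<Longrightarrow> nonneg (P - Q)" by (auto simp: nonneg_def cf_simps)
lemma nonneg_one: "nonneg 1" by (auto simp: nonneg_def cf_simps)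
lemma nonneg_power: "nonneg N \<Longrightarrow> nonneg (N ^ j)"
  by (induction j) (auto intro: nonneg_one nonneg_mult)
lemma nonneg_bneg: "nonneg P \<longleftrightarrow> bneg P = 0"
  by (metis bop_eqI cf_bneg cf_simps(1) nonneg_def)
lemma bneg_add: "bneg (P + Q) = bneg P + bneg Q"
  by (rule bop_eqI) (simp add: cf_bneg cf_simps)

section \<open>Geometric series: inverses and cancellation\<close>

lemma geometric_sum: "(1 - N) * (\<Sum>j<w. N ^ j) = 1 - N ^ w" "(\<Sum>j<w. N ^ j) * (1 - N) = 1 - N ^ w"
  for N :: "'a::supercommutative_algebra bop"
proof (induction w)
  case (Suc w)
  { case 1 show ?case using Suc(1) by (simp add: bop_distrib bop_diff_distrib) }
  { case 2
    have "(\<Sum>j<Suc w. N ^ j) * (1 - N) = 1 - N ^ w + N ^ w * (1 - N)"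
      by (simp only: sum.lessThan_Suc bop_distrib(1) Suc(2))
    then show ?case by (simp add: bop_diff_distrib power_commutes) }
qed simp_all

text \<open>The inverse of a monic operator of order zero is its Neumann series, which converges in the
  \<open>D\<^sup>-\<^sup>1\<close>-adic topology.\<close>

lift_definition binv :: "'a::supercommutative_algebra bop \<Rightarrow> 'a bop" is
  "\<lambda>P n. if n > 0 then 0 else cf (\<Sum>j<Suc (nat (- n)). (1 - Bop P) ^ j) n"
  by (rule exI[of _ 0]) (auto simp: bounded_by_def intro: ordb_0)

lemma cf_binv: "cf (binv S) n = (if n > 0 then 0 else cf (\<Sum>j<Suc (nat (- n)). (1 - S) ^ j) n)"
  by (simp add: binv.rep_eq cf_inverse)

lemma binv:
  assumes S: "degle (- 1) (1 - S)"
  shows "S * binv S = 1" "binv S * S = 1" "degle 0 (binv S)"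
proof -
  let ?N = "1 - S"
  \<comment> \<open>As \<open>1 - S\<close> has degree at most \<open>- 1\<close>, its power
    \<open>j\<close> does not touch the coefficient at \<open>n > - j\<close>. So the partial sum
    through \<open>J\<close> is exact above degree \<open>- J - 1\<close>.\<close>
  have err: "degle (- int J - 1) (binv S - (\<Sum>j<Suc J. ?N ^ j))" for J
    unfolding degle_def cf_simps
  proof (intro allI impI)
    fix n assume n: "- int J - 1 < n"
    have z: "cf (?N ^ j) n = 0" if "- int j < n" for j
      using degle_power[OF S, of j] that by (auto simp: degle_def)
    show "cf (binv S) n - cf (\<Sum>j<Suc J. ?N ^ j) n = 0"
    proof (cases "n > 0")
      case True
      then show ?thesis using z by (simp add: cf_binv cf_sum del: sum.lessThan_Suc)
    next
      case False
      have "(\<Sum>j<Suc J. cf (?N ^ j) n) = (\<Sum>j<Suc (nat (- n)). cf (?N ^ j) n)"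
        using n False z by (intro sum.mono_neutral_right) auto
      then show ?thesis using False by (simp add: cf_binv cf_sum del: sum.lessThan_Suc)
    qed
  qed
  have S0: "degle 0 S" using degle_diff[OF degle_one degle_mono[OF S]] by simp
  have "S * binv S - 1 = 0"
  proof (rule degle_eq_zero)
    fix d
    have "S * binv S - 1 = S * (binv S - (\<Sum>j<Suc d. ?N ^ j)) - ?N ^ Suc d"
      using geometric_sum(1)[of ?N "Suc d"] by (simp add: bop_diff_distrib del: sum.lessThan_Suc)
    moreover have "degle (0 + (- int d - 1)) (S * (binv S - (\<Sum>j<Suc d. ?N ^ j)))"
      by (rule degle_mult[OF S0 err])
    moreover have "degle (- int (Suc d)) (?N ^ Suc d)" by (rule degle_power[OF S])
    ultimately show "degle (- int d) (S * binv S - 1)"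
      by (auto intro!: degle_diff elim: degle_mono simp del: power_Suc)
  qed
  then show "S * binv S = 1" by simp
  have "binv S * S - 1 = 0"
  proof (rule degle_eq_zero)
    fix d
    have "binv S * S - 1 = (binv S - (\<Sum>j<Suc d. ?N ^ j)) * S - ?N ^ Suc d"
      using geometric_sum(2)[of ?N "Suc d"] by (simp add: bop_diff_distrib del: sum.lessThan_Suc)
    moreover have "degle ((- int d - 1) + 0) ((binv S - (\<Sum>j<Suc d. ?N ^ j)) * S)"
      by (rule degle_mult[OF err S0])
    moreover have "degle (- int (Suc d)) (?N ^ Suc d)" by (rule degle_power[OF S])
    ultimately show "degle (- int d) (binv S * S - 1)"
      by (auto intro!: degle_diff elim: degle_mono simp del: power_Suc)
  qed
  then show "binv S * S = 1" by simp
  show "degle 0 (binv S)" by (simp add: degle_def cf_binv)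
qed

text \<open>A partial geometric series in \<open>1 - Y\<close> is nonnegative and inverts
  \<open>Y\<close> modulo weight \<open>w\<close>. Weights replace the \<open>D^-1\<close>-adic
  argument because \<open>Y\<close> may contain arbitrarily high powers of \<open>D\<close>.\<close>

lemma nonneg_cancel:
  assumes "nonneg (W * Y)" "nonneg Y" "bval 1 (Y - 1)"
  shows "nonneg W"
  unfolding nonneg_def
proof (intro allI impI val_eqI)
  fix n :: int and w assume n: "n < 0"
  let ?N = "1 - Y"
  have N: "nonneg ?N" "bval 1 ?N"
    using assms bval_uminus[OF assms(3)] by (auto intro: nonneg_diff nonneg_one)
  have "nonneg (\<Sum>j<w. ?N ^ j)"
    using nonneg_power[OF N(1)] by (simp add: nonneg_def cf_sum)
  then have "nonneg (W * Y * (\<Sum>j<w. ?N ^ j))" by (rule nonneg_mult[OF assms(1)])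
  also have "W * Y * (\<Sum>j<w. ?N ^ j) = W - W * ?N ^ w"
    using geometric_sum(1)[of ?N w] by (simp add: mult.assoc bop_diff_distrib)
  finally have "cf W n = cf (W * ?N ^ w) n" using n by (simp add: nonneg_def cf_simps)
  moreover have "bval w (W * ?N ^ w)" by (intro bval_mult_right bval_power N)
  ultimately show "val w (cf W n - 0)" by (simp add: bval_def)
qed

text \<open>Applied with \<open>Z = U S\<^sub>0\<^sup>-\<^sup>1\<close> and \<open>VS = V S\<close> for a flow \<open>V\<close> such that \<open>V Z = K Z\<close>.\<close>

lemma dressing:
  assumes S: "degle (- 1) (1 - S)" and VS: "degle (- 1) VS"
    and Y: "nonneg (S * Z)" "bval 1 (S * Z - 1)" and VY: "nonneg (VS * Z + S * (K * Z))"
  shows "VS = - (bneg (S * K * binv S) * S)"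
proof -
  note inv = binv[OF S]
  let ?W = "VS * binv S + S * K * binv S"
  have "binv S * (S * Z) = Z" by (simp add: mult.assoc[symmetric] inv)
  then have "VS * Z + S * (K * Z) = ?W * (S * Z)"
    by (simp add: bop_distrib mult.assoc)
  then have "nonneg ?W" using VY Y by (metis nonneg_cancel)
  then have "bneg (VS * binv S) + bneg (S * K * binv S) = 0"
    by (simp add: nonneg_bneg bneg_add)
  moreover have "degle (- 1) (VS * binv S)" using degle_mult[OF VS inv(3)] by simp
  then have "bneg (VS * binv S) = VS * binv S"
    by (intro bop_eqI) (auto simp: cf_bneg degle_def)
  ultimately have "VS * binv S = - bneg (S * K * binv S)" by (simp add: eq_neg_iff_add_eq_0)
  then have "VS * binv S * S = - bneg (S * K * binv S) * S" by simp
  then show ?thesis by (simp add: mult.assoc inv)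
qed


section \<open>The Hamiltonians and their flows\<close>

definition dxi :: "'a::supercommutative_algebra bop" where
  "dxi = dp 1 - bvar Xi * dp 2"

lemma dp_mult_Xi: "dp 1 * bvar Xi = 1 - bvar Xi * dp 1"
  by (simp add: dp_1_mult_os linv_lvar lD_Xi single_uminus single_one)

lemma Xi_Xi: "bvar Xi * bvar Xi = 0"
  by (rule bvar_odd_square) simp

lemma Xi_Xi_mult: "bvar Xi * (bvar Xi * P) = 0"
  by (simp add: mult.assoc[symmetric] Xi_Xi)

lemma dp_2_Xi: "dp 2 * bvar Xi = bvar Xi * (dp 2 :: 'a::supercommutative_algebra bop)"
proof -
  have "dp 2 * bvar Xi = dp 1 * (1 - bvar Xi * dp 1 :: 'a bop)"
    by (simp only: dp_2 mult.assoc dp_mult_Xi)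
  also have "\<dots> = dp 1 - (dp 1 * bvar Xi) * dp 1"
    by (simp add: bop_diff_distrib mult.assoc)
  also have "\<dots> = bvar Xi * dp 2"
    by (simp only: dp_mult_Xi bop_diff_distrib) (simp add: dp_2 mult.assoc)
  finally show ?thesis .
qed

lemma dp_2_dp: "dp 2 * dp j = dp j * dp 2"
  by (simp add: dp_mult_dp add.commute)

definition time :: "var \<Rightarrow> bool" where
  "time v \<longleftrightarrow> v \<noteq> X \<and> v \<noteq> Xi"

lemma dp_bvar: "time v \<Longrightarrow> dp (int n) * bvar v = signed (vodd v \<and> odd n) (bvar v * dp (int n) :: 'a::supercommutative_algebra bop)"
proof (induction n)
  case (Suc n)
  have "dp (int (Suc n)) * bvar v = dp 1 * (dp (int n) * bvar v :: 'a bop)"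
    by (simp add: dp_mult_dp mult.assoc[symmetric] add.commute)
  also have "\<dots> = signed (vodd v \<and> odd n) (dp 1 * bvar v * dp (int n))"
    by (simp only: Suc(1)[OF Suc(2)] signed_mult mult.assoc)
  also have "\<dots> = signed (vodd v \<and> odd (Suc n)) (bvar v * dp (int (Suc n)))"
    using Suc by (auto simp: dp_1_mult_bvar time_def signed_def mult.assoc dp_mult_dp add.commute)
  finally show ?case .
qed (simp add: single_one)

lemma dp_2_bvar: "dp 2 * bvar v = bvar v * dp 2" if "v \<noteq> X"
  using dp_bvar[of v 2] dp_2_Xi that by (cases "v = Xi") (auto simp: time_def)

lemma dp_2_dxi: "dp 2 * dxi = dxi * dp 2"
  by (simp add: dxi_def bop_diff_distrib dp_2_dp) (simp add: mult.assoc[symmetric] dp_2_Xi)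

lemma dp_2_power_commute: "dp 2 * P = P * dp 2 \<Longrightarrow> dp 2 ^ n * P = P * dp 2 ^ n"
  by (rule power_commuting_commutes)

lemma dxi_Xi: "dxi * bvar Xi + bvar Xi * dxi = 1"
  by (simp add: dxi_def bop_diff_distrib dp_mult_Xi mult.assoc dp_2_Xi Xi_Xi_mult)

lemma dxi_dxi: "dxi * dxi = (0 :: 'a::supercommutative_algebra bop)"
proof -
  have "dp 1 * (bvar Xi * dp 2) = dp 2 - bvar Xi * (dp 1 * dp 2 :: 'a bop)"
    by (simp add: mult.assoc[symmetric] dp_mult_Xi bop_diff_distrib)
  moreover have "bvar Xi * dp 2 * (bvar Xi * dp 2) = (0 :: 'a bop)"
  proof -
    have "bvar Xi * dp 2 * (bvar Xi * dp 2) = bvar Xi * (dp 2 * bvar Xi) * (dp 2 :: 'a bop)"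
      by (simp only: mult.assoc)
    then show ?thesis by (simp add: dp_2_Xi mult.assoc Xi_Xi_mult)
  qed
  ultimately show ?thesis
    by (simp add: dxi_def bop_diff_distrib dp_2_dp mult.assoc dp_2[symmetric])
qed

lemma dxi_bvar: "time v \<Longrightarrow> dxi * bvar v = signed (vodd v) (bvar v * dxi :: 'a::supercommutative_algebra bop)"
proof -
  assume v: "time v"
  have "bvar Xi * dp 2 * bvar v = bvar Xi * bvar v * (dp 2 :: 'a bop)"
    using v by (simp add: mult.assoc dp_2_bvar time_def)
  also have "\<dots> = signed (vodd v) (bvar v * (bvar Xi * dp 2))"
    by (simp only: bvar_bvar[of Xi v]) (simp add: signed_mult mult.assoc)
  finally show ?thesis
    using v by (auto simp: dxi_def bop_diff_distrib dp_1_mult_bvar time_def signed_def)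
qed

lemma bnd_timesI: "bnd a P \<Longrightarrow> bnd b Q \<Longrightarrow> a + b \<le> c \<Longrightarrow> bnd c (P * Q)"
  using bnd_times bnd_mono by blast

lemma bnd_dp_power: "bnd (2 * int n) (dp 2 ^ n)"
  using bnd_dp[of "2 * int n"] by (simp add: dp_power)

lemma bnd_Xi: "bnd (- 1) (bvar Xi)"
  using bnd_bvar[of Xi] by simp

lemma bnd_time: "time v \<Longrightarrow> bnd (- int (weight v)) (bvar v)"
  using bnd_bvar[of v] by (simp add: time_def)

lemma bnd_dxi: "bnd 1 dxi"
  unfolding dxi_def by (intro bnd_diff bnd_dp bnd_timesI[OF bnd_Xi bnd_dp]) simp

lemma bval_time: "w \<le> weight v \<Longrightarrow> bval w (bvar v * P)"
  using bval_bvar bval_mono bval_mult_left by blast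

lemma time_simps [simp]: "time (T n)" "time (Tp n)" "time (Tm n)" "\<not> time X" "\<not> time Xi"
  by (auto simp: time_def)

lemma bder_const [simp]:
  "bder v (dp j) = 0" "time v \<Longrightarrow> bder v (bvar Xi) = 0"
  by (auto simp: bder_single lder_lvar time_def)

lemma bder_mult_const: "time v \<Longrightarrow> bder v P = 0 \<Longrightarrow> bder v Q = 0 \<Longrightarrow> bder v (P * Q) = 0"
  by (simp add: bder_mult time_def)

lemma bder_dp_power [simp]: "bder v (dp 2 ^ n) = 0"
  by (simp add: dp_power)

lemma bder_dxi [simp]: "time v \<Longrightarrow> bder v dxi = 0"
  by (simp add: dxi_def bder_diff bder_mult_const)

lemma bder_bvar_mult: "time v \<Longrightarrow> bder v Q = 0 \<Longrightarrow> bder v (bvar u * Q) = (if u = v then Q else 0)"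
  by (simp add: bder_mult time_def bder_single lder_lvar single_one)

lemma ohat_bvar: "ohat (bvar v) = signed (vodd v) (bvar v)"
  by (simp add: ohat_single linv_lvar single_signed)

lemma ohat_dp: "ohat (dp j) = signed (odd j) (dp j)"
  by (simp add: ohat_single)

lemma ohat_dp_power: "ohat (dp 2 ^ n) = dp 2 ^ n"
  by (simp add: dp_power ohat_dp)

lemma ohat_dxi: "ohat dxi = - dxi"
  by (simp add: dxi_def ohat_diff ohat_mult ohat_bvar ohat_dp)

lemma ohat_bsum:
  assumes "fam C F" "\<And>i. ohat (F i) = F i" shows "ohat (bsum F) = bsum F"
  using bsum_map[OF assms(1), of C ohat 0] assms by (simp add: ohat_diff bval_ohat)

lemma bder_bsum_single:
  assumes "fam C F" "\<And>i. i \<noteq> i0 \<Longrightarrow> bder v (F i) = 0"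
  shows "bder v (bsum F) = bder v (F i0)"
  by (rule bsum_map_single[OF assms(1), where c = "weight v"]) (auto simp: assms bder_diff bval_bder)

lemma bsum_reindex:
  assumes F: "fam C F" and G: "fam C' G" and eq: "\<And>w. \<exists>N\<ge>w. sum F {..<N} = sum G {..<w}"
  shows "bsum F = bsum G"
proof (rule bsum_unique[OF G])
  fix w
  obtain N where "N \<ge> w" "sum F {..<N} = sum G {..<w}" using eq by blast
  then have "bval w (bsum F - sum G {..<w})" using bsum_approx[OF F, of w N] by simp
  then show "\<exists>N\<ge>w. bval w (bsum F - sum G {..<N})" by blast
qed

lemma fam_subseq: "fam C F \<Longrightarrow> (\<And>i. i \<le> g i) \<Longrightarrow> fam C (\<lambda>i. F (g i))"
  unfolding fam_def by (blast intro: bval_mono)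

lemma bsum_odd:
  assumes F: "fam C F" and "\<And>i. even i \<Longrightarrow> F i = 0"
  shows "bsum F = bsum (\<lambda>m. F (2 * m + 1))"
proof (rule bsum_reindex[OF F])
  show "fam C (\<lambda>m. F (2 * m + 1))" by (rule fam_subseq[OF F]) simp
  fix w
  have "sum F {..<2 * w} = (\<Sum>m<w. F (2 * m + 1))" by (induction w) (auto simp: assms(2))
  then show "\<exists>N\<ge>w. sum F {..<N} = (\<Sum>m<w. F (2 * m + 1))" by (intro exI[of _ "2 * w"]) simp
qed

lemma bsum_even:
  assumes F: "fam C F" and "\<And>i. odd i \<Longrightarrow> F i = 0"
  shows "bsum F = bsum (\<lambda>m. F (2 * m))"
proof (rule bsum_reindex[OF F])
  show "fam C (\<lambda>m. F (2 * m))" by (rule fam_subseq[OF F]) simp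
  fix w
  have "sum F {..<2 * w} = (\<Sum>m<w. F (2 * m))" by (induction w) (auto simp: assms(2))
  then show "\<exists>N\<ge>w. sum F {..<N} = (\<Sum>m<w. F (2 * m))" by (intro exI[of _ "2 * w"]) simp
qed

lemma bsum_shift:
  assumes F: "fam C F" and "F 0 = 0"
  shows "bsum F = bsum (\<lambda>m. F (Suc m))"
proof (rule bsum_reindex[OF F])
  show "fam C (\<lambda>m. F (Suc m))" by (rule fam_subseq[OF F]) simp
  fix w
  have "sum F {..<Suc w} = (\<Sum>m<w. F (Suc m))"
    unfolding sum.lessThan_Suc_shift using assms by simp
  then show "\<exists>N\<ge>w. sum F {..<N} = (\<Sum>m<w. F (Suc m))" by (intro exI[of _ "Suc w"]) simp
qed


subsection \<open>The Jacobian hierarchy\<close>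

definition termJ :: "nat \<Rightarrow> 'a::supercommutative_algebra bop" where
  "termJ n = bvar (T (2 * (n + 1))) * dp 2 ^ (n + 1) + bvar (T (2 * n + 1)) * dp 2 ^ n * dxi"

definition HJ :: "'a::supercommutative_algebra bop" where
  "HJ = bsum termJ"

text \<open>The weight of each time variable equals the bound of the operator that it multiplies, so
  every term has bound 0. Powers of the exponent then keep bound 0, and the exponential
  exists.\<close>

lemma fam_J:
  "fam 0 (\<lambda>n. bvar (T (2 * (n + 1))) * dp 2 ^ (n + 1) :: 'a::supercommutative_algebra bop)"
  "fam 0 (\<lambda>n. bvar (T (2 * n + 1)) * (dp 2 ^ n * dxi) :: 'a::supercommutative_algebra bop)"
proof -
  have "bnd 0 (bvar (T (2 * (n + 1))) * dp 2 ^ (n + 1) :: 'a bop)" for n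
    by (rule bnd_timesI[OF bnd_time bnd_dp_power]) simp_all
  then show "fam 0 (\<lambda>n. bvar (T (2 * (n + 1))) * dp 2 ^ (n + 1) :: 'a bop)"
    by (simp only: fam_def) (simp add: bval_time)
  have "bnd 0 (bvar (T (2 * n + 1)) * (dp 2 ^ n * dxi) :: 'a bop)" for n
    by (rule bnd_timesI[OF bnd_time bnd_timesI[OF bnd_dp_power bnd_dxi order_refl]]) simp_all
  then show "fam 0 (\<lambda>n. bvar (T (2 * n + 1)) * (dp 2 ^ n * dxi) :: 'a bop)"
    by (simp only: fam_def) (simp add: bval_time)
qed

lemma fam_termJ: "fam 0 termJ"
  unfolding termJ_def mult.assoc by (rule fam_add[OF fam_J])

lemma HJ_props: "bnd 0 (HJ :: 'a::supercommutative_algebra bop)" "bval 1 (HJ :: 'a::supercommutative_algebra bop)" "ohat HJ = (HJ :: 'a::supercommutative_algebra bop)"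
proof -
  show "bnd 0 (HJ :: 'a bop)" unfolding HJ_def by (rule bnd_bsum[OF fam_termJ])
  show "bval 1 (HJ :: 'a bop)" unfolding HJ_def
    by (rule bval_bsum[OF fam_termJ]) (simp add: termJ_def mult.assoc bval_add bval_time)
  show "ohat (HJ :: 'a bop) = HJ" unfolding HJ_def
    by (rule ohat_bsum[OF fam_termJ])
      (simp add: termJ_def ohat_add ohat_mult ohat_bvar ohat_dp_power ohat_dxi del: power_Suc)
qed

lemma bder_HJ:
  "bder (T (2 * (n + 1))) HJ = (dp 2 ^ (n + 1) :: 'a::supercommutative_algebra bop)"
  "bder (T (2 * n + 1)) HJ = (dp 2 ^ n * dxi :: 'a::supercommutative_algebra bop)"
proof -
  have d: "bder (T k) (termJ i) = (if 2 * (i + 1) = k then dp 2 ^ (i + 1) else 0) +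
      (if 2 * i + 1 = k then dp 2 ^ i * dxi else 0 :: 'a bop)" for k i
    by (simp add: termJ_def bder_add mult.assoc bder_bvar_mult bder_mult_const del: power_Suc)
  have o: "2 * i + 1 \<noteq> 2 * (k + 1)" "2 * (k + 1) \<noteq> 2 * i + 1" for i k :: nat by presburger+
  have "bder (T (2 * (n + 1))) (HJ :: 'a bop) = bder (T (2 * (n + 1))) (termJ n)"
    unfolding HJ_def by (rule bder_bsum_single[OF fam_termJ]) (simp only: d o, simp)
  then show "bder (T (2 * (n + 1))) (HJ :: 'a bop) = dp 2 ^ (n + 1)" by (simp only: d o) simp
  have "bder (T (2 * n + 1)) (HJ :: 'a bop) = bder (T (2 * n + 1)) (termJ n)"
    unfolding HJ_def by (rule bder_bsum_single[OF fam_termJ]) (simp only: d o, simp)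
  then show "bder (T (2 * n + 1)) (HJ :: 'a bop) = dp 2 ^ n * dxi" by (simp only: d o) simp
qed

text \<open>Odd times anticommute with \<open>dxi\<close>, but their terms contain
  \<open>dxi\<close> themselves and are killed by \<open>dxi * dxi = 0\<close> on either side. This
  is why the Jacobian flows need no correction terms.\<close>

lemma termJ_dxi: "(dp 2 ^ k * dxi) * termJ n = (termJ n * (dp 2 ^ k * dxi) :: 'a::supercommutative_algebra bop)"
proof -
  have c: "dp 2 ^ k * dxi = (dxi * dp 2 ^ k :: 'a bop)" for k by (rule dp_2_power_commute[OF dp_2_dxi])
  have tn: "dp 2 ^ k * bvar (T i) = (bvar (T i) * dp 2 ^ k :: 'a bop)" for i k
    by (rule dp_2_power_commute[OF dp_2_bvar]) simp
  have z: "dxi * (dp 2 ^ k * dxi) = (0 :: 'a bop)" for k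
    by (simp only: c mult.assoc[symmetric] dxi_dxi bop_mult_zero)
  have "(dp 2 ^ k * dxi) * (bvar (T (2 * (n + 1))) * dp 2 ^ (n + 1)) =
      (bvar (T (2 * (n + 1))) * dp 2 ^ (n + 1)) * (dp 2 ^ k * dxi :: 'a bop)"
  proof -
    have "(dp 2 ^ k * dxi) * (bvar (T (2 * (n + 1))) * dp 2 ^ (n + 1)) =
        dp 2 ^ k * (dxi * bvar (T (2 * (n + 1)))) * (dp 2 ^ (n + 1) :: 'a bop)"
      by (simp only: mult.assoc)
    also have "\<dots> = bvar (T (2 * (n + 1))) * (dp 2 ^ k * (dxi * dp 2 ^ (n + 1)))"
      by (simp only: dxi_bvar[OF time_simps(1)]) (simp add: mult.assoc[symmetric] tn del: power_Suc)
    also have "dp 2 ^ k * (dxi * dp 2 ^ (n + 1)) = dp 2 ^ (n + 1) * (dp 2 ^ k * dxi :: 'a bop)"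
      by (simp only: c[symmetric] mult.assoc[symmetric] power_add[symmetric] add.commute)
    finally show ?thesis by (simp only: mult.assoc)
  qed
  moreover have "(dp 2 ^ k * dxi) * (bvar (T (2 * n + 1)) * dp 2 ^ n * dxi) = (0 :: 'a bop)"
  proof -
    have "(dp 2 ^ k * dxi) * (bvar (T (2 * n + 1)) * dp 2 ^ n * dxi) =
        dp 2 ^ k * (dxi * bvar (T (2 * n + 1))) * (dp 2 ^ n * dxi :: 'a bop)"
      by (simp only: mult.assoc)
    also have "\<dots> = - (dp 2 ^ k * bvar (T (2 * n + 1)) * (dxi * (dp 2 ^ n * dxi)))"
      by (simp only: dxi_bvar[OF time_simps(1)]) (simp add: mult.assoc)
    finally show ?thesis by (simp add: z)
  qed
  moreover have "(bvar (T (2 * n + 1)) * dp 2 ^ n * dxi) * (dp 2 ^ k * dxi) = (0 :: 'a bop)"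
    by (simp add: mult.assoc z)
  ultimately show ?thesis by (simp only: termJ_def bop_distrib)
qed

lemma termJ_dp: "dp 2 ^ k * termJ n = (termJ n * dp 2 ^ k :: 'a::supercommutative_algebra bop)"
proof -
  have "dp 2 * termJ n = (termJ n * dp 2 :: 'a bop)"
  proof -
    have "dp 2 * bvar (T i) = (bvar (T i) * dp 2 :: 'a bop)" for i
      by (rule dp_2_bvar) simp
    then have tn: "dp 2 * (bvar (T i) * P) = bvar (T i) * (dp 2 * P :: 'a bop)" for i P
      by (simp add: mult.assoc[symmetric])
    have "dp 2 * (dp 2 ^ k * dxi) = dp 2 ^ k * (dxi * dp 2 :: 'a bop)" for k
    proof -
      have "dp 2 * (dp 2 ^ k * dxi) = dp 2 ^ k * (dp 2 * dxi :: 'a bop)" for k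
        by (simp add: mult.assoc[symmetric] power_commutes)
      then show ?thesis by (simp add: dp_2_dxi)
    qed
    then show ?thesis
      by (simp add: termJ_def bop_distrib mult.assoc tn power_commutes del: power_Suc)
  qed
  then show ?thesis by (rule dp_2_power_commute)
qed

lemma bder_bexp_commuting:
  assumes "time v" "ogi (vodd v) H = H" "bder v H = K" "H * K = K * H" "bnd 0 H" "bval 1 H"
  shows "bder v (bexp H) = K * bexp H"
  using bder_bexp[of v H K 0] assms by (simp add: time_def)

lemma bder_exp_HJ:
  "bder (T (2 * (n + 1))) (bexp HJ) = dp 2 ^ (n + 1) * (bexp HJ :: 'a::supercommutative_algebra bop)"
  "bder (T (2 * n + 1)) (bexp HJ) = dp 2 ^ n * dxi * (bexp HJ :: 'a::supercommutative_algebra bop)"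
proof -
  have c: "HJ * dp 2 ^ k = dp 2 ^ k * (HJ :: 'a bop)" "HJ * (dp 2 ^ k * dxi) = dp 2 ^ k * dxi * (HJ :: 'a bop)" for k
    unfolding HJ_def
    by (rule bsum_commute[OF fam_termJ, symmetric], simp only: termJ_dxi termJ_dp)+
  show "bder (T (2 * (n + 1))) (bexp HJ) = dp 2 ^ (n + 1) * (bexp HJ :: 'a bop)"
    by (rule bder_bexp_commuting[OF _ _ bder_HJ(1) c(1) HJ_props(1,2)]) (simp_all add: ogi_def HJ_props)
  show "bder (T (2 * n + 1)) (bexp HJ) = dp 2 ^ n * dxi * (bexp HJ :: 'a bop)"
    by (rule bder_bexp_commuting[OF _ _ bder_HJ(2) c(2) HJ_props(1,2)]) (simp_all add: ogi_def HJ_props)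
qed


subsection \<open>The Manin--Radul hierarchy\<close>

definition termMR :: "nat \<Rightarrow> 'a::supercommutative_algebra bop" where
  "termMR n = (if n = 0 then 0 else bvar (T n) * dp (int n))"

definition HMR :: "'a::supercommutative_algebra bop" where
  "HMR = bsum termMR"

lemma fam_termMR: "fam 0 (termMR :: nat \<Rightarrow> 'a::supercommutative_algebra bop)"
proof -
  have "bnd 0 (bvar (T n) * dp (int n) :: 'a bop)" for n
    by (rule bnd_timesI[OF bnd_time bnd_dp]) simp_all
  then show ?thesis by (simp add: fam_def termMR_def bval_time)
qed

lemma HMR_props: "bnd 0 (HMR :: 'a::supercommutative_algebra bop)" "bval 1 (HMR :: 'a::supercommutative_algebra bop)" "ohat HMR = (HMR :: 'a::supercommutative_algebra bop)"
proof -
  show "bnd 0 (HMR :: 'a bop)" unfolding HMR_def by (rule bnd_bsum[OF fam_termMR])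
  show "bval 1 (HMR :: 'a bop)" unfolding HMR_def
    by (rule bval_bsum[OF fam_termMR]) (simp add: termMR_def bval_time)
  have "ohat (0 :: 'a bop) = 0" using ohat_diff[of 0 "0 :: 'a bop"] by simp
  then show "ohat (HMR :: 'a bop) = HMR" unfolding HMR_def
    by (intro ohat_bsum[OF fam_termMR])
      (auto simp: termMR_def ohat_mult ohat_bvar ohat_dp signed_def)
qed

lemma bder_HMR: "n \<ge> 1 \<Longrightarrow> bder (T n) HMR = (dp (int n) :: 'a::supercommutative_algebra bop)"
proof -
  assume n: "n \<ge> 1"
  have d: "bder (T n) (termMR i) = (if i = n then dp (int n) else 0 :: 'a bop)" for i
    using n by (auto simp: termMR_def bder_bvar_mult)
  have "bder (T n) (HMR :: 'a bop) = bder (T n) (termMR n)"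
    unfolding HMR_def by (rule bder_bsum_single[OF fam_termMR]) (simp add: d)
  then show "bder (T n) (HMR :: 'a bop) = dp (int n)" by (simp add: d)
qed

text \<open>Half the commutator of \<open>H\<close> and \<open>D\<^bsup>2k + 1\<^esup>\<close>.\<close>

definition Theta :: "nat \<Rightarrow> 'a::supercommutative_algebra bop" where
  "Theta k = bsum (\<lambda>m. bvar (T (2 * m + 1)) * dp 2 ^ (m + k + 1))"

lemma fam_Theta: "fam (2 * int k + 1) (\<lambda>m. bvar (T (2 * m + 1)) * dp 2 ^ (m + k + 1) :: 'a::supercommutative_algebra bop)"
proof -
  have "bnd (2 * int k + 1) (bvar (T (2 * m + 1)) * dp 2 ^ (m + k + 1) :: 'a bop)" for m
    by (rule bnd_timesI[OF bnd_time bnd_dp_power]) simp_all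
  then show ?thesis by (simp add: fam_def bval_time)
qed

text \<open>Moving \<open>D^n\<close> past \<open>t_i\<close> costs a sign exactly when both indices
  are odd; the two products then add up instead of cancelling.\<close>

lemma termMR_dp: "termMR i * dp (int n) - dp (int n) * termMR i = (
    (if odd i \<and> odd n then bvar (T i) * dp (int (i + n)) + bvar (T i) * dp (int (i + n)) else 0) :: 'a::supercommutative_algebra bop)"
proof (cases "i = 0")
  case False
  have "dp (int n) * (bvar (T i) * dp (int i)) = signed (odd i \<and> odd n) (bvar (T i) * dp (int (i + n)) :: 'a bop)"
  proof -
    have "dp (int n) * (bvar (T i) * dp (int i)) = signed (odd i \<and> odd n) (bvar (T i) * dp (int n) * dp (int i) :: 'a bop)"
      using dp_bvar[of "T i" n, where 'a = 'a] by (simp add: mult.assoc[symmetric] signed_mult)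
    then show ?thesis by (simp add: mult.assoc dp_mult_dp add.commute)
  qed
  moreover have "bvar (T i) * dp (int i) * dp (int n) = (bvar (T i) * dp (int (i + n)) :: 'a bop)"
    by (simp add: mult.assoc dp_mult_dp)
  ultimately show ?thesis using False by (auto simp: termMR_def)
qed (simp add: termMR_def)

text \<open>Only the terms with odd index \<open>2m + 1\<close> contribute, each with twice
  \<open>t_(2m+1) D^(2(m+k+1))\<close>. The doubled form \<open>Theta k + Theta k\<close> is the one
  in which \<open>bder_bexp\<close> expects a commutator.\<close>

lemma HMR_commutator: "HMR * dp (int (2 * k + 1)) = dp (int (2 * k + 1)) * HMR + (Theta k + Theta k :: 'a::supercommutative_algebra bop)"
proof -
  let ?K = "dp (int (2 * k + 1)) :: 'a bop"
  let ?G = "\<lambda>i. if odd i then bvar (T i) * dp (int (i + (2 * k + 1))) + bvar (T i) * dp (int (i + (2 * k + 1))) else (0 :: 'a bop)"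
  have G: "?G = (\<lambda>i. termMR i * ?K + (- 1) * (?K * termMR i))"
    using termMR_dp[of _ "2 * k + 1", where 'a = 'a] by (auto simp: fun_eq_iff)
  have bK: "bnd (int (2 * k + 1)) ?K" by (rule bnd_dp)
  let ?c = "int (2 * k + 1)"
  have f1: "fam ?c (\<lambda>i. termMR i * ?K)" "fam ?c (\<lambda>i. (- 1) * (?K * termMR i))"
  proof -
    have "bnd ?c (termMR i * ?K)" "bnd ?c (?K * termMR i)" for i
      using fam_termMR[where 'a = 'a] bnd_times[OF _ bK, of 0] bnd_times[OF bK, of 0]
      by (simp_all add: fam_def del: of_nat_add of_nat_mult of_nat_Suc)
    then show "fam ?c (\<lambda>i. termMR i * ?K)" "fam ?c (\<lambda>i. (- 1) * (?K * termMR i))"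
      using fam_termMR[where 'a = 'a] unfolding fam_def
      by (simp_all add: bval_mult_left bval_uminus[OF bval_mult_right] bnd_uminus)
  qed
  have "HMR * ?K - ?K * HMR = bsum (\<lambda>i. termMR i * ?K) + bsum (\<lambda>i. (- 1) * (?K * termMR i))"
    using bsum_mult_left[OF fam_termMR, of "- ?K"]
    by (simp add: HMR_def bsum_mult_right[OF fam_termMR])
  also have "\<dots> = bsum ?G" unfolding G by (rule bsum_add[OF f1, symmetric])
  also have "\<dots> = bsum (\<lambda>m. ?G (2 * m + 1))"
    by (rule bsum_odd[of ?c]) (simp_all only: G fam_add[OF f1], simp add: G[symmetric] fun_cong[OF G, symmetric])
  also have "\<dots> = bsum (\<lambda>m. bvar (T (2 * m + 1)) * dp 2 ^ (m + k + 1) + bvar (T (2 * m + 1)) * dp 2 ^ (m + k + 1))"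
  proof -
    have "dp (int (2 * m + 1 + (2 * k + 1))) = (dp 2 ^ (m + k + 1) :: 'a bop)" for m
      by (simp add: dp_power algebra_simps del: power_Suc)
    then show ?thesis by simp
  qed
  also have "\<dots> = Theta k + Theta k" unfolding Theta_def by (rule bsum_add[OF fam_Theta fam_Theta])
  finally show ?thesis by (simp add: algebra_simps)
qed

lemma HMR_dp_even: "HMR * dp (int (2 * k)) = dp (int (2 * k)) * (HMR :: 'a::supercommutative_algebra bop)"
  unfolding HMR_def
  by (rule bsum_commute[OF fam_termMR, symmetric]) (use termMR_dp[of _ "2 * k", where 'a = 'a] in simp)

text \<open>Moving \<open>t_(2m+1)\<close> past \<open>t_i D^i\<close> costs the sign
  \<open>(-1)^i\<close> twice, once for \<open>D^i\<close> and once for \<open>t_i\<close>.\<close>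

lemma HMR_Theta: "HMR * Theta k = (Theta k * HMR :: 'a::supercommutative_algebra bop)"
  unfolding Theta_def
proof (rule bsum_commute[OF fam_Theta])
  fix m
  let ?P = "bvar (T (2 * m + 1)) * dp 2 ^ (m + k + 1) :: 'a bop"
  show "HMR * ?P = ?P * HMR"
    unfolding HMR_def
  proof (rule bsum_commute[OF fam_termMR, symmetric])
    fix i
    have "dp (int i) * bvar (T (2 * m + 1)) = signed (odd i) (bvar (T (2 * m + 1)) * dp (int i) :: 'a bop)"
      using dp_bvar[of "T (2 * m + 1)" i] by simp
    moreover have "bvar (T i) * bvar (T (2 * m + 1)) = signed (odd i) (bvar (T (2 * m + 1)) * bvar (T i) :: 'a bop)"
      using bvar_bvar[of "T i" "T (2 * m + 1)"] by simp
    ultimately have "bvar (T i) * (dp (int i) * bvar (T (2 * m + 1))) = bvar (T (2 * m + 1)) * (bvar (T i) * dp (int i) :: 'a bop)"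
      by (auto simp: signed_def mult.assoc[symmetric])
    then have c1: "bvar (T (2 * m + 1)) * termMR i = (termMR i * bvar (T (2 * m + 1)) :: 'a bop)"
      by (simp add: termMR_def mult.assoc)
    have c2: "dp 2 ^ (m + k + 1) * termMR i = (termMR i * dp 2 ^ (m + k + 1) :: 'a bop)"
      using termMR_dp[of i "2 * (m + k + 1)", where 'a = 'a] by (simp add: dp_power del: power_Suc)
    have "?P * termMR i = bvar (T (2 * m + 1)) * (termMR i * dp 2 ^ (m + k + 1))"
      by (simp only: mult.assoc c2)
    also have "\<dots> = termMR i * ?P" by (simp only: mult.assoc[symmetric] c1)
    finally show "?P * termMR i = termMR i * ?P" .
  qed
qed

lemma bder_exp_HMR:
  "k \<ge> 1 \<Longrightarrow> bder (T (2 * k)) (bexp HMR) = dp (int (2 * k)) * (bexp HMR :: 'a::supercommutative_algebra bop)"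
  "bder (T (2 * k + 1)) (bexp HMR) = (dp (int (2 * k + 1)) + Theta k) * (bexp HMR :: 'a::supercommutative_algebra bop)"
proof -
  assume k: "k \<ge> 1"
  then show "bder (T (2 * k)) (bexp HMR) = dp (int (2 * k)) * (bexp HMR :: 'a bop)"
    by (intro bder_bexp_commuting[OF _ _ bder_HMR HMR_dp_even HMR_props(1,2)]) (simp_all add: ogi_def HMR_props)
next
  show "bder (T (2 * k + 1)) (bexp HMR) = (dp (int (2 * k + 1)) + Theta k) * (bexp HMR :: 'a bop)"
    by (rule bder_bexp) (simp_all only: HMR_props ogi_def bder_HMR HMR_commutator HMR_Theta, simp_all add: bder_HMR)
qed

section \<open>The Manin-Radul vector fields on operators\<close>

definition flow :: "nat \<Rightarrow> 'a::supercommutative_algebra bop \<Rightarrow> 'a bop" where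
  "flow k P = (if even k then bder (T k) P
     else bder (T k) P - bsum (\<lambda>m. bvar (T (2 * m + 1)) * bder (T (2 * (k div 2 + m + 1))) P))"

text \<open>The derivative raises the bound by \<open>2(k + m + 1)\<close> and the variable lowers
  it by \<open>2m + 1\<close>. The difference \<open>2k + 1\<close> does not depend on
  \<open>m\<close>, so the infinite sum in the vector field is an operator.\<close>

lemma fam_flow:
  assumes "bnd C P"
  shows "fam (C + 2 * int k + 1) (\<lambda>m. bvar (T (2 * m + 1)) * bder (T (2 * (k + m + 1))) P)"
proof -
  have "bnd (C + 2 * int k + 1) (bvar (T (2 * m + 1)) * bder (T (2 * (k + m + 1))) P)" for m
    by (rule bnd_timesI[OF bnd_time bnd_bder[OF assms]]) simp_all
  then show ?thesis by (simp add: fam_def bval_time)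
qed

text \<open>On the exponential the even derivatives act as left multiplication by even powers of
  \<open>D\<close>. Hence the correction sum of an odd flow acts as \<open>Theta k\<close>, exactly
  the half commutator that the plain derivative produces in excess.\<close>

lemma flow_exp_HMR: "n \<ge> 1 \<Longrightarrow> flow n (bexp HMR) = (dp (int n) * bexp HMR :: 'a::supercommutative_algebra bop)"
proof -
  assume n: "n \<ge> 1"
  let ?U = "bexp HMR :: 'a bop"
  show "flow n ?U = dp (int n) * ?U"
  proof (cases "even n")
    case True
    then obtain k where "n = 2 * k" by (elim evenE)
    then show ?thesis using n bder_exp_HMR(1)[of k] by (simp add: flow_def)
  next
    case False
    then obtain k where k: "n = 2 * k + 1" by (elim oddE)
    have e: "bvar (T (2 * m + 1)) * bder (T (2 * (k + m + 1))) ?U = bvar (T (2 * m + 1)) * dp 2 ^ (m + k + 1) * ?U" for m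
      by (subst bder_exp_HMR(1)) (simp_all add: dp_power mult.assoc add.commute add.left_commute del: power_Suc)
    have "bsum (\<lambda>m. bvar (T (2 * m + 1)) * bder (T (2 * (k + m + 1))) ?U) = Theta k * ?U"
      unfolding e Theta_def by (rule bsum_mult_right[OF fam_Theta, symmetric])
    then have "flow n ?U = (dp (int n) + Theta k) * ?U - Theta k * ?U"
      using bder_exp_HMR(2)[of k] k by (simp add: flow_def)
    then show ?thesis by (simp add: bop_distrib)
  qed
qed

lemma cf_mult_bvar: "time v \<Longrightarrow> cf (P * bvar v :: 'a::supercommutative_algebra bop) n = cf P n * signed (vodd v \<and> odd n) (lvar v)"
proof -
  assume v: "time v"
  have z: "Dc m r (lvar v :: 'a lser) = 0" if "r > 0" for m r
  proof -
    obtain s where s: "r = Suc s" using \<open>r > 0\<close> gr0_implies_Suc by blast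
    have "lD (lgi p (lvar v :: 'a lser)) = 0" for p
      using v by (cases p) (auto simp: linv_lvar lD_lvar lD_signed time_def)
    then show ?thesis by (simp add: Dc_def s funpow_Suc_right del: funpow.simps)
  qed
  have "lsum (mterm (cf P) (cf (bvar v)) n) = mterm (cf P) (cf (bvar v)) n (n, 0)"
  proof (rule lsum_single)
    fix i assume i: "i \<noteq> (n, 0 :: nat)"
    obtain m r where mr: "i = (m, r)" by (cases i)
    show "mterm (cf P) (cf (bvar v)) n i = 0"
      using i mr by (cases "r = 0") (auto simp: mterm_def cf_single z)
  qed
  then show ?thesis
    by (auto simp: cf_times mterm_def cf_single Dc_def lgi_def linv_lvar signed_def)
qed

lemma bvar_mult_commute: "time v \<Longrightarrow> bvar v * P = ogi (vodd v) P * bvar v"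
  by (rule bop_eqI) (auto simp: cf_os_mult cf_mult_bvar ogi_def cf_ohat lvar_mult_commute signed_mult
    signed_signed signed_def)

lemma bder_mult_S:
  fixes S Z :: "'a::supercommutative_algebra bop"
  assumes "ohat S = S" "time v" shows "bder v (S * Z) = bder v S * Z + S * bder v Z"
  using assms bder_mult[of v S Z] by (auto simp: time_def ogi_def)

text \<open>An operator fixed by \<open>ohat\<close> commutes with the odd variables in the
  correction terms and is passed by the odd derivative without a sign.\<close>

lemma flow_mult:
  fixes S Z :: "'a::supercommutative_algebra bop"
  assumes S: "ohat S = S"
  shows "flow n (S * Z) = flow n S * Z + S * flow n Z"
proof (cases "even n")
  case False
  define k where "k = n div 2"
  obtain C where C: "bnd C S" using bnd_exists by blast
  obtain C' where C': "bnd C' Z" using bnd_exists by blast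
  let ?t = "\<lambda>m. bvar (T (2 * m + 1)) :: 'a bop" and ?d = "\<lambda>m. bder (T (2 * (k + m + 1))) :: 'a bop \<Rightarrow> 'a bop"
  have t: "?t m * (?d m (S * Z)) = ?t m * ?d m S * Z + S * (?t m * ?d m Z)" for m
    using bvar_mult_commute[of "T (2 * m + 1)" S] S
    by (simp add: bder_mult_S bop_distrib mult.assoc[symmetric] ogi_def)
  have f1: "fam (C + 2 * int k + 1 + C') (\<lambda>m. ?t m * ?d m S * Z)"
    using fam_flow[OF C, of k] bnd_times[OF _ C'] by (auto simp: fam_def bval_mult_left)
  have f2: "fam (C + 2 * int k + 1 + C') (\<lambda>m. S * (?t m * ?d m Z))"
    using fam_flow[OF C', of k] bnd_times[OF C, of "C' + 2 * int k + 1"] by (auto simp: fam_def bval_mult_right algebra_simps)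
  have "bsum (\<lambda>m. ?t m * ?d m (S * Z)) = bsum (\<lambda>m. ?t m * ?d m S) * Z + S * bsum (\<lambda>m. ?t m * ?d m Z)"
    unfolding t bsum_add[OF f1 f2] bsum_mult_right[OF fam_flow[OF C]] bsum_mult_left[OF fam_flow[OF C']] ..
  then show ?thesis
    using False S by (simp add: flow_def bder_mult_S k_def[symmetric] bop_distrib bop_diff_distrib)
qed (simp add: flow_def bder_mult_S S)

lemma flow_const: "(\<And>v. time v \<Longrightarrow> bder v P = 0) \<Longrightarrow> flow n P = (0 :: 'a::supercommutative_algebra bop)"
proof -
  assume "\<And>v. time v \<Longrightarrow> bder v P = 0"
  moreover have "bsum (\<lambda>m. 0 :: 'a bop) = 0"
    using bsum_unique[of 0 "\<lambda>m. 0 :: 'a bop" 0] by (auto simp: fam_def)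
  ultimately show ?thesis by (simp add: flow_def)
qed

text \<open>Flows act on each power of \<open>D\<close> separately. Hence they preserve
  nonnegativity and annihilate constant coefficients.\<close>

lemma cf_flow_zero: "(\<And>v. lder v (cf P n) = 0) \<Longrightarrow> cf (flow k P) n = 0"
proof -
  assume z: "\<And>v. lder v (cf P n) = 0"
  obtain C where C: "bnd C P" using bnd_exists by blast
  have "cf (bsum (\<lambda>m. bvar (T (2 * m + 1)) * bder (T (2 * (k div 2 + m + 1))) P)) n = 0"
    unfolding cf_bsum[OF fam_flow[OF C]] by (rule lsum_zero) (simp add: cf_os_mult cf_bder z)
  then show ?thesis
    by (cases "even k") (simp_all only: flow_def if_True if_False cf_simps cf_bder z diff_self)
qed


section \<open>Substitution of the time variables\<close>

text \<open>Both substitutions send \<open>t\<^sup>\<plusminus>\<^sub>n\<close> to \<open>t\<^sub>n\<close>, except that the variables in \<open>K\<close> are sent to \<open>0\<close>.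
  Since \<open>phi\<close> is weakly monotone, no signs occur when a monomial is renamed.\<close>

fun phi :: "var \<Rightarrow> var" where
  "phi (Tp n) = T n"
| "phi (Tm n) = T n"
| "phi v = v"

lemma vodd_phi [simp]: "vodd (phi v) = vodd v" by (cases v) auto
lemma weight_phi [simp]: "weight (phi v) = weight v" by (cases v) auto
lemma phi_mono: "u \<le> v \<Longrightarrow> phi u \<le> phi v"
  by (cases u; cases v) (auto simp: less_eq_var_def)
lemma phi_eq_X: "phi v = X \<longleftrightarrow> v = X" "phi v = Xi \<longleftrightarrow> v = Xi" by (cases v; auto)+

text \<open>The monomials that contribute to the coefficient at \<open>k\<close> after substitution:
  those that are renamed to \<open>k\<close> and avoid the variables sent to 0.\<close>

definition fiber :: "var set \<Rightarrow> mono \<Rightarrow> mono set" where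
  "fiber K k = {m. image_mset phi m = k \<and> set_mset m \<inter> K = {}}"

lemma fiber_empty [simp]: "fiber K {#} = {{#}}" by (auto simp: fiber_def)

text \<open>A variable has at most three preimages under \<open>phi\<close>, so the substitution
  involves no infinite sums of coefficients.\<close>

lemma finite_fiber [simp]: "finite (fiber K k)"
proof (induction k)
  case (add v k)
  have fin: "finite {u. phi u = v}"
  proof -
    have "{u. phi u = v} \<subseteq> {v} \<union> (case v of T n \<Rightarrow> {Tp n, Tm n} | _ \<Rightarrow> {})"
    proof
      fix u assume "u \<in> {u. phi u = v}"
      then show "u \<in> {v} \<union> (case v of T n \<Rightarrow> {Tp n, Tm n} | _ \<Rightarrow> {})" by (cases u) auto
    qed
    then show ?thesis by (rule finite_subset) (auto split: var.split)
  qed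
  have "fiber K (add_mset v k) \<subseteq> (\<lambda>(u, m). add_mset u m) ` ({u. phi u = v} \<times> fiber K k)"
  proof
    fix m assume m: "m \<in> fiber K (add_mset v k)"
    then obtain u m' where "m = add_mset u m'" "phi u = v" "image_mset phi m' = k"
      by (auto simp: fiber_def dest!: msed_map_invR)
    then show "m \<in> (\<lambda>(u, m). add_mset u m) ` ({u. phi u = v} \<times> fiber K k)"
      using m by (auto simp: fiber_def intro!: image_eqI[of _ _ "(u, m')"])
  qed
  then show ?case using fin add by (meson finite_SigmaI finite_imageI finite_subset)
qed simp

lemma mpar_phi: "mpar (image_mset phi m) = mpar m"
  by (induction m) (auto simp: mpar_add_mset)

lemma mweight_phi: "mweight (image_mset phi m) = mweight m"
  by (induction m) (auto simp: mweight_add_mset)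

lemma count_phi:
  "v = X \<or> v = Xi \<Longrightarrow> count (image_mset phi m) v = count m v"
proof (induction m)
  case (add u m)
  then show ?case using phi_eq_X[of u] by auto
qed simp

lemma xweight_phi: "xweight (image_mset phi m) = xweight m"
  by (simp add: xweight_def mweight_phi count_phi)

lemma legal_phi: "legal (image_mset phi m) \<Longrightarrow> legal m"
  by (induction m) (auto simp: legal_add_mset)

lemma phi_inj_on_odd:
  assumes "legal (image_mset phi m)" "u \<in> oddset m" "v \<in> oddset m" "phi u = phi v"
  shows "u = v"
proof (rule ccontr)
  assume "u \<noteq> v"
  moreover obtain m' where m': "m = add_mset u m'" using assms(2) by (auto simp: oddset_def dest: multi_member_split)
  ultimately have "v \<in># m'" using assms(3) by (auto simp: oddset_def)
  then have "phi u \<in># image_mset phi m'" using assms(4) by auto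
  then show False using assms by (auto simp: m' legal_add_mset oddset_def)
qed

text \<open>Legality of the image makes \<open>phi\<close> injective on the odd variables that
  occur. A weakly monotone map that is injective preserves inversions.\<close>

lemma msign_phi:
  assumes leg: "legal (image_mset phi (k + l))"
  shows "msign (image_mset phi k) (image_mset phi l) = msign k l"
proof -
  let ?A = "{(u, v). u \<in> oddset k \<and> v \<in> oddset l \<and> v < u}"
  let ?B = "{(u, v). u \<in> oddset (image_mset phi k) \<and> v \<in> oddset (image_mset phi l) \<and> v < u}"
  have inj: "u = v" if "u \<in> oddset (k + l)" "v \<in> oddset (k + l)" "phi u = phi v" for u v
    using phi_inj_on_odd[OF leg] that by blast
  have "inj_on (map_prod phi phi) ?A"
  proof (rule inj_onI)
    fix x y assume xy: "x \<in> ?A" "y \<in> ?A" "map_prod phi phi x = map_prod phi phi y"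
    then have "fst x \<in> oddset (k + l)" "fst y \<in> oddset (k + l)" "snd x \<in> oddset (k + l)"
      "snd y \<in> oddset (k + l)" "phi (fst x) = phi (fst y)" "phi (snd x) = phi (snd y)"
      by (auto simp: oddset_add)
    then show "x = y" using inj by (simp add: prod_eq_iff)
  qed
  moreover have "map_prod phi phi ` ?A = ?B"
  proof (intro equalityI subsetI)
    fix y assume "y \<in> map_prod phi phi ` ?A"
    then obtain u v where uv: "y = (phi u, phi v)" "u \<in> oddset k" "v \<in> oddset l" "v < u" by auto
    have "phi v \<noteq> phi u" using inj[of v u] uv by (auto simp: oddset_add)
    moreover have "phi v \<le> phi u" using phi_mono uv by simp
    ultimately show "y \<in> ?B" using uv by (auto simp: oddset_def)
  next
    fix y assume "y \<in> ?B"
    then obtain u v where uv: "y = (phi u, phi v)" "u \<in> oddset k" "v \<in> oddset l" "phi v < phi u"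
      by (auto simp: oddset_def)
    have "v < u" using phi_mono[of u v] uv(4) by (meson leD not_le_imp_less)
    then show "y \<in> map_prod phi phi ` ?A" using uv by (auto intro!: image_eqI[of _ _ "(u, v)"])
  qed
  ultimately have "card ?B = card ?A" using card_image by fastforce
  then show ?thesis unfolding msign_alt by (simp only:)
qed

text \<open>To split a preimage of \<open>k\<close> into two factors is to split \<open>k\<close>
  and to choose a preimage of each part.\<close>

lemma sum_fiber_split:
  "(\<Sum>m\<in>fiber K k. \<Sum>j | j \<subseteq># m. F j (m - j)) =
   (\<Sum>k1 | k1 \<subseteq># k. \<Sum>i\<in>fiber K k1. \<Sum>j\<in>fiber K (k - k1). F i j)"
  for F :: "mono \<Rightarrow> mono \<Rightarrow> 'b::comm_monoid_add"
proof -
  have "(\<Sum>(m, j)\<in>(SIGMA m:fiber K k. {j. j \<subseteq># m}). F j (m - j)) =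
    (\<Sum>(k1, i, j)\<in>(SIGMA k1:{k1. k1 \<subseteq># k}. fiber K k1 \<times> fiber K (k - k1)). F i j)"
  proof (rule sum.reindex_bij_witness[where i = "\<lambda>(k1, i, j). (i + j, i)" and
        j = "\<lambda>(m, j). (image_mset phi j, j, m - j)"])
    fix x assume "x \<in> (SIGMA m:fiber K k. {j. j \<subseteq># m})"
    then obtain m j where x: "x = (m, j)" "m \<in> fiber K k" "j \<subseteq># m" by auto
    then obtain l where l: "m = j + l" by (auto simp: subset_mset.le_iff_add)
    show "(\<lambda>(k1, i, j). (i + j, i)) ((\<lambda>(m, j). (image_mset phi j, j, m - j)) x) = x"
      "(\<lambda>(m, j). (image_mset phi j, j, m - j)) x \<in> (SIGMA k1:{k1. k1 \<subseteq># k}. fiber K k1 \<times> fiber K (k - k1))"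
      "(case (\<lambda>(m, j). (image_mset phi j, j, m - j)) x of (k1, i, j) \<Rightarrow> F i j) = (case x of (m, j) \<Rightarrow> F j (m - j))"
      using x by (auto simp: l fiber_def)
  next
    fix y assume "y \<in> (SIGMA k1:{k1. k1 \<subseteq># k}. fiber K k1 \<times> fiber K (k - k1))"
    then obtain k1 i j where y: "y = (k1, i, j)" "k1 \<subseteq># k" "i \<in> fiber K k1" "j \<in> fiber K (k - k1)" by auto
    then show "(\<lambda>(m, j). (image_mset phi j, j, m - j)) ((\<lambda>(k1, i, j). (i + j, i)) y) = y"
      "(\<lambda>(k1, i, j). (i + j, i)) y \<in> (SIGMA m:fiber K k. {j. j \<subseteq># m})"
      by (auto simp: fiber_def)
  qed
  then show ?thesis by (simp add: sum.Sigma sum.cartesian_product)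
qed

text \<open>The explicit 0 at illegal \<open>k\<close> is the square of an odd variable: for odd
  \<open>n\<close> a legal monomial with both \<open>Tp n\<close> and \<open>Tm n\<close> is renamed
  to one with \<open>T n\<close> twice.\<close>

definition lsub :: "var set \<Rightarrow> 'a::supercommutative_algebra lser \<Rightarrow> 'a lser" where
  "lsub K f = Lser (\<lambda>k. if legal k then \<Sum>m\<in>fiber K k. coeff f m else 0)"

lemma coeff_lsub: "legal k \<Longrightarrow> coeff (lsub K f) k = (\<Sum>m\<in>fiber K k. coeff f m)"
  unfolding lsub_def by (subst Lser_inverse) auto

lemma coeff_lsub_nonzero: "coeff (lsub K f) k \<noteq> 0 \<Longrightarrow> \<exists>m\<in>fiber K k. coeff f m \<noteq> 0"
  by (metis (full_types) coeff_illegal coeff_lsub sum.neutral)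

lemma lsub_add: "lsub K (f + g) = lsub K f + lsub K g"
  by (rule lser_eqI) (simp add: coeff_lsub coeff_simps sum.distrib)

lemma lsub_diff: "lsub K (f - g) = lsub K f - lsub K g"
  by (rule lser_eqI) (simp add: coeff_lsub coeff_simps sum_subtractf)

lemma lsub_zero [simp]: "lsub K 0 = 0"
  by (rule lser_eqI) (simp add: coeff_lsub coeff_simps)

lemma lsub_signed: "lsub K (signed p f) = signed p (lsub K f)"
  using lsub_diff[of K 0 f] by (auto simp: signed_def)

lemma lsub_lscale: "lsub K (lscale c f) = lscale c (lsub K f)"
  by (rule lser_eqI) (simp add: coeff_lsub lscale.rep_eq scaleC_sum)

lemma lsub_linv: "lsub K (linv f) = linv (lsub K f)"
proof (rule lser_eqI)
  fix k assume k: "legal k"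
  have mp: "mpar m = mpar k" if "m \<in> fiber K k" for m
    using that mpar_phi[of m] by (auto simp: fiber_def)
  have "(\<Sum>m\<in>fiber K k. coeff (linv f) m) = (\<Sum>m\<in>fiber K k. signed (mpar k) (grinv (coeff f m)))"
    by (intro sum.cong refl) (simp only: coeff_linv mp)
  then show "coeff (lsub K (linv f)) k = coeff (linv (lsub K f)) k"
    by (simp only: coeff_lsub[OF k] coeff_linv grinv_sum signed_sum)
qed

lemma lsub_mult: "lsub K (f * g) = lsub K f * lsub K g"
proof (rule lser_eqI)
  fix k assume k: "legal k"
  have "coeff (lsub K (f * g)) k = (\<Sum>m\<in>fiber K k. \<Sum>j | j \<subseteq># m. sterm (coeff f) (coeff g) j (m - j))"
    unfolding coeff_lsub[OF k]
  proof (intro sum.cong refl)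
    fix m assume "m \<in> fiber K k"
    then have "legal m" using k legal_phi[of m] by (simp add: fiber_def)
    then show "coeff (f * g) m = (\<Sum>j | j \<subseteq># m. sterm (coeff f) (coeff g) j (m - j))"
      by (rule coeff_mult)
  qed
  also have "\<dots> = (\<Sum>k1 | k1 \<subseteq># k. \<Sum>i\<in>fiber K k1. \<Sum>j\<in>fiber K (k - k1). sterm (coeff f) (coeff g) i j)"
    by (rule sum_fiber_split)
  also have "\<dots> = coeff (lsub K f * lsub K g) k"
    unfolding coeff_mult[OF k]
  proof (intro sum.cong refl)
    fix k1 assume "k1 \<in> {k1. k1 \<subseteq># k}"
    then have k1: "k1 \<subseteq># k" by simp
    have leg: "legal k1" "legal (k - k1)"
      by (rule legal_subset[OF k], simp add: k1)+
    have "sterm (coeff f) (coeff g) i j = signed (msign k1 (k - k1)) (coeff f i * gi (mpar k1) (coeff g j))"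
      if ij: "i \<in> fiber K k1" "j \<in> fiber K (k - k1)" for i j
    proof -
      have "image_mset phi (i + j) = k" using ij k1 by (auto simp: fiber_def)
      then have "msign i j = msign k1 (k - k1)" "mpar i = mpar k1"
        using msign_phi[of i j] ij k mpar_phi by (auto simp: fiber_def)
      then show ?thesis by (simp add: sterm_def)
    qed
    then show "(\<Sum>i\<in>fiber K k1. \<Sum>j\<in>fiber K (k - k1). sterm (coeff f) (coeff g) i j) =
       sterm (coeff (lsub K f)) (coeff (lsub K g)) k1 (k - k1)"
      using leg by (simp add: sterm_def coeff_lsub sum_product gi_sum signed_sum)
  qed
  finally show "coeff (lsub K (f * g)) k = coeff (lsub K f * lsub K g) k" .
qed

lemma lsub_one [simp]: "lsub K 1 = 1"
proof (rule lser_eqI)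
  fix k assume k: "legal k"
  have "coeff (lsub K 1 :: 'a lser) k = (\<Sum>m\<in>fiber K k. if m = {#} then 1 else 0)"
    unfolding coeff_lsub[OF k] by (intro sum.cong) (auto simp: coeff_simps sconst_def)
  also have "\<dots> = (if {#} \<in> fiber K k then 1 else 0)" by (simp add: sum.delta)
  also have "\<dots> = coeff 1 k" by (auto simp: fiber_def coeff_simps sconst_def)
  finally show "coeff (lsub K 1 :: 'a lser) k = coeff 1 k" .
qed

lemma lsub_lvar: "lsub K (lvar v) = (if v \<in> K then 0 else lvar (phi v))"
proof (rule lser_eqI)
  fix k assume k: "legal k"
  have "coeff (lsub K (lvar v) :: 'a lser) k = (\<Sum>m\<in>fiber K k. if m = {#v#} then 1 else 0)"
    unfolding coeff_lsub[OF k] by (intro sum.cong) (auto simp: lvar.rep_eq svar_def)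
  also have "\<dots> = (if {#v#} \<in> fiber K k then 1 else 0)" by (simp add: sum.delta)
  also have "\<dots> = coeff (if v \<in> K then 0 else lvar (phi v)) k"
    by (auto simp: fiber_def coeff_simps lvar.rep_eq svar_def)
  finally show "coeff (lsub K (lvar v) :: 'a lser) k = coeff (if v \<in> K then 0 else lvar (phi v)) k" .
qed

text \<open>\<open>X\<close> and \<open>Xi\<close> are their own only preimages under
  \<open>phi\<close>, and the hypothesis on \<open>K\<close> prevents them from being sent to 0. So
  the substitution commutes with the space derivatives, hence with \<open>D\<close>.\<close>

lemma fiber_add_space:
  assumes K: "K \<subseteq> range Tm" and v: "v = X \<or> v = Xi"
  shows "fiber K (add_mset v k) = add_mset v ` fiber K k"
proof (intro equalityI subsetI)
  fix m assume m: "m \<in> fiber K (add_mset v k)"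
  then obtain u m' where "m = add_mset u m'" "phi u = v" "image_mset phi m' = k"
    by (auto simp: fiber_def dest!: msed_map_invR)
  moreover from this v have "u = v" using phi_eq_X[of u] by auto
  ultimately show "m \<in> add_mset v ` fiber K k" using m by (auto simp: fiber_def)
next
  fix m assume "m \<in> add_mset v ` fiber K k"
  then show "m \<in> fiber K (add_mset v k)" using K v by (auto simp: fiber_def)
qed

lemma lsub_lder:
  assumes K: "K \<subseteq> range Tm" and v: "v = X \<or> v = Xi"
  shows "lsub K (lder v f) = lder v (lsub K f)"
proof (rule lser_eqI)
  fix k assume k: "legal k"
  have cnt: "count m v = count k v" if "m \<in> fiber K k" for m
    using that count_phi[OF v, of m] by (auto simp: fiber_def)
  then have mem: "v \<in># m \<longleftrightarrow> v \<in># k" if "m \<in> fiber K k" for m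
    using that by (metis count_greater_zero_iff)
  have s: "(\<Sum>m\<in>fiber K (add_mset v k). coeff f m) = (\<Sum>m\<in>fiber K k. coeff f (add_mset v m))"
    unfolding fiber_add_space[OF K v] by (simp add: sum.reindex inj_on_def)
  from v show "coeff (lsub K (lder v f)) k = coeff (lder v (lsub K f)) k"
  proof
    assume X: "v = X"
    then have "legal (add_mset v k)" using k by (simp add: legal_add_mset)
    then show ?thesis using k X s cnt
      by (simp add: coeff_lsub coeff_lder_even scaleC_sum cong: sum.cong)
  next
    assume Xi: "v = Xi"
    show ?thesis
    proof (cases "v \<in># k")
      case True
      then show ?thesis using k Xi mem by (simp add: coeff_lsub coeff_lder_odd)
    next
      case False
      then have "legal (add_mset v k)" using k by (simp add: legal_add_mset)
      then show ?thesis using k Xi s mem False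
        by (simp add: coeff_lsub coeff_lder_odd grinv_sum cong: sum.cong)
    qed
  qed
qed

lemma lsub_lD:
  assumes K: "K \<subseteq> range Tm" shows "lsub K (lD f) = lD (lsub K f)"
proof -
  have "Xi \<notin> K" using K by auto
  then show ?thesis by (simp add: lD_def lsub_add lsub_mult lsub_lder[OF K] lsub_lvar)
qed

lemma lsub_Dc: "K \<subseteq> range Tm \<Longrightarrow> lsub K (Dc m r f) = Dc m r (lsub K f)"
proof -
  assume K: "K \<subseteq> range Tm"
  have "lsub K ((lD ^^ r) f) = (lD ^^ r) (lsub K f)" for f :: "'a lser"
    by (induction r) (simp_all add: lsub_lD[OF K])
  then show ?thesis by (auto simp: Dc_def lsub_lscale lgi_def lsub_linv)
qed

lemma val_lsub: "val w f \<Longrightarrow> val w (lsub K f)"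
  unfolding val_def using coeff_lsub_nonzero[of K f] by (fastforce simp: fiber_def mweight_phi)

lemma ordb_lsub: "ordb d f \<Longrightarrow> ordb d (lsub K f)"
  unfolding ordb_def using coeff_lsub_nonzero[of K f] by (fastforce simp: fiber_def xweight_phi)

section \<open>Substitution in operators\<close>

definition bsub :: "var set \<Rightarrow> 'a::supercommutative_algebra bop \<Rightarrow> 'a bop" where
  "bsub K P = Bop (\<lambda>n. lsub K (cf P n))"

lemma cf_bsub: "cf (bsub K P) n = lsub K (cf P n)"
proof -
  obtain C where "bounded_by C (cf P)" using cf[of P] by blast
  then have "bounded_by C (\<lambda>n. lsub K (cf P n))" by (auto simp: bounded_by_def ordb_lsub)
  then show ?thesis unfolding bsub_def by (subst Bop_inverse) auto
qed

lemma bnd_bsub: "bnd C P \<Longrightarrow> bnd C (bsub K P)"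
  by (simp add: bnd_def bounded_by_def cf_bsub ordb_lsub)

lemma bval_bsub: "bval w P \<Longrightarrow> bval w (bsub K P)"
  by (simp add: bval_def cf_bsub val_lsub)

lemma bsub_diff: "bsub K (P - Q) = bsub K P - bsub K Q"
  by (rule bop_eqI) (simp add: cf_bsub cf_simps lsub_diff)

lemma bsub_add: "bsub K (P + Q) = bsub K P + bsub K Q"
  by (rule bop_eqI) (simp add: cf_bsub cf_simps lsub_add)

lemma bsub_zero [simp]: "bsub K 0 = 0"
  by (rule bop_eqI) (simp add: cf_bsub cf_simps)

lemma bsub_one [simp]: "bsub K 1 = 1"
  by (rule bop_eqI) (simp add: cf_bsub cf_simps)

lemma bsub_sc: "bsub K (sc c P) = sc c (bsub K P)"
  by (rule bop_eqI) (simp add: cf_bsub cf_sc lsub_lscale)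

lemma bsub_bneg: "bsub K (bneg P) = bneg (bsub K P)"
  by (rule bop_eqI) (simp add: cf_bsub cf_bneg)

lemma bsub_single: "bsub K (single j f) = single j (lsub K f)"
  by (rule bop_eqI) (simp add: cf_bsub cf_single)

lemma bsub_mult:
  assumes K: "K \<subseteq> range Tm" shows "bsub K (P * Q) = bsub K P * bsub K Q"
proof (rule bop_eqI)
  fix n
  have "lsub K (lsum (mterm (cf P) (cf Q) n)) = lsum (\<lambda>i. lsub K (mterm (cf P) (cf Q) n i))"
    by (rule lsum_map[where c = 0]) (auto simp: lsub_diff val_lsub locfin_mterm_cf)
  also have "(\<lambda>i. lsub K (mterm (cf P) (cf Q) n i)) = mterm (cf (bsub K P)) (cf (bsub K Q)) n"
    by (auto simp: mterm_def cf_bsub lsub_mult lsub_Dc[OF K])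
  finally show "cf (bsub K (P * Q)) n = cf (bsub K P * bsub K Q) n"
    by (simp add: cf_bsub cf_times)
qed

lemma bsub_power: "K \<subseteq> range Tm \<Longrightarrow> bsub K (P ^ j) = bsub K P ^ j"
  by (induction j) (simp_all add: bsub_mult)

lemma fam_bsub: "fam C F \<Longrightarrow> fam C (\<lambda>i. bsub K (F i))"
  by (simp add: fam_def bnd_bsub bval_bsub)

lemma bsub_bsum: "fam C F \<Longrightarrow> bsub K (bsum F) = bsum (\<lambda>i. bsub K (F i))"
  by (rule bsum_map[where c = 0 and C' = C]) (auto simp: fam_bsub bsub_diff bval_bsub)

lemma bsub_bexp:
  assumes "K \<subseteq> range Tm" "bnd 0 H" "bval 1 H"
  shows "bsub K (bexp H) = bexp (bsub K H)"
proof -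
  have "(\<lambda>j. bsub K (dpow H j)) = dpow (bsub K H)"
    using assms(1) by (simp add: dpow_def bsub_sc bsub_power fun_eq_iff)
  then show ?thesis unfolding bexp_def by (simp add: bsub_bsum[OF fam_dpow[OF assms(2,3)]])
qed

lemma bsub_bvar: "bsub K (bvar v) = (if v \<in> K then 0 else bvar (phi v))"
  by (simp add: bsub_single lsub_lvar)

lemma bsub_dp [simp]: "bsub K (dp j) = dp j"
  by (simp add: bsub_single)

lemma bsub_dxi: "K \<subseteq> range Tm \<Longrightarrow> bsub K dxi = dxi"
  by (auto simp: dxi_def bsub_diff bsub_mult bsub_bvar)


subsection \<open>The maximal evolution operator\<close>

definition term1 :: "nat \<Rightarrow> 'a::supercommutative_algebra bop" where
  "term1 n = bvar (Tp (2 * n + 1)) * dxi * dp 2 ^ n + bvar (Tm (2 * n + 1)) * bvar Xi * dp 2 ^ (n + 1)"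

definition term0 :: "nat \<Rightarrow> 'a::supercommutative_algebra bop" where
  "term0 n = (if n = 0 then 0 else bvar (Tp (2 * n)) * dxi * bvar Xi * dp 2 ^ n
     + bvar (Tm (2 * n)) * bvar Xi * dxi * dp 2 ^ n)"

definition UM :: "'a::supercommutative_algebra bop" where
  "UM = bexp (bsum term1) * bexp (bsum term0)"

text \<open>Here the weight 1 of \<open>Xi\<close> pays off: \<open>Xi * D^(2n+2)\<close> has bound
  \<open>2n + 1\<close> rather than \<open>2n + 2\<close>, which the weight of
  \<open>Tm (2n+1)\<close> compensates. So both exponents of \<open>UM\<close> have bound 0.\<close>

lemma bounds_dxi_Xi:
  "bnd (int (2 * n) + 1) (dxi * dp 2 ^ n :: 'a::supercommutative_algebra bop)"
  "bnd (int (2 * n) + 1) (bvar Xi * dp 2 ^ (n + 1) :: 'a bop)"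
  "bnd (int (2 * n)) (dxi * (bvar Xi * dp 2 ^ n) :: 'a bop)"
  "bnd (int (2 * n)) (bvar Xi * (dxi * dp 2 ^ n) :: 'a bop)"
  by (rule bnd_timesI[OF bnd_dxi bnd_dp_power] bnd_timesI[OF bnd_Xi bnd_dp_power]
      bnd_timesI[OF bnd_dxi bnd_timesI[OF bnd_Xi bnd_dp_power order_refl]]
      bnd_timesI[OF bnd_Xi bnd_timesI[OF bnd_dxi bnd_dp_power order_refl]]; simp)+

lemma fam_term1: "fam 0 (term1 :: nat \<Rightarrow> 'a::supercommutative_algebra bop)"
proof -
  have "bnd 0 (term1 n :: 'a bop)" for n
    unfolding term1_def mult.assoc
    by (intro bnd_add bnd_timesI[OF bnd_time bounds_dxi_Xi(1)] bnd_timesI[OF bnd_time bounds_dxi_Xi(2)]) auto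
  then show ?thesis by (simp add: fam_def) (simp add: term1_def mult.assoc bval_add bval_time)
qed

lemma fam_term0: "fam 0 (term0 :: nat \<Rightarrow> 'a::supercommutative_algebra bop)"
proof -
  have "bnd 0 (term0 n :: 'a bop)" for n
    unfolding term0_def mult.assoc
    by (cases "n = 0", simp, simp only: if_False,
        intro bnd_add bnd_timesI[OF bnd_time bounds_dxi_Xi(3)] bnd_timesI[OF bnd_time bounds_dxi_Xi(4)]) auto
  then show ?thesis by (simp add: fam_def) (simp add: term0_def mult.assoc bval_add bval_time)
qed

lemma H1_H0_props:
  "bnd 0 (bsum term1 :: 'a::supercommutative_algebra bop)" "bval 1 (bsum term1 :: 'a bop)"
  "bnd 0 (bsum term0 :: 'a bop)" "bval 1 (bsum term0 :: 'a bop)"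
proof -
  show "bnd 0 (bsum term1 :: 'a bop)" by (rule bnd_bsum[OF fam_term1])
  show "bval 1 (bsum term1 :: 'a bop)"
    by (rule bval_bsum[OF fam_term1]) (simp add: term1_def mult.assoc bval_add bval_time)
  show "bnd 0 (bsum term0 :: 'a bop)" by (rule bnd_bsum[OF fam_term0])
  show "bval 1 (bsum term0 :: 'a bop)"
    by (rule bval_bsum[OF fam_term0]) (simp add: term0_def mult.assoc bval_add bval_time)
qed

lemma bsub_UM:
  fixes A B :: "'a::supercommutative_algebra bop"
  assumes K: "K \<subseteq> range Tm" and A: "bsub K (bsum term1) = A" and B: "bsub K (bsum term0) = B"
    and AB: "A * B = B * A"
  shows "bsub K UM = bexp (A + B)"
proof -
  have "bsub K UM = bexp A * bexp B"
    by (simp add: UM_def bsub_mult[OF K] bsub_bexp[OF K H1_H0_props(1,2)] bsub_bexp[OF K H1_H0_props(3,4)] A B)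
  also have "\<dots> = bexp (A + B)"
    by (rule bexp_add) (simp_all only: A[symmetric] B[symmetric] bnd_bsub bval_bsub H1_H0_props AB[folded A B])
  finally show ?thesis .
qed

text \<open>Once the two even times coincide, the complementary projections \<open>dxi * Xi\<close>
  and \<open>Xi * dxi\<close> add up to 1.\<close>

lemma bsub_term0:
  assumes K: "K \<subseteq> range Tm" "\<And>n. Tm (2 * n) \<notin> K"
  shows "bsub K (term0 n) = (if n = 0 then 0 else bvar (T (2 * n)) * dp 2 ^ n :: 'a::supercommutative_algebra bop)"
proof -
  have "Xi \<notin> K" "Tp (2 * n) \<notin> K" using K by auto
  then have "bsub K (bvar (Tp (2 * n)) * dxi * bvar Xi * dp 2 ^ n + bvar (Tm (2 * n)) * bvar Xi * dxi * dp 2 ^ n) =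
    bvar (T (2 * n)) * (dxi * bvar Xi + bvar Xi * dxi) * (dp 2 ^ n :: 'a bop)"
    using K by (simp add: bsub_add bsub_mult bsub_bvar bsub_dxi bsub_power bop_distrib mult.assoc)
  then show ?thesis by (simp add: term0_def dxi_Xi)
qed

lemma even_term_commute:
  fixes P :: "'a::supercommutative_algebra bop"
  assumes "dp 2 * P = P * dp 2"
  shows "P * (bvar (T (2 * n)) * dp 2 ^ k) = (bvar (T (2 * n)) * dp 2 ^ k) * P"
proof -
  have t: "bvar (T (2 * n)) * P = P * bvar (T (2 * n))"
    using bvar_mult_commute[of "T (2 * n)" P] by (simp add: ogi_def)
  have "P * (bvar (T (2 * n)) * dp 2 ^ k) = (P * bvar (T (2 * n))) * dp 2 ^ k"
    by (simp only: mult.assoc)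
  also have "\<dots> = bvar (T (2 * n)) * (P * dp 2 ^ k)"
    by (simp only: t[symmetric] mult.assoc)
  also have "\<dots> = (bvar (T (2 * n)) * dp 2 ^ k) * P"
    by (simp only: dp_2_power_commute[OF assms, symmetric] mult.assoc)
  finally show ?thesis .
qed

lemma bsub_UM_J: "bsub {Tm n |n. odd n} UM = (bexp HJ :: 'a::supercommutative_algebra bop)"
proof -
  let ?K = "{Tm n |n. odd n}"
  let ?a = "\<lambda>n. bvar (T (2 * n + 1)) * (dp 2 ^ n * dxi) :: 'a bop"
  let ?b = "\<lambda>n. bvar (T (2 * (n + 1))) * dp 2 ^ (n + 1) :: 'a bop"
  have K: "?K \<subseteq> range Tm" "\<And>n. Tm (2 * n) \<notin> ?K" by auto
  have c: "dxi * dp 2 ^ n = (dp 2 ^ n * dxi :: 'a bop)" for n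
    by (rule dp_2_power_commute[OF dp_2_dxi, symmetric])
  have "bsub ?K (term1 n) = ?a n" for n
    using K by (auto simp: term1_def bsub_add bsub_mult bsub_bvar bsub_dxi bsub_power mult.assoc c simp del: power_Suc)
  then have A: "bsub ?K (bsum term1) = bsum ?a"
    by (simp add: bsub_bsum[OF fam_term1])
  have "bsub ?K (bsum term0) = bsum (\<lambda>n. bsub ?K (term0 n :: 'a bop))"
    by (rule bsub_bsum[OF fam_term0])
  also have "\<dots> = bsum (\<lambda>n. bsub ?K (term0 (Suc n)))"
    by (rule bsum_shift[OF fam_bsub[OF fam_term0]]) (simp add: term0_def)
  also have "\<dots> = bsum ?b" using bsub_term0[OF K, where 'a = 'a] by simp
  finally have B: "bsub ?K (bsum term0) = bsum ?b" .
  have "bsum ?a * bsum ?b = bsum ?b * bsum ?a"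
  proof (rule bsum_commute[OF fam_J(1)])
    fix n
    have "?b n * bsum ?a = bsum ?a * ?b n"
    proof (rule bsum_commute[OF fam_J(2)])
      fix m
      have "dp 2 * ?a m = bvar (T (2 * m + 1)) * (dp 2 * (dp 2 ^ m * dxi))"
        using dp_2_bvar[of "T (2 * m + 1)", where 'a = 'a] by (simp add: mult.assoc[symmetric])
      also have "dp 2 * (dp 2 ^ m * dxi) = (dp 2 ^ m * dxi) * (dp 2 :: 'a bop)"
        by (simp add: mult.assoc dp_2_dxi[symmetric]) (simp add: mult.assoc[symmetric] power_commutes)
      finally have "dp 2 * ?a m = ?a m * dp 2" by (simp add: mult.assoc)
      from even_term_commute[OF this, of "n + 1" "n + 1"] show "?b n * ?a m = ?a m * ?b n" by simp
    qed
    then show "bsum ?a * ?b n = ?b n * bsum ?a" by simp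
  qed
  then have "bsub ?K UM = bexp (bsum ?a + bsum ?b)" by (rule bsub_UM[OF K(1) A B])
  also have "bsum ?a + bsum ?b = HJ"
    unfolding HJ_def termJ_def mult.assoc bsum_add[OF fam_J, symmetric] add.commute[of "bsum ?a"] ..
  finally show ?thesis .
qed

lemma bsub_UM_MR: "bsub {} UM = (bexp HMR :: 'a::supercommutative_algebra bop)"
proof -
  let ?a = "\<lambda>n. if even n then 0 else termMR n :: 'a bop"
  let ?b = "\<lambda>n. if odd n then 0 else termMR n :: 'a bop"
  have fa: "fam 0 ?a" and fb: "fam 0 ?b" using fam_termMR[where 'a = 'a] by (auto simp: fam_def)
  have dd: "dp 1 * dp 2 ^ n = (dp (int (2 * n + 1)) :: 'a bop)" for n
    by (simp add: dp_power dp_mult_dp add.commute)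
  have "bsub {} (term1 n) = bvar (T (2 * n + 1)) * (dxi + bvar Xi * dp 2) * (dp 2 ^ n :: 'a bop)" for n
    by (simp add: term1_def bsub_add bsub_mult bsub_bvar bsub_dxi bsub_power bop_distrib mult.assoc)
  \<comment> \<open>\<open>dxi + Xi * D^2\<close> is \<open>D\<close> by the definition of
    \<open>dxi\<close>, so identifying the odd times yields an odd power of
    \<open>D\<close>.\<close>
  also have "bvar (T (2 * n + 1)) * (dxi + bvar Xi * dp 2) * (dp 2 ^ n :: 'a bop) = ?a (2 * n + 1)" for n
    by (simp add: dxi_def mult.assoc dd termMR_def)
  finally have "bsub {} (bsum term1) = bsum (\<lambda>n. ?a (2 * n + 1))"
    by (simp add: bsub_bsum[OF fam_term1])
  also have "\<dots> = bsum ?a" by (rule bsum_odd[OF fa, symmetric]) simp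
  finally have A: "bsub {} (bsum term1) = bsum ?a" .
  have "bsub {} (term0 n) = ?b (2 * n)" for n
    using bsub_term0[of "{}" n, where 'a = 'a] by (simp add: termMR_def dp_power)
  then have "bsub {} (bsum term0) = bsum (\<lambda>n. ?b (2 * n))"
    by (simp add: bsub_bsum[OF fam_term0])
  also have "\<dots> = bsum ?b" by (rule bsum_even[OF fb, symmetric]) simp
  finally have B: "bsub {} (bsum term0) = bsum ?b" .
  have "bsum ?a * bsum ?b = bsum ?b * bsum ?a"
  proof (rule bsum_commute[OF fb])
    fix n
    have "?b n * bsum ?a = bsum ?a * ?b n"
    proof (rule bsum_commute[OF fa])
      fix m
      have "dp 2 * ?a m = ?a m * dp 2"
        using termMR_dp[of m 2, where 'a = 'a] by auto
      from even_term_commute[OF this, of "n div 2" "n div 2"]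
      show "?b n * ?a m = ?a m * ?b n"
        by (auto simp: termMR_def[of n] dp_power elim!: evenE)
    qed
    then show "bsum ?a * ?b n = ?b n * bsum ?a" by simp
  qed
  then have "bsub {} UM = bexp (bsum ?a + bsum ?b)" by (rule bsub_UM[OF empty_subsetI A B])
  also have "bsum ?a + bsum ?b = bsum (\<lambda>n. ?a n + ?b n)" by (rule bsum_add[OF fa fb, symmetric])
  also have "(\<lambda>n. ?a n + ?b n) = termMR" by auto
  finally show ?thesis by (simp add: HMR_def)
qed


section \<open>Translation to the formal sums of the statement\<close>

definition raw :: "'a::supercommutative_algebra bop \<Rightarrow> 'a oper" where
  "raw P = (\<lambda>n. coeff (cf P n))"

lemma raw_inject: "raw P = raw Q \<longleftrightarrow> P = Q"
  unfolding raw_def by (metis bop_eqI coeff_inject)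

lemma raw_times: "raw P \<odot> raw Q = raw (P * Q)"
  by (simp add: omult_def raw_def cf_times lsum.rep_eq mterm_def times_lser.rep_eq coeff_Dc case_prod_unfold)

lemma raw_zero: "raw 0 = 0"
  by (simp add: raw_def cf_simps zero_lser.rep_eq zero_fun_def)

lemma raw_add: "raw P + raw Q = raw (P + Q)"
  by (simp add: raw_def cf_simps plus_lser.rep_eq plus_fun_def)

lemma raw_uminus: "- raw P = raw (- P)"
  by (simp add: raw_def cf_simps uminus_lser.rep_eq fun_Compl_def)

lemma raw_diff: "raw P - raw Q = raw (P - Q)"
  by (simp add: raw_def cf_simps minus_lser.rep_eq fun_diff_def)

lemma raw_one: "oone = raw 1"
  by (auto simp: oone_def oser_def raw_def cf_simps one_lser.rep_eq zero_lser.rep_eq zero_fun_def)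

lemma raw_power: "opow (raw P) k = raw (P ^ k)"
  by (induction k) (simp_all add: opow_def raw_one raw_times)

lemma raw_var: "ovar v = raw (bvar v)"
  by (auto simp: ovar_def oser_def raw_def cf_single lvar.rep_eq zero_lser.rep_eq zero_fun_def)

lemma raw_dp: "Dpow j = raw (dp j)"
  by (auto simp: Dpow_def raw_def cf_single one_lser.rep_eq zero_lser.rep_eq zero_fun_def)

lemma raw_d_x: "d_x = raw (dp 2)"
  by (simp add: d_x_def raw_dp)

lemma raw_d_xi: "d_xi = raw dxi"
  by (simp add: d_xi_def dxi_def raw_dp raw_var raw_times raw_diff)

lemma raw_bneg: "neg_part (raw P) = raw (bneg P)"
  by (auto simp: neg_part_def raw_def cf_bneg zero_lser.rep_eq zero_fun_def)

lemma raw_bder: "oderiv v (raw P) = raw (bder v P)"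
  by (simp add: oderiv_def raw_def cf_bder lder.rep_eq)

lemma raw_bsum: "fam C F \<Longrightarrow> osum UNIV (\<lambda>i. raw (F i)) = raw (bsum F)"
  by (simp add: osum_def raw_def cf_bsum lsum.rep_eq)

lemma raw_bsum_from_1:
  assumes "fam C G" "\<And>i. G i = (if i = 0 then 0 else F i)"
  shows "osum {1..} (\<lambda>i. raw (F i)) = raw (bsum G)"
proof -
  have "{i. i \<in> {1::nat..} \<and> raw (F i) n m \<noteq> 0} = {i. i \<in> UNIV \<and> raw (G i) n m \<noteq> 0}" for n m
    by (auto simp: assms(2) raw_zero)
  moreover have "raw (F i) n m = raw (G i) n m" if "i \<in> UNIV \<and> raw (G i) n m \<noteq> 0" for i n m
    using that by (auto simp: assms(2) raw_zero split: if_splits)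
  ultimately have "osum {1..} (\<lambda>i. raw (F i)) = osum UNIV (\<lambda>i. raw (G i))"
    unfolding osum_def fsum_def by (intro ext sum.cong) auto
  then show ?thesis using raw_bsum[OF assms(1)] by simp
qed

lemma raw_H1: "H1 = raw (bsum term1)"
  using raw_bsum[OF fam_term1] by (simp add: H1_def raw_var raw_d_xi raw_d_x raw_power raw_times raw_add term1_def[abs_def])

lemma raw_H0: "H0 = raw (bsum term0)"
  unfolding H0_def raw_var raw_d_xi raw_d_x raw_power raw_times raw_add
  by (rule raw_bsum_from_1[OF fam_term0]) (simp add: term0_def)

lemma raw_exp: "bnd 0 H \<Longrightarrow> bval 1 H \<Longrightarrow> oexp (raw H) = raw (bexp H)"
proof -
  assume "bnd 0 H" "bval 1 H"
  then have "osum UNIV (\<lambda>i. raw (dpow H i)) = raw (bexp H)"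
    unfolding bexp_def by (rule raw_bsum[OF fam_dpow])
  then show ?thesis
    by (simp add: oexp_def raw_power) (simp add: raw_def dpow_def cf_sc lscale.rep_eq)
qed

lemma raw_UM: "U_M = raw UM"
  by (simp only: U_M_def UM_def raw_H1 raw_H0 raw_exp H1_H0_props raw_times)

lemma raw_UJ: "U_J = raw (bexp HJ)"
proof -
  have "U_J = oexp (osum UNIV (\<lambda>n. raw (termJ n)))"
    by (simp only: U_J_def raw_var raw_d_x raw_d_xi raw_power raw_times raw_add termJ_def)
  then show ?thesis by (simp only: raw_bsum[OF fam_termJ] HJ_def[symmetric] raw_exp HJ_props)
qed

lemma raw_UMR: "U_MR = raw (bexp HMR)"
proof -
  have "U_MR = oexp (raw (bsum termMR))"
    unfolding U_MR_def raw_var raw_dp raw_times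
    by (rule arg_cong[where f = oexp], rule raw_bsum_from_1[OF fam_termMR]) (simp add: termMR_def)
  then show ?thesis by (simp only: HMR_def[symmetric] raw_exp HMR_props)
qed

lemma raw_flow: "MR_flow k (raw P) = raw (flow k P)"
proof -
  obtain C where C: "bnd C P" using bnd_exists by blast
  show ?thesis
    by (simp only: MR_flow_def flow_def raw_bder raw_var raw_times raw_bsum[OF fam_flow[OF C]] raw_diff if_distrib[of raw])
qed


subsection \<open>Substitution\<close>

lemma smult_coeff_svar: "smult (svar v) (coeff f) = coeff (lvar v * f)"
  by (simp add: times_lser.rep_eq lvar.rep_eq)

lemma smult_zero_left: "smult (\<lambda>_. 0) g = (\<lambda>_. 0)"
  by (simp add: smult_def fun_eq_iff)

lemma smult_sconst: "legal k \<Longrightarrow> smult (sconst a) g k = a * g k"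
proof -
  assume k: "legal k"
  have "smult (sconst a) g k = (\<Sum>j | j \<subseteq># k. if j = {#} then a * g k else 0)"
    unfolding smult_alt if_P[OF k] by (rule sum.cong) (auto simp: sterm_def sconst_def)
  then show ?thesis by (simp add: sum.delta)
qed

text \<open>The list is sorted and \<open>phi\<close> is weakly monotone, so the image of the head
  never passes a smaller odd variable and no sign arises. A repeated odd image makes the monomial
  illegal and the product 0.\<close>

lemma foldr_subst:
  fixes \<sigma> :: "var \<Rightarrow> 'a::supercommutative_algebra ser"
  assumes \<sigma>: "\<And>v. \<sigma> v = (if v \<in> K then (\<lambda>_. 0) else svar (phi v))"
  shows "sorted xs \<Longrightarrow> foldr (\<lambda>v g. smult (\<sigma> v) g) xs (sconst 1) =
    (\<lambda>k. if legal k \<and> k = image_mset phi (mset xs) \<and> set xs \<inter> K = {} then 1 else 0)"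
proof (induction xs)
  case Nil
  show ?case by (auto simp: sconst_def)
next
  case (Cons v xs)
  let ?g = "\<lambda>k. if legal k \<and> k = image_mset phi (mset xs) \<and> set xs \<inter> K = {} then 1 else 0 :: 'a"
  have IH: "foldr (\<lambda>v g. smult (\<sigma> v) g) xs (sconst 1) = ?g" using Cons by simp
  define G where "G = Lser ?g"
  have g: "coeff G = ?g" unfolding G_def by (subst Lser_inverse) auto
  show ?case
  proof (cases "v \<in> K")
    case True
    then show ?thesis by (simp add: \<sigma> smult_zero_left)
  next
    case False
    let ?u = "phi v"
    have sm: "smult (\<sigma> v) ?g = coeff (lvar ?u * G)"
      unfolding g[symmetric] \<sigma> if_not_P[OF False] by (rule smult_coeff_svar)
    have "smult (\<sigma> v) ?g k = (if legal k \<and> k = image_mset phi (mset (v # xs)) \<and> set (v # xs) \<inter> K = {} then 1 else 0)" for k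
    proof (cases "legal k \<and> ?u \<in># k")
      case True
      then obtain k' where k': "k = add_mset ?u k'" by (meson multi_member_split)
      have leg: "legal k" "legal k'" using True by (auto simp: k' legal_add_mset)
      have sgn: "\<not> msign {#?u#} k'" if "k' = image_mset phi (mset xs)"
      proof (cases "vodd ?u")
        case True
        have "{w \<in> oddset k'. w < ?u} = {}"
          using Cons.prems that phi_mono by (auto simp: oddset_def not_less)
        then have "\<not> below ?u k'" unfolding below_def by (metis card.empty even_zero)
        then show ?thesis using True by (simp add: msign_single_left)
      qed (simp add: msign_single_even)
      have "smult (\<sigma> v) ?g k = signed (msign {#?u#} k') (gi (vodd ?u) (coeff G k'))"
        unfolding sm coeff_lvar_mult[OF leg(1)] by (simp add: k')
      also have "coeff G k' = ?g k'" by (simp only: g)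
      finally have "smult (\<sigma> v) ?g k = signed (msign {#?u#} k') (gi (vodd ?u) (?g k'))" .
      then show ?thesis using sgn False leg by (auto simp: k')
    next
      case nmem: False
      then have "smult (\<sigma> v) ?g k = 0"
        unfolding sm by (cases "legal k") (simp_all add: coeff_lvar_mult coeff_illegal)
      then show ?thesis using nmem by auto
    qed
    moreover have "foldr (\<lambda>v g. smult (\<sigma> v) g) (v # xs) (sconst 1) = smult (\<sigma> v) ?g"
      by (simp only: foldr_Cons o_apply IH)
    ultimately show ?thesis by presburger
  qed
qed

lemma ssubst_coeff:
  assumes \<sigma>: "\<And>v. \<sigma> v = (if v \<in> K then (\<lambda>_. 0) else svar (phi v))"
  shows "ssubst \<sigma> (coeff f) = coeff (lsub K f)"
proof
  fix k
  show "ssubst \<sigma> (coeff f) k = coeff (lsub K f) k"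
  proof (cases "legal k")
    case True
    have ms: "msubst \<sigma> m = (\<lambda>k. if legal k \<and> k = image_mset phi m \<and> set_mset m \<inter> K = {} then 1 else 0)" for m
      unfolding msubst_def using foldr_subst[OF \<sigma>, of "sorted_list_of_multiset m"] by simp
    have "ssubst \<sigma> (coeff f) k = fsum UNIV (\<lambda>m. if m \<in> fiber K k then coeff f m else 0)"
      unfolding ssubst_def ms smult_sconst[OF True]
      by (rule arg_cong[where f = "fsum UNIV"]) (use True in \<open>auto simp: fiber_def\<close>)
    also have "\<dots> = (\<Sum>m\<in>fiber K k. if m \<in> fiber K k then coeff f m else 0)"
      by (rule fsum_eq) auto
    finally show ?thesis by (simp add: coeff_lsub[OF True])
  next
    case False
    then show ?thesis by (simp add: ssubst_def smult_def fsum_def coeff_illegal)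
  qed
qed

lemma raw_bsub:
  assumes "\<And>v. \<sigma> v = (if v \<in> K then (\<lambda>_. 0) else svar (phi v))"
  shows "osubst \<sigma> (raw P) = raw (bsub K P)"
  by (simp add: osubst_def raw_def cf_bsub ssubst_coeff[OF assms])

lemma subst_J_alt: "subst_J v = (if v \<in> {Tm n |n. odd n} then (\<lambda>_. 0) else svar (phi v))"
  by (cases v) (auto simp: zero_fun_def)

lemma subst_MR_alt: "subst_MR v = (if v \<in> {} then (\<lambda>_. 0) else svar (phi v))"
  by (cases v) auto


section \<open>Coefficients in \<open>R\<close>\<close>

definition tensor :: "(mono \<Rightarrow> complex) \<Rightarrow> 'a \<Rightarrow> 'a::supercommutative_algebra ser" where
  "tensor c a = (\<lambda>m. scaleC (c m) a)"

definition space :: "(mono \<Rightarrow> complex) \<Rightarrow> bool" where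
  "space c \<longleftrightarrow> (\<forall>m. c m \<noteq> 0 \<longrightarrow> legal m \<and> set_mset m \<subseteq> {X, Xi})"

lemma R_ring_iff: "f \<in> R_ring \<longleftrightarrow> (\<exists>(N::nat) a c. (\<forall>i<N. space (c i)) \<and> f = (\<lambda>m. \<Sum>i<N. tensor (c i) (a i) m))"
  by (simp add: R_ring_def space_def tensor_def)

lemma R_ring_tensor: "space c \<Longrightarrow> tensor c a \<in> R_ring"
  unfolding R_ring_iff by (intro exI[of _ "1::nat"] exI[of _ "\<lambda>_. a"] exI[of _ "\<lambda>_. c"]) auto

lemma R_ring_zero: "(\<lambda>m. 0) \<in> R_ring"
  unfolding R_ring_iff by (rule exI[of _ "0::nat"]) auto

lemma R_ring_add:
  assumes "f \<in> R_ring" "g \<in> R_ring" shows "(\<lambda>m. f m + g m) \<in> R_ring"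
proof -
  obtain N :: nat and a c where f: "\<forall>i<N. space (c i)" "f = (\<lambda>m. \<Sum>i<N. tensor (c i) (a i) m)"
    using assms(1) unfolding R_ring_iff by blast
  obtain M :: nat and b d where g: "\<forall>i<M. space (d i)" "g = (\<lambda>m. \<Sum>i<M. tensor (d i) (b i) m)"
    using assms(2) unfolding R_ring_iff by blast
  let ?a = "\<lambda>i. if i < N then a i else b (i - N)" and ?c = "\<lambda>i. if i < N then c i else d (i - N)"
  have "(\<Sum>i<N + M. tensor (?c i) (?a i) m) = f m + g m" for m
  proof -
    have "sum F {..<N + M} = sum F {..<N} + (\<Sum>i<M. F (N + i))" for F :: "nat \<Rightarrow> 'a"
      by (induction M) (simp_all add: add.assoc)
    then show ?thesis by (simp add: f g)
  qed
  moreover have "\<forall>i<N + M. space (?c i)" using f g by auto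
  ultimately show ?thesis unfolding R_ring_iff by (intro exI[of _ "N + M"] exI[of _ ?a] exI[of _ ?c]) auto
qed

lemma R_ring_sum: "(\<And>i. i \<in> A \<Longrightarrow> f i \<in> R_ring) \<Longrightarrow> (\<lambda>m. \<Sum>i\<in>A. f i m) \<in> R_ring"
  by (induction A rule: infinite_finite_induct) (auto intro: R_ring_zero R_ring_add)

text \<open>Additivity reduces closure properties of \<open>R\<close> to simple tensors;
  multiplication is handled by applying this in each argument.\<close>

lemma R_ring_map:
  assumes "f \<in> R_ring" and L0: "L (\<lambda>m. 0) = (\<lambda>m. 0)"
    and add: "\<And>f g. L (\<lambda>m. f m + g m) = (\<lambda>m. L f m + L g m)"
    and tensor: "\<And>c a. space c \<Longrightarrow> L (tensor c a) \<in> R_ring"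
  shows "L f \<in> R_ring"
proof -
  obtain N :: nat and a c where f: "\<forall>i<N. space (c i)" "f = (\<lambda>m. \<Sum>i<N. tensor (c i) (a i) m)"
    using assms(1) unfolding R_ring_iff by blast
  have "L (\<lambda>m. \<Sum>i<n. tensor (c i) (a i) m) = (\<lambda>m. \<Sum>i<n. L (tensor (c i) (a i)) m)" for n
    by (induction n) (simp_all add: L0 add)
  then show ?thesis using f tensor R_ring_sum[of "{..<N}" "\<lambda>i. L (tensor (c i) (a i))"] by simp
qed

lemma R_ring_sinv: "f \<in> R_ring \<Longrightarrow> sinv f \<in> R_ring"
proof (erule R_ring_map)
  fix c and a :: 'a assume c: "space c"
  have "sinv (tensor c a) = tensor (\<lambda>m. signed (mpar m) (c m)) (grinv a)"
    by (auto simp: sinv_def tensor_def grinv_scaleC signed_def scaleC_neg)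
  then show "sinv (tensor c a) \<in> R_ring"
    using c by (auto intro!: R_ring_tensor simp: space_def)
qed (auto simp: sinv_def grinv_add signed_add)

lemma R_ring_scale: "f \<in> R_ring \<Longrightarrow> (\<lambda>m. scaleC d (f m)) \<in> R_ring"
proof (erule R_ring_map)
  fix c and a :: 'a assume c: "space c"
  have "(\<lambda>m. scaleC d (tensor c a m)) = tensor (\<lambda>m. d * c m) a"
    by (auto simp: tensor_def scaleC_scaleC)
  then show "(\<lambda>m. scaleC d (tensor c a m)) \<in> R_ring"
    using c by (auto intro!: R_ring_tensor simp: space_def)
qed (auto simp: scaleC_add_right)

lemma R_ring_signed: "f \<in> R_ring \<Longrightarrow> (\<lambda>m. signed p (f m)) \<in> R_ring"
  using R_ring_scale[of f "- 1"] by (cases p) (simp_all add: scaleC_neg scaleC_one)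

lemma R_ring_sderiv:
  assumes v: "v = X \<or> v = Xi" and f: "f \<in> R_ring" shows "sderiv v f \<in> R_ring"
  using f
proof (rule R_ring_map)
  show "sderiv v (\<lambda>m. 0) = (\<lambda>m. 0 :: 'a)" by (auto simp: sderiv_alt)
  show "sderiv v (\<lambda>m. f m + g m) = (\<lambda>m. sderiv v f m + sderiv v g m)" for f g :: "'a ser"
    by (auto simp: sderiv_alt grinv_add signed_add scaleC_add_right)
  fix c and a :: 'a assume c: "space c"
  let ?c = "\<lambda>m. if vodd v then if v \<in># m then 0 else signed (below v m) (c (add_mset v m))
    else of_nat (count m v + 1) * c (add_mset v m)"
  have "sderiv v (tensor c a) = tensor ?c (if vodd v then grinv a else a)"
    by (auto simp: sderiv_alt tensor_def scaleC_scaleC grinv_scaleC signed_def scaleC_neg)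
  moreover have "space ?c"
    unfolding space_def
  proof (intro allI impI)
    fix m assume "?c m \<noteq> 0"
    then have "c (add_mset v m) \<noteq> 0" by (auto split: if_splits)
    then have "legal (add_mset v m)" "set_mset (add_mset v m) \<subseteq> {X, Xi}"
      using c unfolding space_def by blast+
    then show "legal m \<and> set_mset m \<subseteq> {X, Xi}" by (auto simp: legal_add_mset)
  qed
  ultimately show "sderiv v (tensor c a) \<in> R_ring" by (simp add: R_ring_tensor)
qed

text \<open>The result is a sum of two simple tensors, sorted by the parity of the monomial from the
  first factor: an odd one turns \<open>b\<close> into \<open>grinv b\<close> on its way.\<close>

lemma R_ring_smult_tensor:
  assumes "space c" "space d" shows "smult (tensor c a) (tensor d b) \<in> R_ring"
proof -
  define e where "e p m = (if legal m then \<Sum>k | k \<subseteq># m.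
    (if mpar k = p then signed (msign k (m - k)) (c k * d (m - k)) else 0) else 0)" for p m
  have "smult (tensor c a) (tensor d b) = (\<lambda>m. tensor (e False) (a * b) m + tensor (e True) (a * grinv b) m)"
  proof
    fix m
    show "smult (tensor c a) (tensor d b) m = tensor (e False) (a * b) m + tensor (e True) (a * grinv b) m"
    proof (cases "legal m")
      case True
      show ?thesis
        unfolding smult_alt tensor_def e_def if_P[OF True] scaleC_sum_left sum.distrib[symmetric]
        by (intro sum.cong refl)
          (auto simp: sterm_def gi_scaleC mult_scaleC_left mult_scaleC_right scaleC_scaleC signed_def scaleC_neg mult.commute)
    qed (simp add: smult_def tensor_def e_def)
  qed
  moreover have "space (e p)" for p
    unfolding space_def
  proof (intro allI impI)
    fix m assume m: "e p m \<noteq> 0"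
    then have leg: "legal m" by (auto simp: e_def split: if_splits)
    then obtain k where k: "k \<subseteq># m" "c k \<noteq> 0" "d (m - k) \<noteq> 0"
      using m unfolding e_def if_P[OF leg]
      by (elim sum.not_neutral_contains_not_neutral) (auto split: if_splits)
    then have "set_mset k \<subseteq> {X, Xi}" "set_mset (m - k) \<subseteq> {X, Xi}" using assms by (auto simp: space_def)
    moreover have "set_mset m = set_mset k \<union> set_mset (m - k)"
      using k(1) by (metis set_mset_union subset_mset.add_diff_inverse)
    ultimately show "legal m \<and> set_mset m \<subseteq> {X, Xi}" using leg by simp
  qed
  ultimately show ?thesis by (simp add: R_ring_add R_ring_tensor)
qed

lemma smult_add:
  "smult (\<lambda>m. f m + g m) h = (\<lambda>m. smult f h m + smult g h m)"
  "smult h (\<lambda>m. f m + g m) = (\<lambda>m. smult h f m + smult h g m)"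
  by (auto simp: smult_alt sterm_def distrib_right distrib_left gi_add signed_add sum.distrib)

lemma smult_zero_right: "smult g (\<lambda>_. 0) = (\<lambda>_. 0)"
  by (simp add: smult_alt sterm_def fun_eq_iff)

lemma R_ring_smult:
  assumes "f \<in> R_ring" "g \<in> R_ring" shows "smult f g \<in> R_ring"
  using assms(1)
proof (rule R_ring_map[where L = "\<lambda>f. smult f g"])
  fix c and a :: 'a assume c: "space c"
  show "smult (tensor c a) g \<in> R_ring"
    using assms(2) by (rule R_ring_map) (simp_all only: smult_zero_right smult_add R_ring_smult_tensor[OF c])
qed (simp_all only: smult_zero_left smult_add)

section \<open>Coefficients of the time monomials\<close>

definition slice :: "mono \<Rightarrow> 'a::supercommutative_algebra ser \<Rightarrow> 'a ser" where
  "slice k f = (\<lambda>m. if set_mset m \<subseteq> {X, Xi} then f (m + k) else 0)"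

definition Rt :: "var set \<Rightarrow> 'a::supercommutative_algebra lser \<Rightarrow> bool" where
  "Rt V f \<longleftrightarrow> (\<forall>m. coeff f m \<noteq> 0 \<longrightarrow> set_mset m \<subseteq> {X, Xi} \<union> V) \<and>
     (\<forall>k. set_mset k \<subseteq> V \<longrightarrow> slice k (coeff f) \<in> R_ring)"

lemma Rt_iff: "Rt V f \<longleftrightarrow> coeff f \<in> R_time V"
  using coeff_illegal[of _ f] by (auto simp: Rt_def R_time_def slice_def)

lemma Rt_zero: "Rt V 0"
  by (simp add: Rt_def slice_def coeff_simps R_ring_zero)

lemma RtI:
  "(\<And>m. coeff f m \<noteq> 0 \<Longrightarrow> set_mset m \<subseteq> {X, Xi} \<union> V) \<Longrightarrow>
   (\<And>k. set_mset k \<subseteq> V \<Longrightarrow> slice k (coeff f) \<in> R_ring) \<Longrightarrow> Rt V f"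
  by (simp only: Rt_def) blast

lemma RtD:
  "Rt V f \<Longrightarrow> coeff f m \<noteq> 0 \<Longrightarrow> set_mset m \<subseteq> {X, Xi} \<union> V"
  "Rt V f \<Longrightarrow> set_mset k \<subseteq> V \<Longrightarrow> slice k (coeff f) \<in> R_ring"
  unfolding Rt_def by blast+

lemma Rt_add: "Rt V f \<Longrightarrow> Rt V g \<Longrightarrow> Rt V (f + g)"
proof -
  assume f: "Rt V f" and g: "Rt V g"
  have "slice k (coeff (f + g)) = (\<lambda>m. slice k (coeff f) m + slice k (coeff g) m)" for k
    by (auto simp: slice_def coeff_simps)
  moreover have "coeff f m \<noteq> 0 \<or> coeff g m \<noteq> 0" if "coeff (f + g) m \<noteq> 0" for m
    using that by (auto simp: coeff_simps)
  ultimately show ?thesis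
    by (intro RtI) (metis RtD(1)[OF f] RtD(1)[OF g], simp add: R_ring_add RtD(2)[OF f] RtD(2)[OF g])
qed

lemma Rt_sum: "(\<And>i. i \<in> A \<Longrightarrow> Rt V (f i)) \<Longrightarrow> Rt V (sum f A)"
  by (induction A rule: infinite_finite_induct) (auto simp: Rt_zero Rt_add)

lemma Rt_lscale: "Rt V f \<Longrightarrow> Rt V (lscale c f)"
proof -
  assume f: "Rt V f"
  have "slice k (coeff (lscale c f)) = (\<lambda>m. scaleC c (slice k (coeff f) m))" for k
    by (auto simp: slice_def lscale.rep_eq)
  moreover have "coeff f m \<noteq> 0" if "coeff (lscale c f) m \<noteq> 0" for m
    using that by (auto simp: lscale.rep_eq)
  ultimately show ?thesis
    by (intro RtI) (metis RtD(1)[OF f], simp add: R_ring_scale RtD(2)[OF f])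
qed

lemma Rt_uminus: "Rt V f \<Longrightarrow> Rt V (- f)"
  using Rt_lscale[of V f "- 1"] by (simp add: lscale_uminus)

lemma Rt_diff: "Rt V f \<Longrightarrow> Rt V g \<Longrightarrow> Rt V (f - g)"
  using Rt_add[of V f "- g"] Rt_uminus[of V g] by simp

lemma Rt_linv: "Rt V f \<Longrightarrow> Rt V (linv f)"
proof -
  assume f: "Rt V f"
  have "slice k (coeff (linv f)) = (\<lambda>m. signed (mpar k) (sinv (slice k (coeff f)) m))" for k
    by (auto simp: slice_def coeff_linv sinv_def mpar_add signed_def)
  moreover have "coeff f m \<noteq> 0" if "coeff (linv f) m \<noteq> 0" for m
    using that by (auto simp: coeff_linv)
  ultimately show ?thesis
    by (intro RtI) (metis RtD(1)[OF f], simp add: R_ring_signed R_ring_sinv RtD(2)[OF f])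
qed

lemma Rt_lder:
  assumes v: "v = X \<or> v = Xi" and V: "V \<inter> {X, Xi} = {}" and f: "Rt V f"
  shows "Rt V (lder v f)"
  unfolding Rt_def
proof (intro conjI allI impI)
  fix m assume "coeff (lder v f) m \<noteq> 0"
  then have "coeff f (add_mset v m) \<noteq> 0" by (rule coeff_lder_nonzero)
  then have "set_mset (add_mset v m) \<subseteq> {X, Xi} \<union> V" by (rule RtD(1)[OF f])
  then show "set_mset m \<subseteq> {X, Xi} \<union> V" by simp
next
  fix k assume k: "set_mset k \<subseteq> V"
  then have vk: "v \<notin># k" using v V by auto
  have "below v m = False" if "vodd v" for m using v that by auto
  then have "slice k (coeff (lder v f)) = sderiv v (slice k (coeff f))"
    using v vk count_eq_zero_iff[of k v, THEN iffD2, OF vk]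
    by (auto simp: slice_def lder.rep_eq sderiv_alt fun_eq_iff)
  then show "slice k (coeff (lder v f)) \<in> R_ring"
    using f k v by (simp add: Rt_def R_ring_sderiv)
qed

lemma space_less: "u \<in> {X, Xi} \<Longrightarrow> v \<notin> {X, Xi} \<Longrightarrow> u < v"
  by (cases v) (auto simp: less_var_def)

lemma sum_submultisets_disjoint:
  assumes "set_mset m \<inter> set_mset k = {}"
  shows "(\<Sum>j | j \<subseteq># m + k. F j (m + k - j)) = (\<Sum>k1 | k1 \<subseteq># k. \<Sum>m1 | m1 \<subseteq># m. F (m1 + k1) ((m - m1) + (k - k1)))"
proof -
  let ?S = "set_mset m"
  have "(\<Sum>j | j \<subseteq># m + k. F j (m + k - j)) =
    (\<Sum>(k1, m1)\<in>{k1. k1 \<subseteq># k} \<times> {m1. m1 \<subseteq># m}. F (m1 + k1) ((m - m1) + (k - k1)))"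
  proof (rule sum.reindex_bij_witness[where i = "\<lambda>(k1, m1). m1 + k1" and
        j = "\<lambda>j. (filter_mset (\<lambda>v. v \<notin> ?S) j, filter_mset (\<lambda>v. v \<in> ?S) j)"])
    fix j assume j: "j \<in> {j. j \<subseteq># m + k}"
    have fm: "filter_mset (\<lambda>v. v \<in> ?S) m = m" "filter_mset (\<lambda>v. v \<notin> ?S) m = {#}"
      by (auto simp: filter_mset_eq_conv)
    have fk: "filter_mset (\<lambda>v. v \<notin> ?S) k = k" "filter_mset (\<lambda>v. v \<in> ?S) k = {#}"
      using assms by (auto simp: filter_mset_eq_conv)
    have s: "filter_mset (\<lambda>v. v \<in> ?S) j \<subseteq># m" "filter_mset (\<lambda>v. v \<notin> ?S) j \<subseteq># k"
      using j multiset_filter_mono[of j "m + k" "\<lambda>v. v \<in> ?S"] multiset_filter_mono[of j "m + k" "\<lambda>v. v \<notin> ?S"]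
      by (simp_all add: fm fk)
    have e: "filter_mset (\<lambda>v. v \<in> ?S) j + filter_mset (\<lambda>v. v \<notin> ?S) j = j"
      by (rule multiset_partition[symmetric])
    show "(\<lambda>(k1, m1). m1 + k1) (filter_mset (\<lambda>v. v \<notin> ?S) j, filter_mset (\<lambda>v. v \<in> ?S) j) = j"
      using e by simp
    show "(filter_mset (\<lambda>v. v \<notin> ?S) j, filter_mset (\<lambda>v. v \<in> ?S) j) \<in> {k1. k1 \<subseteq># k} \<times> {m1. m1 \<subseteq># m}"
      using s by simp
    obtain m2 k2 where mk: "m = filter_mset (\<lambda>v. v \<in> ?S) j + m2" "k = filter_mset (\<lambda>v. v \<notin> ?S) j + k2"
      using s by (meson subset_mset.le_iff_add)
    have "m + k - j = (m - filter_mset (\<lambda>v. v \<in> ?S) j) + (k - filter_mset (\<lambda>v. v \<notin> ?S) j)"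
    proof -
      have "m + k = j + (m2 + k2)" using mk e by (metis (no_types, lifting) add.assoc add.left_commute)
      moreover have "m - filter_mset (\<lambda>v. v \<in> ?S) j = m2" "k - filter_mset (\<lambda>v. v \<notin> ?S) j = k2"
        using mk by (metis add_diff_cancel_left')+
      ultimately show ?thesis by simp
    qed
    then show "(case (filter_mset (\<lambda>v. v \<notin> ?S) j, filter_mset (\<lambda>v. v \<in> ?S) j) of
        (k1, m1) \<Rightarrow> F (m1 + k1) ((m - m1) + (k - k1))) = F j (m + k - j)"
      using e by simp
  next
    fix y assume "y \<in> {k1. k1 \<subseteq># k} \<times> {m1. m1 \<subseteq># m}"
    then obtain k1 m1 where y: "y = (k1, m1)" "k1 \<subseteq># k" "m1 \<subseteq># m" by auto
    then have "set_mset k1 \<subseteq> set_mset k" "set_mset m1 \<subseteq> set_mset m" by (simp_all add: set_mset_mono)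
    then have "filter_mset (\<lambda>v. v \<notin> ?S) m1 = {#}" "filter_mset (\<lambda>v. v \<notin> ?S) k1 = k1"
      "filter_mset (\<lambda>v. v \<in> ?S) m1 = m1" "filter_mset (\<lambda>v. v \<in> ?S) k1 = {#}"
      using assms by (auto simp: filter_mset_eq_conv)
    then have "filter_mset (\<lambda>v. v \<notin> ?S) (m1 + k1) = k1" "filter_mset (\<lambda>v. v \<in> ?S) (m1 + k1) = m1"
      by simp_all
    then show "(filter_mset (\<lambda>v. v \<notin> ?S) ((\<lambda>(k1, m1). m1 + k1) y), filter_mset (\<lambda>v. v \<in> ?S) ((\<lambda>(k1, m1). m1 + k1) y)) = y"
      by (simp add: y)
    show "(\<lambda>(k1, m1). m1 + k1) y \<in> {j. j \<subseteq># m + k}"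
      using y by (auto intro: subset_mset.add_mono)
  qed
  then show ?thesis by (simp only: sum.cartesian_product)
qed

lemma legal_add_space:
  assumes "set_mset m \<subseteq> {X, Xi}" "set_mset k \<inter> {X, Xi} = {}"
  shows "legal (m + k) \<longleftrightarrow> legal m \<and> legal k"
proof -
  have "count m v = 0 \<or> count k v = 0" for v
    using assms by (metis IntI count_eq_zero_iff empty_iff subsetD)
  then have "count (m + k) v \<le> 1 \<longleftrightarrow> count m v \<le> 1 \<and> count k v \<le> 1" for v
    by (metis add.left_neutral add.right_neutral count_union zero_le)
  then show ?thesis unfolding legal_def by blast
qed

text \<open>Space variables precede time variables. So \<open>m1\<close> and \<open>k2\<close> have
  no inversions, whereas every odd pair from \<open>k1\<close> and \<open>m2\<close> is one.\<close>

lemma msign_space: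
  assumes m: "set_mset m1 \<subseteq> {X, Xi}" "set_mset m2 \<subseteq> {X, Xi}"
    and k: "set_mset k1 \<inter> {X, Xi} = {}" "set_mset k2 \<inter> {X, Xi} = {}"
    and leg: "legal (m1 + k1)" "legal (m2 + k2)"
  shows "msign (m1 + k1) (m2 + k2) = ((msign m1 m2 \<noteq> msign k1 k2) \<noteq> (mpar k1 \<and> mpar m2))"
proof -
  have less: "u < v" if "u \<in># m1 \<or> u \<in># m2" "v \<in># k1 \<or> v \<in># k2" for u v
  proof (rule space_less)
    show "u \<in> {X, Xi}" using that(1) m by blast
    show "v \<notin> {X, Xi}" using that(2) k by blast
  qed
  have "{(u, v). u \<in> oddset m1 \<and> v \<in> oddset k2 \<and> v < u} = {}"
    using less less_asym unfolding oddset_def by blast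
  then have 1: "msign m1 k2 = False" unfolding msign_alt by (simp only: card.empty even_zero) simp
  have "{(u, v). u \<in> oddset k1 \<and> v \<in> oddset m2 \<and> v < u} = oddset k1 \<times> oddset m2"
    using less unfolding oddset_def by blast
  then have 2: "msign k1 m2 = (mpar k1 \<and> mpar m2)"
    using legal_addD[OF leg(1)] legal_addD[OF leg(2)]
    unfolding msign_alt by (simp add: card_cartesian_product mpar_oddset)
  show ?thesis
    unfolding msign_add_left[OF leg(1)] msign_add_right[OF leg(2)] 1 2 by blast
qed

text \<open>A coefficient of the product is thus a finite sum of products in \<open>R\<close>.
  Applying \<open>lgi\<close> moves \<open>k1\<close> past the slice of \<open>g\<close>, but it
  also sees the time monomial \<open>k - k1\<close>; the sign
  \<open>mpar k1 \<and> mpar (k - k1)\<close> undoes that.\<close>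

lemma slice_mult:
  assumes k: "set_mset k \<inter> {X, Xi} = {}" "legal k"
  shows "slice k (coeff (f * g)) = (\<lambda>m. \<Sum>k1 | k1 \<subseteq># k. signed (msign k1 (k - k1) \<noteq> (mpar k1 \<and> mpar (k - k1)))
     (smult (slice k1 (coeff f)) (slice (k - k1) (coeff (lgi (mpar k1) g))) m))"
proof
  fix m
  show "slice k (coeff (f * g)) m = (\<Sum>k1 | k1 \<subseteq># k. signed (msign k1 (k - k1) \<noteq> (mpar k1 \<and> mpar (k - k1)))
     (smult (slice k1 (coeff f)) (slice (k - k1) (coeff (lgi (mpar k1) g))) m))"
  proof (cases "legal m")
    case False
    then have "\<not> legal (m + k)" using legal_addD by blast
    then show ?thesis using False by (simp add: slice_def smult_def coeff_illegal)
  next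
    case leg: True
    show ?thesis
    proof (cases "set_mset m \<subseteq> {X, Xi}")
      case False
      have "sterm (slice k1 (coeff f)) (slice (k - k1) (coeff (lgi (mpar k1) g))) j (m - j) = 0"
        if "j \<subseteq># m" for j k1
      proof -
        have "set_mset m = set_mset j \<union> set_mset (m - j)"
          using that by (metis set_mset_union subset_mset.add_diff_inverse)
        then have "\<not> set_mset j \<subseteq> {X, Xi} \<or> \<not> set_mset (m - j) \<subseteq> {X, Xi}" using False by blast
        then show ?thesis by (auto simp: sterm_def slice_def)
      qed
      then show ?thesis using False leg by (auto simp: slice_def smult_alt)
    next
      case m: True
      have lmk: "legal (m + k)" using legal_add_space[OF m k(1)] leg k(2) by simp
      have dis: "set_mset m \<inter> set_mset k = {}" using m k by blast
      have st: "sterm (coeff f) (coeff g) (m1 + k1) ((m - m1) + (k - k1)) = signed (msign k1 (k - k1) \<noteq> (mpar k1 \<and> mpar (k - k1)))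
          (sterm (slice k1 (coeff f)) (slice (k - k1) (coeff (lgi (mpar k1) g))) m1 (m - m1))"
        if km: "k1 \<subseteq># k" "m1 \<subseteq># m" for k1 m1
      proof -
        obtain m2 where m2: "m = m1 + m2" using km(2) by (auto simp: subset_mset.le_iff_add)
        obtain k2 where k2: "k = k1 + k2" using km(1) by (auto simp: subset_mset.le_iff_add)
        have sets: "set_mset m1 \<subseteq> {X, Xi}" "set_mset m2 \<subseteq> {X, Xi}"
          "set_mset k1 \<inter> {X, Xi} = {}" "set_mset k2 \<inter> {X, Xi} = {}"
          using m k(1) by (auto simp: m2 k2)
        have l: "legal (m1 + k1)" "legal (m2 + k2)"
          by (rule legal_subset[OF lmk], simp add: m2 k2 add.assoc add.left_commute)+
        show ?thesis
          using sets
          by (auto simp: m2 k2 sterm_def slice_def msign_space[OF sets l] mpar_add lgi_def coeff_linv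
              gi_signed gi_grinv gi_gi signed_mult signed_def gi_def grinv_uminus)
      qed
      have "slice k (coeff (f * g)) m =
          (\<Sum>k1 | k1 \<subseteq># k. \<Sum>m1 | m1 \<subseteq># m. sterm (coeff f) (coeff g) (m1 + k1) ((m - m1) + (k - k1)))"
        unfolding slice_def if_P[OF m] coeff_mult[OF lmk] by (rule sum_submultisets_disjoint[OF dis])
      also have "\<dots> = (\<Sum>k1 | k1 \<subseteq># k. \<Sum>m1 | m1 \<subseteq># m. signed (msign k1 (k - k1) \<noteq> (mpar k1 \<and> mpar (k - k1)))
          (sterm (slice k1 (coeff f)) (slice (k - k1) (coeff (lgi (mpar k1) g))) m1 (m - m1)))"
        by (intro sum.cong refl st) simp_all
      finally show ?thesis
        by (simp only: smult_alt if_P[OF leg] signed_sum)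
    qed
  qed
qed

lemma Rt_mult:
  assumes V: "V \<inter> {X, Xi} = {}" and f: "Rt V f" and g: "Rt V g"
  shows "Rt V (f * g)"
  unfolding Rt_def
proof (intro conjI allI impI)
  fix m assume "coeff (f * g) m \<noteq> 0"
  then obtain k l where "m = k + l" "coeff f k \<noteq> 0" "coeff g l \<noteq> 0" by (rule coeff_mult_nonzero)
  then show "set_mset m \<subseteq> {X, Xi} \<union> V" using RtD(1)[OF f, of k] RtD(1)[OF g, of l] by simp
next
  fix k assume k: "set_mset k \<subseteq> V"
  then have kX: "set_mset k \<inter> {X, Xi} = {}" using V by blast
  show "slice k (coeff (f * g)) \<in> R_ring"
  proof (cases "legal k")
    case True
    have lg: "Rt V (lgi p g)" for p using g by (cases p) (auto simp: Rt_linv)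
    have "set_mset k1 \<subseteq> V \<and> set_mset (k - k1) \<subseteq> V" if "k1 \<subseteq># k" for k1
      using k set_mset_mono[OF that] set_mset_mono[of "k - k1" k] by auto
    then show ?thesis
      unfolding slice_mult[OF kX True]
      by (intro R_ring_sum R_ring_signed R_ring_smult RtD(2)[OF f] RtD(2)[OF lg]) auto
  next
    case False
    then have "\<not> legal (m + k)" for m using legal_addD(2) by blast
    then have "slice k (coeff (f * g)) = (\<lambda>m. 0)"
      by (auto simp: slice_def coeff_illegal fun_eq_iff)
    then show ?thesis by (simp add: R_ring_zero)
  qed
qed

lemma Rt_space:
  assumes "space c" shows "Rt V (Lser (tensor c a))"
proof -
  have c: "coeff (Lser (tensor c a)) = tensor c a"
    using assms by (subst Lser_inverse) (auto simp: tensor_def space_def, metis scaleC_zero_left)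
  have "slice k (tensor c a) \<in> R_ring" for k
  proof -
    let ?c = "\<lambda>m. if set_mset m \<subseteq> {X, Xi} then c (m + k) else 0"
    have "slice k (tensor c a) = tensor ?c a" by (auto simp: slice_def tensor_def)
    moreover have "space ?c" using assms legal_addD(1) by (auto simp: space_def split: if_splits)
    ultimately show ?thesis by (simp add: R_ring_tensor)
  qed
  moreover have "set_mset m \<subseteq> {X, Xi}" if "tensor c a m \<noteq> 0" for m
    using that assms by (auto simp: tensor_def space_def) (metis scaleC_zero_left insertE singletonD subsetD)+
  ultimately show ?thesis unfolding Rt_def c by blast
qed

lemma Rt_one: "Rt V 1"
proof -
  have "1 = Lser (tensor (\<lambda>m. if m = {#} then 1 else 0) 1 :: 'a ser)"
    by (subst coeff_inverse[symmetric], rule arg_cong[where f = Lser])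
      (auto simp: coeff_simps sconst_def tensor_def scaleC_one)
  then show ?thesis using Rt_space[of "\<lambda>m. if m = {#} then 1 else 0" V "1 :: 'a"] by (simp add: space_def)
qed

lemma Rt_Xi: "Rt V (lvar Xi)"
proof -
  have "lvar Xi = Lser (tensor (\<lambda>m. if m = {#Xi#} then 1 else 0) 1 :: 'a ser)"
    by (subst coeff_inverse[symmetric], rule arg_cong[where f = Lser])
      (auto simp: lvar.rep_eq svar_def tensor_def scaleC_one)
  then show ?thesis using Rt_space[of "\<lambda>m. if m = {#Xi#} then 1 else 0" V "1 :: 'a"] by (simp add: space_def)
qed

lemma Rt_lD: "V \<inter> {X, Xi} = {} \<Longrightarrow> Rt V f \<Longrightarrow> Rt V (lD f)"
  unfolding lD_def by (intro Rt_add Rt_mult Rt_lder Rt_Xi) auto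

lemma Rt_Dc:
  assumes V: "V \<inter> {X, Xi} = {}" and f: "Rt V f" shows "Rt V (Dc m r f)"
proof -
  have "Rt V (lgi p f)" for p using f by (cases p) (auto simp: Rt_linv)
  then have "Rt V ((lD ^^ r) (lgi p f))" for p by (induction r) (auto simp: Rt_lD[OF V])
  then show ?thesis by (simp add: Dc_def Rt_lscale)
qed

text \<open>For operators of order at most zero only finitely many pairs \<open>(m, r)\<close> reach
  a given coefficient, so closure of \<open>R[[t]]\<close> under finite sums suffices.\<close>

lemma Rt_bop_mult:
  assumes V: "V \<inter> {X, Xi} = {}" and P: "\<And>n. Rt V (cf P n)" "degle 0 P" and Q: "\<And>n. Rt V (cf Q n)" "degle 0 Q"
  shows "Rt V (cf (P * Q) n)"
proof -
  have "lsum (mterm (cf P) (cf Q) n) = sum (mterm (cf P) (cf Q) n) ({n..0} \<times> {..nat (- n)})"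
  proof (rule lsum_finite)
    fix i assume i: "i \<notin> {n..0} \<times> {..nat (- n)}"
    obtain m r where mr: "i = (m, r)" by (cases i)
    then have "m > 0 \<or> n - m + int r > 0" using i by auto
    then show "mterm (cf P) (cf Q) n i = 0" using P(2) Q(2) by (auto simp: mr mterm_def degle_def)
  qed simp
  moreover have "Rt V (mterm (cf P) (cf Q) n i)" for i
    unfolding mterm_def using P(1) Q(1) by (cases i) (simp add: Rt_mult[OF V] Rt_Dc[OF V])
  ultimately show ?thesis unfolding cf_times by (simp add: Rt_sum)
qed

lemma Rt_cf_one: "Rt V (cf 1 n)" by (simp add: cf_simps Rt_one Rt_zero)

lemma Rt_binv:
  assumes V: "V \<inter> {X, Xi} = {}" and S: "degle (- 1) (1 - S)" "\<And>n. Rt V (cf S n)"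
  shows "Rt V (cf (binv S) n)"
proof -
  have N: "Rt V (cf (1 - S) n)" for n
    unfolding cf_simps(5) by (intro Rt_diff Rt_cf_one S(2))
  have d: "degle 0 ((1 - S) ^ j)" for j by (rule degle_mono[OF degle_power[OF S(1)]]) simp
  have "Rt V (cf ((1 - S) ^ j) n)" for j n
  proof (induction j arbitrary: n)
    case (Suc j)
    then show ?case using N d[of 1] d[of j] by (simp add: Rt_bop_mult[OF V])
  qed (simp add: Rt_cf_one)
  then show ?thesis by (simp add: cf_binv cf_sum Rt_sum Rt_zero del: sum.lessThan_Suc)
qed


subsection \<open>Dressing operators\<close>

lemma E_hat_raw:
  assumes "Q \<in> E_hat V" obtains q where "Q = raw q"
proof -
  have leg: "Q n m \<noteq> 0 \<Longrightarrow> legal m" for n m using assms by (auto simp: E_hat_def R_time_def)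
  obtain C where C: "\<And>n m. Q n m \<noteq> 0 \<Longrightarrow> n - C \<le> int (mweight m)" using assms by (auto simp: E_hat_def)
  have c: "coeff (Lser (Q n)) = Q n" for n using leg by (subst Lser_inverse) auto
  have "bounded_by C (\<lambda>n. Lser (Q n))"
    using C by (force simp: bounded_by_def ordb_def c xweight_def)
  then have "cf (Bop (\<lambda>n. Lser (Q n))) = (\<lambda>n. Lser (Q n))" by (subst Bop_inverse) auto
  then have "Q = raw (Bop (\<lambda>n. Lser (Q n)))" by (simp add: raw_def c)
  then show ?thesis by (rule that)
qed

text \<open>The description of \<open>oinv\<close> asks for an inverse inside
  \<open>E_hat V\<close>, so the coefficients of the Neumann series have to be shown to lie in
  \<open>R[[t]]\<close>. Uniqueness is the usual argument with a two-sided inverse, valid in all of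
  \<open>bop\<close>.\<close>

lemma oinv_raw:
  assumes V: "V \<inter> {X, Xi} = {}" and S: "degle (- 1) (1 - S)" "\<And>n. Rt V (cf S n)"
  shows "oinv V (raw S) = raw (binv S)"
  unfolding oinv_def
proof (rule the_equality)
  note inv = binv[OF S(1)]
  have "raw (binv S) n m \<noteq> 0 \<Longrightarrow> n - 0 \<le> int (mweight m)" for n m
    using inv(3) by (cases "n > 0") (auto simp: raw_def degle_def coeff_simps)
  moreover have "raw (binv S) n \<in> R_time V" for n
    using Rt_binv[OF V S] by (simp add: raw_def Rt_iff)
  ultimately have "raw (binv S) \<in> E_hat V"
    unfolding E_hat_def by blast
  then show "raw (binv S) \<in> E_hat V \<and> raw S \<odot> raw (binv S) = oone \<and> raw (binv S) \<odot> raw S = oone"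
    by (simp add: raw_times raw_one inv)
next
  fix Q assume Q: "Q \<in> E_hat V \<and> raw S \<odot> Q = oone \<and> Q \<odot> raw S = oone"
  then obtain q where q: "Q = raw q" using E_hat_raw by blast
  then have "q * S = 1" using Q by (simp add: raw_times raw_one raw_inject)
  then have "q * S * binv S = binv S" by simp
  then show "Q = raw (binv S)" using binv(1)[OF S(1)] by (simp add: q mult.assoc)
qed

text \<open>The parity of the coefficient of \<open>D^-j\<close> makes each summand even, which is
  recorded as \<open>ohat s = s\<close>.\<close>

lemma Gamma_raw:
  assumes S: "S \<in> Gamma0_hat V"
  obtains s where "S = raw s" "degle (- 1) (1 - s)" "\<And>n. Rt V (cf s n)" "ohat s = s"
proof -
  have S': "S 0 = sconst 1" "\<And>n. n > 0 \<Longrightarrow> S n = 0" "\<And>n. n < 0 \<Longrightarrow> S n \<in> R_time V \<and> has_parity (odd n) (S n)"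
  proof -
    show "S 0 = sconst 1" "\<And>n. n > 0 \<Longrightarrow> S n = 0" using S by (auto simp: Gamma0_hat_def Gamma_over_def)
    fix n :: int assume "n < 0"
    then have "- n \<ge> 1" by simp
    then show "S n \<in> R_time V \<and> has_parity (odd n) (S n)"
      using S unfolding Gamma0_hat_def Gamma_over_def by fastforce
  qed
  have leg: "S n m \<noteq> 0 \<Longrightarrow> legal m" for n m
    using S'(1) S'(2)[of n] S'(3)[of n]
    by (cases "n = 0"; cases "n > 0") (auto simp: sconst_def R_time_def split: if_splits)
  have c: "coeff (Lser (S n)) = S n" for n using leg by (subst Lser_inverse) auto
  have "ordb (n - 0) (Lser (S n))" for n
  proof (cases "n > 0")
    case True
    have "coeff (Lser (S n)) k = 0" for k
    proof -
      have "coeff (Lser (S n)) k = S n k" by (simp only: c)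
      then show ?thesis using S'(2)[OF True] by simp
    qed
    then show ?thesis by (simp add: ordb_def)
  qed (simp add: ordb_0)
  then have "bounded_by 0 (\<lambda>n. Lser (S n))" unfolding bounded_by_def by blast
  then have cf: "cf (Bop (\<lambda>n. Lser (S n))) n = Lser (S n)" for n by (subst Bop_inverse) auto
  let ?s = "Bop (\<lambda>n. Lser (S n))"
  have cS: "coeff (cf ?s n) = S n" for n by (simp only: cf c)
  have "coeff (cf ?s 0) = coeff 1" by (simp only: cS S'(1) one_lser.rep_eq)
  then have one: "cf ?s 0 = 1" by (simp only: coeff_inject)
  have zero: "cf ?s n = 0" if "n > 0" for n
  proof -
    have "coeff (cf ?s n) = coeff 0" by (simp only: cS S'(2)[OF that] zero_lser.rep_eq zero_fun_def)
    then show ?thesis by (simp only: coeff_inject)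
  qed
  show ?thesis
  proof
    show "S = raw ?s" by (simp only: raw_def cS)
    show "degle (- 1) (1 - ?s)"
      unfolding degle_def by (auto simp: cf_simps one zero)
    show "Rt V (cf ?s n)" for n
    proof -
      consider "n < 0" | "n = 0" | "n > 0" by linarith
      then show ?thesis
      proof cases
        case 1
        then show ?thesis using S'(3) by (simp only: Rt_iff cS)
      qed (simp_all only: one zero Rt_one Rt_zero)
    qed
    show "ohat ?s = ?s"
    proof (intro bop_eqI lser_eqI)
      fix n m
      show "coeff (cf (ohat ?s) n) m = coeff (cf ?s n) m"
      proof (cases "n < 0")
        case True
        then have "S n m \<in> hpart (odd n \<noteq> mpar m)" using S'(3) by (auto simp: has_parity_def)
        from grinv_hpart[OF this] show ?thesis
          by (auto simp: cf_ohat coeff_signed coeff_linv coeff_simps cS signed_def)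
      next
        case False
        then show ?thesis using one zero[of n] by (cases "n = 0") (auto simp: cf_ohat)
      qed
    qed
  qed
qed

lemma Gamma0_hat_space: "Gamma0 = (Gamma0_hat {} :: 'a::supercommutative_algebra oper set)"
proof -
  have "R_time {} = (R_ring :: 'a ser set)"
  proof (intro equalityI subsetI)
    fix f :: "'a ser" assume f: "f \<in> R_time {}"
    then have "(\<lambda>m. if set_mset m \<subseteq> {X, Xi} then f (m + {#}) else 0) \<in> R_ring"
      unfolding R_time_def by fastforce
    moreover have "(\<lambda>m. if set_mset m \<subseteq> {X, Xi} then f (m + {#}) else 0) = f"
      using f by (auto simp: R_time_def fun_eq_iff)
    ultimately show "f \<in> R_ring" by simp
  next
    fix f :: "'a ser" assume f: "f \<in> R_ring"
    have s: "legal m \<and> set_mset m \<subseteq> {X, Xi}" if nz: "f m \<noteq> 0" for m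
    proof -
      obtain N :: nat and a c where ac: "\<forall>i<N. space (c i)" "f = (\<lambda>m. \<Sum>i<N. tensor (c i) (a i) m)"
        using f unfolding R_ring_iff by blast
      have "(\<Sum>i<N. tensor (c i) (a i) m) \<noteq> 0" using nz ac(2) by metis
      then obtain i where "i \<in> {..<N}" "tensor (c i) (a i) m \<noteq> 0"
        by (rule sum.not_neutral_contains_not_neutral)
      then have "c i m \<noteq> 0" by (auto simp: tensor_def)
      then show ?thesis using ac(1) \<open>i \<in> {..<N}\<close> by (auto simp: space_def)
    qed
    then have "(\<lambda>m. if set_mset m \<subseteq> {X, Xi} then f (m + {#}) else 0) = f" by fastforce
    then show "f \<in> R_time {}" using s f unfolding R_time_def by auto
  qed
  then show ?thesis by (simp add: Gamma0_def Gamma0_hat_def)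
qed

section \<open>Time-independent and substituted coefficients\<close>

lemma Rt_mono:
  assumes "Rt {} f" "V \<inter> {X, Xi} = {}" shows "Rt V f"
  unfolding Rt_def
proof (intro conjI allI impI)
  fix m assume "coeff f m \<noteq> 0"
  then show "set_mset m \<subseteq> {X, Xi} \<union> V" using RtD(1)[OF assms(1)] by blast
next
  fix k assume k: "set_mset k \<subseteq> V"
  show "slice k (coeff f) \<in> R_ring"
  proof (cases "k = {#}")
    case True
    then show ?thesis using assms(1) by (simp add: Rt_def)
  next
    case False
    have "coeff f (m + k) = 0" for m
    proof (rule ccontr)
      assume "coeff f (m + k) \<noteq> 0"
      then have "set_mset k \<subseteq> {X, Xi}" using RtD(1)[OF assms(1), of "m + k"] by simp
      then have "set_mset k = {}" using k assms(2) by blast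
      then show False using False by simp
    qed
    then have "slice k (coeff f) = (\<lambda>m. 0)" by (auto simp: slice_def)
    then show ?thesis by (simp add: R_ring_zero)
  qed
qed

lemma lder_space: "Rt {} f \<Longrightarrow> time v \<Longrightarrow> lder v f = 0"
proof (rule lser_eqI)
  fix m assume f: "Rt {} f" and v: "time v"
  show "coeff (lder v f) m = coeff 0 m"
  proof (rule ccontr)
    assume "coeff (lder v f) m \<noteq> coeff 0 m"
    then have "coeff f (add_mset v m) \<noteq> 0" using coeff_lder_nonzero by (simp add: coeff_simps)
    then have "set_mset (add_mset v m) \<subseteq> {X, Xi} \<union> {}" by (rule RtD(1)[OF f])
    then show False using v by (simp add: time_def)
  qed
qed

lemma lsub_space:
  assumes "Rt {} f" "K \<subseteq> range Tm" shows "lsub K f = f"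
proof (rule lser_eqI)
  fix k assume k: "legal k"
  have s: "image_mset phi m = m \<and> set_mset m \<inter> K = {}" if "coeff f m \<noteq> 0" for m
  proof -
    have "set_mset m \<subseteq> {X, Xi}" using RtD(1)[OF assms(1) that] by simp
    moreover from this have "image_mset phi m = image_mset id m" by (intro image_mset_cong) auto
    ultimately show ?thesis using assms(2) by auto
  qed
  have "(\<Sum>m\<in>fiber K k. coeff f m) = (\<Sum>m\<in>fiber K k. if m = k then coeff f k else 0)"
    using s by (intro sum.cong) (auto simp: fiber_def)
  also have "\<dots> = (if k \<in> fiber K k then coeff f k else 0)" by (simp add: sum.delta)
  also have "\<dots> = coeff f k" using s[of k] by (auto simp: fiber_def)
  finally show "coeff (lsub K f) k = coeff f k" by (simp add: coeff_lsub[OF k])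
qed

lemma fiber_add_spaces:
  assumes "K \<subseteq> range Tm" "set_mset m \<subseteq> {X, Xi}"
  shows "fiber K (m + k) = (+) m ` fiber K k"
  using assms(2)
proof (induction m)
  case (add v m)
  have "fiber K (add_mset v (m + k)) = add_mset v ` fiber K (m + k)"
    using fiber_add_space[OF assms(1), of v "m + k"] add.prems by auto
  then show ?case using add by (simp add: image_image)
qed auto

text \<open>The hierarchies invert \<open>S\<close> over the variables \<open>times_std\<close>, so
  the substituted coefficients must be in the corresponding ring. Each slice is a finite sum, over a
  fiber, of slices of \<open>f\<close>.\<close>

lemma Rt_lsub:
  assumes f: "Rt times_pm f" and K: "K \<subseteq> range Tm"
  shows "Rt times_std (lsub K f)"
  unfolding Rt_def
proof (intro conjI allI impI)
  fix m assume "coeff (lsub K f) m \<noteq> 0"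
  then obtain m' where m': "m' \<in> fiber K m" "coeff f m' \<noteq> 0" using coeff_lsub_nonzero by blast
  then have "set_mset m' \<subseteq> {X, Xi} \<union> times_pm" using RtD(1)[OF f] by blast
  then have "phi ` set_mset m' \<subseteq> {X, Xi} \<union> times_std" by (auto simp: times_pm_def times_std_def)
  moreover have "set_mset m = phi ` set_mset m'" using m'(1) by (auto simp: fiber_def)
  ultimately show "set_mset m \<subseteq> {X, Xi} \<union> times_std" by simp
next
  fix k assume k: "set_mset k \<subseteq> times_std"
  then have kX: "set_mset k \<inter> {X, Xi} = {}" by (auto simp: times_std_def)
  show "slice k (coeff (lsub K f)) \<in> R_ring"
  proof (cases "legal k")
    case True
    let ?A = "{k' \<in> fiber K k. set_mset k' \<subseteq> times_pm}"
    have "slice k (coeff (lsub K f)) m = (\<Sum>k'\<in>?A. slice k' (coeff f) m)" for m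
    proof (cases "set_mset m \<subseteq> {X, Xi} \<and> legal m")
      case m: True
      then have "legal (m + k)" using legal_add_space[OF _ kX] True by blast
      then have "slice k (coeff (lsub K f)) m = (\<Sum>k'\<in>fiber K k. coeff f (m + k'))"
        using m by (simp add: slice_def coeff_lsub fiber_add_spaces[OF K] sum.reindex)
      also have "\<dots> = (\<Sum>k'\<in>?A. coeff f (m + k'))"
      proof (rule sum.mono_neutral_right)
        show "\<forall>k'\<in>fiber K k - ?A. coeff f (m + k') = 0"
        proof (rule ballI, rule ccontr)
          fix k' assume k': "k' \<in> fiber K k - ?A" "coeff f (m + k') \<noteq> 0"
          then have "set_mset k' \<subseteq> {X, Xi} \<union> times_pm" using RtD(1)[OF f, of "m + k'"] by simp
          moreover have "set_mset k' \<inter> {X, Xi} = {}"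
          proof -
            have "set_mset k = phi ` set_mset k'" using k' by (auto simp: fiber_def)
            then show ?thesis using kX by (auto simp: image_iff)
          qed
          ultimately show False using k' by blast
        qed
      qed auto
      finally show ?thesis using m by (simp add: slice_def)
    next
      case False
      then have "\<not> set_mset m \<subseteq> {X, Xi} \<or> (\<forall>k'. \<not> legal (m + k'))" using legal_addD(1) by blast
      then show ?thesis by (auto simp: slice_def coeff_illegal)
    qed
    then have "slice k (coeff (lsub K f)) = (\<lambda>m. \<Sum>k'\<in>?A. slice k' (coeff f) m)" by blast
    moreover have "(\<lambda>m. \<Sum>k'\<in>?A. slice k' (coeff f) m) \<in> R_ring"
      by (intro R_ring_sum RtD(2)[OF f]) simp
    ultimately show ?thesis by simp
  next
    case False
    then have "\<not> legal (m + k)" for m using legal_addD(2) by blast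
    then have "slice k (coeff (lsub K f)) = (\<lambda>m. 0)"
      by (auto simp: slice_def coeff_illegal fun_eq_iff)
    then show ?thesis by (simp add: R_ring_zero)
  qed
qed


section \<open>The theorem\<close>

lemma substituted_solution:
  fixes S S0 :: "'a::supercommutative_algebra oper"
  assumes S: "S \<in> Gamma0_hat times_pm" and S0: "S0 \<in> Gamma0" and max: "maximal_SKP S S0"
    and \<sigma>: "\<And>v. \<sigma> v = (if v \<in> K then (\<lambda>_. 0) else svar (phi v))" and K: "K \<subseteq> range Tm"
  obtains s T0 where "osubst \<sigma> S = raw s" "degle (- 1) (1 - s)" "ohat s = s"
    "oinv times_std (raw s) = raw (binv s)"
    "nonneg (s * (bsub K UM * T0))" "bval 1 (s * (bsub K UM * T0) - 1)"
    "\<And>v. time v \<Longrightarrow> bder v T0 = 0"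
proof -
  obtain s where s: "S = raw s" "degle (- 1) (1 - s)" "\<And>n. Rt times_pm (cf s n)" "ohat s = s"
    using S by (rule Gamma_raw) blast
  obtain s0 where s0: "S0 = raw s0" "degle (- 1) (1 - s0)" "\<And>n. Rt {} (cf s0 n)"
    using S0 unfolding Gamma0_hat_space by (rule Gamma_raw) blast
  have pm: "times_pm \<inter> {X, Xi} = {}" and std: "times_std \<inter> {X, Xi} = {}"
    by (auto simp: times_pm_def times_std_def)
  define s' where "s' = bsub K s"
  define T0 where "T0 = binv s0"
  note inv0 = binv[OF s0(2), folded T0_def]
  have "oinv times_pm S0 = raw T0"
    unfolding s0(1) T0_def by (rule oinv_raw[OF pm s0(2) Rt_mono[OF s0(3) pm]])
  then have "raw (bneg (s * UM * T0)) = raw 0"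
    using max by (simp add: maximal_SKP_def s(1) raw_UM raw_times raw_bneg raw_zero)
  then have "bsub K (bneg (s * UM * T0)) = 0" by (simp add: raw_inject)
  moreover have RT0: "Rt {} (cf T0 n)" for n
    unfolding T0_def by (rule Rt_binv[OF _ s0(2,3)]) simp
  \<comment> \<open>Time independence passes from \<open>S0\<close> to its inverse, so no variable
    in it is renamed or sent to 0.\<close>
  then have "bsub K T0 = T0" by (intro bop_eqI) (simp add: cf_bsub lsub_space[OF _ K])
  ultimately have nn: "nonneg (s' * (bsub K UM * T0))"
    by (simp add: nonneg_bneg bsub_bneg bsub_mult[OF K] s'_def mult.assoc)
  have s': "degle (- 1) (1 - s')"
  proof -
    have "degle (- 1) (bsub K (1 - s))" using s(2) by (simp add: degle_def cf_bsub)
    then show ?thesis by (simp add: bsub_diff s'_def)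
  qed
  have hat: "ohat s' = s'"
  proof -
    have "ohat s' = bsub K (ohat s)" unfolding s'_def
      by (rule bop_eqI) (simp add: cf_ohat cf_bsub lsub_signed lsub_linv)
    then show ?thesis by (simp add: s(4) s'_def)
  qed
  have inv: "oinv times_std (raw s') = raw (binv s')"
    by (rule oinv_raw[OF std s']) (simp add: s'_def cf_bsub Rt_lsub[OF s(3) K])
  have "bval 1 (UM - 1 :: 'a bop)"
  proof -
    have "bval 1 ((bexp (bsum term1) - 1) * bexp (bsum term0) + (bexp (bsum term0) - 1 :: 'a bop))"
      by (intro bval_add bval_mult_left bexp_one H1_H0_props)
    then show ?thesis by (simp add: UM_def bop_diff_distrib)
  qed
  then have "bval 1 (bsub K UM - 1 :: 'a bop)"
    using bval_bsub[of 1 "UM - 1 :: 'a bop" K] by (simp add: bsub_diff)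
  then have "bval 1 (s' * ((bsub K UM - 1) * T0))" by (intro bval_mult_right bval_mult_left)
  then have Y: "bval 1 (s' * (bsub K UM * T0) - s' * T0)" by (simp add: bop_diff_distrib)
  \<comment> \<open>Both factors are monic of order zero, hence so is their product, although the
    two dressing operators are unrelated.\<close>
  have dT: "degle (- 1) (1 - s' * T0)"
  proof -
    have "degle (- 1 + 0) ((s0 - 1) * T0)"
      by (rule degle_mult[OF _ inv0(3)]) (use s0(2) in \<open>auto simp: degle_def cf_simps\<close>)
    then have "degle (- 1) (1 - T0)" by (simp add: bop_diff_distrib inv0(1))
    moreover have "degle 0 s'" using degle_diff[OF degle_one degle_mono[OF s']] by simp
    ultimately have "degle (0 + - 1) (s' * (1 - T0))" by (intro degle_mult)
    then have "degle (- 1) ((1 - s') + s' * (1 - T0))" using s' by (intro degle_add) simp_all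
    then show ?thesis by (simp add: bop_diff_distrib)
  qed
  \<comment> \<open>Modulo weight 1 the evolution operator is 1, so the product agrees there with
    \<open>s' * T0\<close>, whose coefficients at nonnegative powers are those of 1. The negative
    ones vanish exactly, by the hierarchy.\<close>
  have Y1: "bval 1 (s' * (bsub K UM * T0) - 1)"
    unfolding bval_def
  proof
    fix n
    let ?Y = "s' * (bsub K UM * T0)"
    show "val 1 (cf (?Y - 1) n)"
    proof (cases "n < 0")
      case True
      then show ?thesis using nn by (simp add: nonneg_def cf_simps)
    next
      case False
      then have "cf (1 - s' * T0) n = 0" using dT by (simp add: degle_def)
      then have "cf (?Y - 1) n = cf (?Y - s' * T0) n" by (simp add: cf_simps)
      then show ?thesis using Y by (simp add: bval_def)
    qed
  qed
  have const: "bder v T0 = 0" if "time v" for v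
    by (rule bop_eqI) (simp add: cf_bder lder_space[OF RT0 that] cf_simps)
  show ?thesis
  proof
    show "osubst \<sigma> S = raw s'" unfolding s(1) s'_def by (rule raw_bsub[OF \<sigma>])
  qed (fact s' hat inv nn Y1 const)+
qed

lemma ohat_dpow: "ohat H = H \<Longrightarrow> ohat (dpow H j) = dpow H j"
proof -
  assume H: "ohat H = H"
  have "ohat 1 = (1 :: 'a bop)" by (simp add: ohat_single flip: single_one)
  then have "ohat (H ^ j) = H ^ j" by (induction j) (simp_all add: ohat_mult H)
  moreover have "ohat (sc c P) = sc c (ohat P)" for c and P :: "'a bop"
    by (rule bop_eqI) (simp add: cf_ohat cf_sc linv_lscale lscale_signed)
  ultimately show ?thesis by (simp add: dpow_def)
qed

text \<open>At nonnegative powers the coefficients are the constants 1 and 0. So a flow of a monic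
  operator of order zero has only negative powers, as \<open>dressing\<close> requires.\<close>

lemma lder_monic:
  assumes "degle (- 1) (1 - s)" "n \<ge> 0" shows "lder v (cf s n) = 0"
proof -
  have "cf (1 - s) n = 0" using assms by (simp add: degle_def)
  then have "cf s n = (if n = 0 then 1 else 0)" by (simp add: cf_simps)
  then show ?thesis by simp
qed

lemma degle_bder: "degle (- 1) (1 - s) \<Longrightarrow> degle (- 1) (bder v s)"
  by (simp add: degle_def[of _ "bder v s"] cf_bder lder_monic)

lemma degle_flow: "degle (- 1) (1 - s) \<Longrightarrow> degle (- 1) (flow k s)"
  by (simp add: degle_def[of _ "flow k s"] cf_flow_zero lder_monic)

lemma nonneg_bder: "nonneg P \<Longrightarrow> nonneg (bder v P)"
  by (simp add: nonneg_def cf_bder)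

lemma nonneg_flow: "nonneg P \<Longrightarrow> nonneg (flow k P)"
  by (simp add: nonneg_def cf_flow_zero)

theorem mainTheorem2:
  shows "(osubst subst_J (U_M :: 'a::supercommutative_algebra oper) = U_J \<and>
      (\<forall>S \<in> Gamma0_hat times_pm. \<forall>S0 \<in> Gamma0.
        maximal_SKP S S0 \<longrightarrow> JSKP (osubst subst_J S :: 'a oper))) \<and>
    (osubst subst_MR (U_M :: 'a oper) = U_MR \<and>
      (\<forall>S \<in> Gamma0_hat times_pm. \<forall>S0 \<in> Gamma0.
        maximal_SKP S S0 \<longrightarrow> MRSKP (osubst subst_MR S :: 'a oper)))"
proof (intro conjI ballI impI)
  show "osubst subst_J (U_M :: 'a oper) = U_J"
    by (simp add: raw_UM raw_UJ raw_bsub[OF subst_J_alt] bsub_UM_J)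
  show "osubst subst_MR (U_M :: 'a oper) = U_MR"
    by (simp add: raw_UM raw_UMR raw_bsub[OF subst_MR_alt] bsub_UM_MR)
next
  fix S S0 :: "'a oper"
  assume S: "S \<in> Gamma0_hat times_pm" "S0 \<in> Gamma0" "maximal_SKP S S0"
  obtain s T0 where s: "osubst subst_J S = raw s" "degle (- 1) (1 - s)" "ohat s = s"
      "oinv times_std (raw s) = raw (binv s)"
      "nonneg (s * (bexp HJ * T0))" "bval 1 (s * (bexp HJ * T0) - 1)"
      "\<And>v. time v \<Longrightarrow> bder v T0 = 0"
    by (rule substituted_solution[OF S subst_J_alt, unfolded bsub_UM_J]) auto
  \<comment> \<open>The even and the odd Jacobian flows differ only in the generator
    \<open>K\<close>, so one dressing argument covers both.\<close>
  have flow: "oderiv v (raw s) = - (neg_part (raw (s * K) \<odot> raw (binv s)) \<odot> raw s)"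
    if v: "time v" and U: "bder v (bexp HJ) = K * bexp HJ" for v K
  proof -
    let ?Z = "bexp HJ * T0"
    have "bder v ?Z = K * ?Z"
      using v s(7)[OF v] by (simp add: bder_mult time_def U mult.assoc)
    then have "nonneg (bder v s * ?Z + s * (K * ?Z))"
      using nonneg_bder[OF s(5), of v] bder_mult_S[OF s(3) v, of ?Z] by simp
    from dressing[OF s(2) degle_bder[OF s(2)] s(5,6) this]
    show ?thesis by (simp add: raw_bder raw_times raw_bneg raw_uminus)
  qed
  have "oderiv (T (2 * n)) (raw s) = - (neg_part (raw (s * dp 2 ^ n) \<odot> raw (binv s)) \<odot> raw s)" if "n \<ge> 1" for n
    using flow[of "T (2 * n)" "dp 2 ^ n"] bder_exp_HJ(1)[of "n - 1", where 'a = 'a] that by simp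
  moreover have "oderiv (T (2 * n + 1)) (raw s) = - (neg_part (raw (s * (dp 2 ^ n * dxi)) \<odot> raw (binv s)) \<odot> raw s)" for n
    by (rule flow[OF time_simps(1) bder_exp_HJ(2)])
  ultimately show "JSKP (osubst subst_J S)"
    by (simp only: JSKP_def s(1,4) raw_d_x raw_d_xi raw_power raw_times mult.assoc) blast
next
  fix S S0 :: "'a oper"
  assume S: "S \<in> Gamma0_hat times_pm" "S0 \<in> Gamma0" "maximal_SKP S S0"
  obtain s T0 where s: "osubst subst_MR S = raw s" "degle (- 1) (1 - s)" "ohat s = s"
      "oinv times_std (raw s) = raw (binv s)"
      "nonneg (s * (bexp HMR * T0))" "bval 1 (s * (bexp HMR * T0) - 1)"
      "\<And>v. time v \<Longrightarrow> bder v T0 = 0"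
    by (rule substituted_solution[OF S subst_MR_alt, unfolded bsub_UM_MR]) auto
  have "MR_flow n (raw s) = - (neg_part (raw s \<odot> Dpow (int n) \<odot> oinv times_std (raw s)) \<odot> raw s)"
    if n: "n \<ge> 1" for n
  proof -
    let ?Z = "bexp HMR * T0"
    \<comment> \<open>\<open>flow_mult\<close> needs an even left factor; the exponential is even
      because its exponent is.\<close>
    have hat: "ohat (bexp HMR) = (bexp HMR :: 'a bop)"
      unfolding bexp_def by (rule ohat_bsum[OF fam_dpow[OF HMR_props(1,2)]]) (rule ohat_dpow[OF HMR_props(3)])
    have "flow n ?Z = dp (int n) * ?Z"
      by (simp add: flow_mult[OF hat] flow_exp_HMR[OF n] flow_const[OF s(7)] mult.assoc)
    then have "nonneg (flow n s * ?Z + s * (dp (int n) * ?Z))"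
      using nonneg_flow[OF s(5), of n] flow_mult[OF s(3), of n ?Z] by simp
    from dressing[OF s(2) degle_flow[OF s(2)] s(5,6) this]
    show ?thesis by (simp add: raw_flow raw_dp s(4) raw_times raw_bneg raw_uminus)
  qed
  then show "MRSKP (osubst subst_MR S)" by (simp add: MRSKP_def s(1))
qed

end
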